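(* Let $p\ge1$ and let $W$ and $W'$ be graphons over arbitrary probability spaces with $\|W\|_p,\|W'\|_p<\infty$. The following are equivalent: (i) $\delta_\square(W,W')=0$; (ii) $\delta_p(W,W')=0$; (iii) $W$ and $W'$ are equivalent.
   Context: A graphon over $(\Omega,\mathcal F,\pi)$ is a measurable symmetric $W:\Omega\times\Omega\to[0,\infty)$ with $\|W\|_1<\infty$, $\|W\|_p^p=\int|W|^p\,d\pi\,d\pi$. For graphons $W$ on $(\Omega,\pi)$, $W'$ on $(\Omega',\pi')$: $\delta_p(W,W')=\inf_\nu(\int|W(x,y)-W'(x',y')|^pd\nu(x,x')d\nu(y,y'))^{1/p}$ and $\delta_\square(W,W')=\inf_\nu\sup_{S,T}|\int_{S\times T}(W(x,y)-W'(x',y'))\,d\nu(x,x')\,d\nu(y,y')|$, infima over couplings $\nu$ of $\pi$ and $\pi'$, supremum over measurable $S,T\subseteq\Omega\times\Omega'$. $W$ and $W'$ are equivalent if there exist a probability space $\Omega''$, a graphon $U$ on it, and measure-preserving maps $\phi:\Omega\to\Omega''$, $\phi':\Omega'\to\Omega''$ with $W(x,y)=U(\phi(x),\phi(y))$ and $W'(x,y)=U(\phi'(x),\phi'(y))$ almost everywhere. *)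

theory Defs
  imports "HOL-Probability.Probability"
begin

definition graphon :: "'a measure \<Rightarrow> ('a \<Rightarrow> 'a \<Rightarrow> real) \<Rightarrow> bool" where
  "graphon M W \<longleftrightarrow>
     (\<lambda>(x, y). W x y) \<in> borel_measurable (M \<Otimes>\<^sub>M M) \<and>
     (\<forall>x y. W x y = W y x) \<and>
     (\<forall>x y. 0 \<le> W x y) \<and>
     (\<integral>\<^sup>+ z. ennreal \<bar>W (fst z) (snd z)\<bar> \<partial>(M \<Otimes>\<^sub>M M)) < \<infinity>"

definition Lp_norm_pow :: "real \<Rightarrow> 'a measure \<Rightarrow> ('a \<Rightarrow> 'a \<Rightarrow> real) \<Rightarrow> ennreal" where
  "Lp_norm_pow p M W = (\<integral>\<^sup>+ z. ennreal (\<bar>W (fst z) (snd z)\<bar> powr p) \<partial>(M \<Otimes>\<^sub>M M))"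

definition couplings :: "'a measure \<Rightarrow> 'b measure \<Rightarrow> ('a \<times> 'b) measure set" where
  "couplings M M' = {\<nu>. sets \<nu> = sets (M \<Otimes>\<^sub>M M') \<and>
                        distr \<nu> M fst = M \<and> distr \<nu> M' snd = M'}"

definition ennreal_root :: "real \<Rightarrow> ennreal \<Rightarrow> ennreal" where
  "ennreal_root p x = (if x = \<infinity> then \<infinity> else ennreal (enn2real x powr (1 / p)))"

definition delta_p :: "real \<Rightarrow> 'a measure \<Rightarrow> ('a \<Rightarrow> 'a \<Rightarrow> real)
                        \<Rightarrow> 'b measure \<Rightarrow> ('b \<Rightarrow> 'b \<Rightarrow> real) \<Rightarrow> ennreal" where
  "delta_p p M W M' W' =
     (INF \<nu> \<in> couplings M M'. ennreal_root p
        (\<integral>\<^sup>+ z. ennreal (\<bar>W (fst (fst z)) (fst (snd z)) - W' (snd (fst z)) (snd (snd z))\<bar> powr p)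
           \<partial>(\<nu> \<Otimes>\<^sub>M \<nu>)))"

definition delta_cut :: "'a measure \<Rightarrow> ('a \<Rightarrow> 'a \<Rightarrow> real)
                        \<Rightarrow> 'b measure \<Rightarrow> ('b \<Rightarrow> 'b \<Rightarrow> real) \<Rightarrow> ereal" where
  "delta_cut M W M' W' =
     (INF \<nu> \<in> couplings M M'. SUP S \<in> sets (M \<Otimes>\<^sub>M M'). SUP T \<in> sets (M \<Otimes>\<^sub>M M').
        ereal \<bar>set_lebesgue_integral (\<nu> \<Otimes>\<^sub>M \<nu>) (S \<times> T)
           (\<lambda>z. W (fst (fst z)) (fst (snd z)) - W' (snd (fst z)) (snd (snd z)))\<bar>)"

definition graphon_equiv_via :: "'a measure \<Rightarrow> ('a \<Rightarrow> 'a \<Rightarrow> real)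
      \<Rightarrow> 'b measure \<Rightarrow> ('b \<Rightarrow> 'b \<Rightarrow> real) \<Rightarrow> 'c measure \<Rightarrow> bool" where
  "graphon_equiv_via M W M' W' N \<longleftrightarrow>
     prob_space N \<and>
     (\<exists>U \<phi> \<phi>'. graphon N U \<and>
        \<phi> \<in> measurable M N \<and> distr M N \<phi> = N \<and>
        \<phi>' \<in> measurable M' N \<and> distr M' N \<phi>' = N \<and>
        (AE z in M \<Otimes>\<^sub>M M. W (fst z) (snd z) = U (\<phi> (fst z)) (\<phi> (snd z))) \<and>
        (AE z in M' \<Otimes>\<^sub>M M'. W' (fst z) (snd z) = U (\<phi>' (fst z)) (\<phi>' (snd z))))"

text \<open>Equivalence: witnessed by some probability space. HOL cannot quantify over types,
  so the existential is taken over probability measures on the type real (which can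
  host [0,1]); the theorem additionally states that a witness of any type implies the
  other conditions.\<close>
definition graphon_equiv :: "'a measure \<Rightarrow> ('a \<Rightarrow> 'a \<Rightarrow> real)
      \<Rightarrow> 'b measure \<Rightarrow> ('b \<Rightarrow> 'b \<Rightarrow> real) \<Rightarrow> bool" where
  "graphon_equiv M W M' W' \<longleftrightarrow> (\<exists>N :: real measure. graphon_equiv_via M W M' W' N)"

end

theory Submission
  imports Defs
begin

text \<open>
  Equivalent graphons have distance 0 although an optimal coupling need not exist on arbitrary
  probability spaces: approximating the common graphon \<open>U\<close> in \<open>L\<^sup>p\<close> by a step function, one couples
  the two spaces independently inside the cells of the finite partition that carries the step function.

  For the converse, a graphon only involves countably many measurable sets, so it is a pullback from
  the Cantor space. Couplings \<open>\<nu>\<^sub>n\<close> of small cut distance push forward to the square of the Cantor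
  space, where compactness of the unit cube and Caratheodory's theorem on the algebra of clopen sets
  give a limit coupling \<open>\<nu>\<close> under which the two graphons agree almost everywhere. Let \<open>C\<close> consist of the
  sets \<open>A\<close> for which there is \<open>A'\<close> on the other side such that \<open>x \<in> A \<longleftrightarrow> x' \<in> A'\<close> holds \<open>\<nu>\<close>-almost surely.
  All integrals \<open>\<integral> b(y) W(x,y) dy\<close> are \<open>C\<close>-measurable in \<open>x\<close>, which forces \<open>W\<close> to be
  \<open>C \<otimes> C\<close>-measurable up to null sets. Countably many sets of \<open>C\<close> then define the common factor.
\<close>

subsection \<open>Density of step functions\<close>

text \<open>The cut distance sees only integrals over rectangles, and weak convergence of couplings
  does not by itself carry such integrals of a merely integrable function to the limit. What saves
  the passage is that all couplings share their marginals: each graphon is pulled back through one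
  marginal, so the error of a step function approximation is the same for every coupling, and for
  step functions on clopen rectangles the integrals are products of measures of clopen sets. The
  Cantor space enters because its clopen sets are compact: a finitely additive limit of
  probabilities on them is automatically countably additive there.

  A limit coupling gives \<open>W(x,y) = W'(x',y')\<close> almost surely, but no map from either
  side into a common space. The \<sigma>-algebra \<open>C\<close> of events readable from both sides
  replaces such a map. The integral of \<open>b(y) W(x,y)\<close> over \<open>y\<close> belongs to
  it because, rewritten over the coupling, it becomes an integral in which only \<open>x'\<close> is
  left free. Countably many events of \<open>C\<close> suffice to express \<open>W\<close>, and
  their bits, paired with those of the partner events, are the two maps into the common
  factor.\<close>

lemma powr_abs_add_le:
  fixes a b p :: real
  assumes "p > 0"
  shows "\<bar>a + b\<bar> powr p \<le> 2 powr p * (\<bar>a\<bar> powr p + \<bar>b\<bar> powr p)"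
proof -
  have "\<bar>a + b\<bar> powr p \<le> (2 * max \<bar>a\<bar> \<bar>b\<bar>) powr p"
    using assms by (intro powr_mono2) auto
  also have "\<dots> = 2 powr p * max \<bar>a\<bar> \<bar>b\<bar> powr p"
    by (simp add: powr_mult)
  also have "max \<bar>a\<bar> \<bar>b\<bar> powr p \<le> \<bar>a\<bar> powr p + \<bar>b\<bar> powr p"
    by (auto simp: max_def)
  finally show ?thesis by simp
qed

text \<open>Plays the part of Minkowski's inequality for \<open>p\<close>-th powers of norms. Only
  smallness matters below, so the factor \<open>2 powr p\<close> is harmless.\<close>

lemma nn_integral_powr_add_le:
  fixes f g :: "'a \<Rightarrow> real"
  assumes "p > 0" and [measurable]: "f \<in> borel_measurable M" "g \<in> borel_measurable M"
  shows "(\<integral>\<^sup>+x. ennreal (\<bar>f x + g x\<bar> powr p) \<partial>M)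
    \<le> ennreal (2 powr p) * ((\<integral>\<^sup>+x. ennreal (\<bar>f x\<bar> powr p) \<partial>M) + (\<integral>\<^sup>+x. ennreal (\<bar>g x\<bar> powr p) \<partial>M))"
proof -
  have "(\<integral>\<^sup>+x. ennreal (\<bar>f x + g x\<bar> powr p) \<partial>M)
      \<le> (\<integral>\<^sup>+x. ennreal (2 powr p) * (ennreal (\<bar>f x\<bar> powr p) + ennreal (\<bar>g x\<bar> powr p)) \<partial>M)"
    using powr_abs_add_le[OF assms(1)]
    by (intro nn_integral_mono) (simp flip: ennreal_mult ennreal_plus)
  also have "\<dots> = ennreal (2 powr p) * ((\<integral>\<^sup>+x. ennreal (\<bar>f x\<bar> powr p) \<partial>M) + (\<integral>\<^sup>+x. ennreal (\<bar>g x\<bar> powr p) \<partial>M))"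
    by (simp add: nn_integral_cmult nn_integral_add)
  finally show ?thesis .
qed

text \<open>A list of weighted sets that may overlap or repeat. Sums thus become concatenations, and
  the sets stay inside a given generator, which a disjoint refinement could leave.\<close>

definition step_fun :: "(real \<times> 'a set) list \<Rightarrow> 'a \<Rightarrow> real" where
  "step_fun xs z = (\<Sum>(c, E)\<leftarrow>xs. c * indicator E z)"

lemma step_fun_Nil [simp]: "step_fun [] z = 0"
  and step_fun_Cons [simp]: "step_fun ((c, E) # xs) z = c * indicator E z + step_fun xs z"
  and step_fun_append [simp]: "step_fun (xs @ ys) z = step_fun xs z + step_fun ys z"
  by (simp_all add: step_fun_def)

lemma step_fun_scale: "step_fun (map (\<lambda>(d, E). (c * d, E)) xs) z = c * step_fun xs z"
  by (induction xs) (auto simp: algebra_simps)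

lemma borel_measurable_step_fun:
  "snd ` set xs \<subseteq> sets M \<Longrightarrow> step_fun xs \<in> borel_measurable M"
proof (induction xs)
  case Nil
  then show ?case by (simp add: step_fun_def[abs_def])
next
  case (Cons a xs)
  obtain c E where a: "a = (c, E)" by force
  have [measurable]: "E \<in> sets M" "step_fun xs \<in> borel_measurable M"
    using Cons a by auto
  have "step_fun (a # xs) = (\<lambda>z. c * indicator E z + step_fun xs z)" by (auto simp: a)
  then show ?case by simp
qed

text \<open>Membership in the \<open>L^p\<close> closure of the span of the indicators of
  \<open>\<E>\<close>, with the \<open>p\<close>-th power of the distance. The family
  \<open>\<E>\<close> is a parameter because both the rectangles with measurable sides and those
  with clopen sides occur later.\<close>

definition Lp_approx :: "real \<Rightarrow> 'a measure \<Rightarrow> 'a set set \<Rightarrow> ('a \<Rightarrow> real) \<Rightarrow> bool" where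
  "Lp_approx p M \<E> f \<longleftrightarrow> (\<forall>e>0. \<exists>xs. snd ` set xs \<subseteq> \<E> \<and>
     (\<integral>\<^sup>+z. ennreal (\<bar>f z - step_fun xs z\<bar> powr p) \<partial>M) < ennreal e)"

lemma Lp_approxD:
  assumes "Lp_approx p M \<E> f" "e > 0"
  obtains xs where "snd ` set xs \<subseteq> \<E>" "(\<integral>\<^sup>+z. ennreal (\<bar>f z - step_fun xs z\<bar> powr p) \<partial>M) < ennreal e"
  using assms unfolding Lp_approx_def by blast

lemma Lp_approx_cong:
  assumes "\<And>z. z \<in> space M \<Longrightarrow> f z = g z"
  shows "Lp_approx p M \<E> f \<longleftrightarrow> Lp_approx p M \<E> g"
  unfolding Lp_approx_def using assms by (simp cong: nn_integral_cong)

text \<open>The tolerance \<open>e / 2 powr (p + 1)\<close> is what the quasi-triangle inequality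
  asks for: two such errors, times \<open>2 powr p\<close>, add up to \<open>e\<close>.\<close>

lemma ennreal_two_powr_bound:
  assumes "p > 0" "e > 0" "x < ennreal (e / 2 powr (p + 1))" "y < ennreal (e / 2 powr (p + 1))"
  shows "ennreal (2 powr p) * (x + y) < ennreal e"
proof -
  have "x + y < ennreal (e / 2 powr (p + 1)) + ennreal (e / 2 powr (p + 1))"
    using assms by (intro add_strict_mono)
  also have "\<dots> = ennreal (e / 2 powr p)"
    using assms by (subst ennreal_plus[symmetric]) (auto simp: powr_add field_simps)
  finally have "ennreal (2 powr p) * (x + y) < ennreal (2 powr p) * ennreal (e / 2 powr p)"
    by (intro ennreal_mult_strict_left_mono) auto
  also have "\<dots> = ennreal e"
    using assms by (simp flip: ennreal_mult)
  finally show ?thesis .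
qed

lemma Lp_approx_add:
  assumes p: "p > 0" and sub: "\<E> \<subseteq> sets M"
    and [measurable]: "f \<in> borel_measurable M" "g \<in> borel_measurable M"
    and f: "Lp_approx p M \<E> f" and g: "Lp_approx p M \<E> g"
  shows "Lp_approx p M \<E> (\<lambda>z. f z + g z)"
  unfolding Lp_approx_def
proof (intro allI impI)
  fix e :: real assume e: "e > 0"
  define d where "d = e / 2 powr (p + 1)"
  have "d > 0" using e by (simp add: d_def)
  obtain xs where xs: "snd ` set xs \<subseteq> \<E>" "(\<integral>\<^sup>+z. ennreal (\<bar>f z - step_fun xs z\<bar> powr p) \<partial>M) < ennreal d"
    using Lp_approxD[OF f \<open>d > 0\<close>] by blast
  obtain ys where ys: "snd ` set ys \<subseteq> \<E>" "(\<integral>\<^sup>+z. ennreal (\<bar>g z - step_fun ys z\<bar> powr p) \<partial>M) < ennreal d"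
    using Lp_approxD[OF g \<open>d > 0\<close>] by blast
  have [measurable]: "step_fun xs \<in> borel_measurable M" "step_fun ys \<in> borel_measurable M"
    using xs ys sub by (auto intro!: borel_measurable_step_fun)
  have "(\<integral>\<^sup>+z. ennreal (\<bar>f z + g z - step_fun (xs @ ys) z\<bar> powr p) \<partial>M)
      = (\<integral>\<^sup>+z. ennreal (\<bar>(f z - step_fun xs z) + (g z - step_fun ys z)\<bar> powr p) \<partial>M)"
    by (simp add: algebra_simps)
  also have "\<dots> \<le> ennreal (2 powr p) * ((\<integral>\<^sup>+z. ennreal (\<bar>f z - step_fun xs z\<bar> powr p) \<partial>M)
      + (\<integral>\<^sup>+z. ennreal (\<bar>g z - step_fun ys z\<bar> powr p) \<partial>M))"
    by (intro nn_integral_powr_add_le p) auto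
  also have "\<dots> < ennreal e"
    using xs ys p e by (intro ennreal_two_powr_bound) (auto simp: d_def)
  finally show "\<exists>xs. snd ` set xs \<subseteq> \<E> \<and>
      (\<integral>\<^sup>+z. ennreal (\<bar>f z + g z - step_fun xs z\<bar> powr p) \<partial>M) < ennreal e"
    using xs ys by (intro exI[of _ "xs @ ys"]) auto
qed

lemma Lp_approx_scale:
  assumes p: "p > 0" and sub: "\<E> \<subseteq> sets M"
    and [measurable]: "f \<in> borel_measurable M" and f: "Lp_approx p M \<E> f"
  shows "Lp_approx p M \<E> (\<lambda>z. c * f z)"
proof (cases "c = 0")
  case True
  then show ?thesis
    using p by (auto simp: Lp_approx_def intro!: exI[of _ "[]"])
next
  case c: False
  show ?thesis
    unfolding Lp_approx_def
  proof (intro allI impI)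
    fix e :: real assume e: "e > 0"
    define d where "d = e / \<bar>c\<bar> powr p"
    have d: "d > 0" using e c by (simp add: d_def)
    obtain xs where xs: "snd ` set xs \<subseteq> \<E>" "(\<integral>\<^sup>+z. ennreal (\<bar>f z - step_fun xs z\<bar> powr p) \<partial>M) < ennreal d"
      using Lp_approxD[OF f d] by blast
    have [measurable]: "step_fun xs \<in> borel_measurable M"
      using xs sub by (auto intro!: borel_measurable_step_fun)
    let ?ys = "map (\<lambda>(d, E). (c * d, E)) xs"
    have "\<bar>c * f z - step_fun ?ys z\<bar> powr p = \<bar>c\<bar> powr p * \<bar>f z - step_fun xs z\<bar> powr p" for z
      unfolding step_fun_scale right_diff_distrib[symmetric] abs_mult by (simp add: powr_mult)
    then have "(\<integral>\<^sup>+z. ennreal (\<bar>c * f z - step_fun ?ys z\<bar> powr p) \<partial>M)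
        = ennreal (\<bar>c\<bar> powr p) * (\<integral>\<^sup>+z. ennreal (\<bar>f z - step_fun xs z\<bar> powr p) \<partial>M)"
      by (simp add: ennreal_mult nn_integral_cmult)
    also have "\<dots> < ennreal (\<bar>c\<bar> powr p) * ennreal d"
      using xs c by (intro ennreal_mult_strict_left_mono) auto
    also have "\<dots> = ennreal e"
      using c e by (simp add: d_def flip: ennreal_mult)
    finally show "\<exists>xs. snd ` set xs \<subseteq> \<E> \<and>
        (\<integral>\<^sup>+z. ennreal (\<bar>c * f z - step_fun xs z\<bar> powr p) \<partial>M) < ennreal e"
      using xs by (intro exI[of _ ?ys]) force
  qed
qed

lemma Lp_approx_LIMSEQ:
  assumes p: "p > 0" and sub: "\<E> \<subseteq> sets M"
    and [measurable]: "f \<in> borel_measurable M" "\<And>i::nat. g i \<in> borel_measurable M"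
    and g: "\<And>i. Lp_approx p M \<E> (g i)"
    and lim: "(\<lambda>i. \<integral>\<^sup>+z. ennreal (\<bar>f z - g i z\<bar> powr p) \<partial>M) \<longlonglongrightarrow> 0"
  shows "Lp_approx p M \<E> f"
  unfolding Lp_approx_def
proof (intro allI impI)
  fix e :: real assume e: "e > 0"
  define d where "d = e / 2 powr (p + 1)"
  have d: "d > 0" using e by (simp add: d_def)
  have "eventually (\<lambda>i. (\<integral>\<^sup>+z. ennreal (\<bar>f z - g i z\<bar> powr p) \<partial>M) < ennreal d) sequentially"
    using d by (intro order_tendstoD(2)[OF lim]) auto
  then obtain i where i: "(\<integral>\<^sup>+z. ennreal (\<bar>f z - g i z\<bar> powr p) \<partial>M) < ennreal d"
    by (auto simp: eventually_sequentially)
  obtain xs where xs: "snd ` set xs \<subseteq> \<E>" "(\<integral>\<^sup>+z. ennreal (\<bar>g i z - step_fun xs z\<bar> powr p) \<partial>M) < ennreal d"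
    using Lp_approxD[OF g d] by blast
  have [measurable]: "step_fun xs \<in> borel_measurable M"
    using xs sub by (auto intro!: borel_measurable_step_fun)
  have "(\<integral>\<^sup>+z. ennreal (\<bar>f z - step_fun xs z\<bar> powr p) \<partial>M)
      = (\<integral>\<^sup>+z. ennreal (\<bar>(f z - g i z) + (g i z - step_fun xs z)\<bar> powr p) \<partial>M)"
    by (simp add: algebra_simps)
  also have "\<dots> \<le> ennreal (2 powr p) * ((\<integral>\<^sup>+z. ennreal (\<bar>f z - g i z\<bar> powr p) \<partial>M)
      + (\<integral>\<^sup>+z. ennreal (\<bar>g i z - step_fun xs z\<bar> powr p) \<partial>M))"
    by (intro nn_integral_powr_add_le p) auto
  also have "\<dots> < ennreal e"
    using xs i p e by (intro ennreal_two_powr_bound) (auto simp: d_def)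
  finally show "\<exists>xs. snd ` set xs \<subseteq> \<E> \<and>
      (\<integral>\<^sup>+z. ennreal (\<bar>f z - step_fun xs z\<bar> powr p) \<partial>M) < ennreal e"
    using xs by blast
qed

text \<open>A Dynkin argument: the sets with approximable indicator contain the intersection-stable
  generator and are closed under complements and countable disjoint unions.\<close>

lemma Lp_approx_indicator:
  assumes fin: "finite_measure M" and p: "p > 0" and stable: "Int_stable \<E>"
    and gen: "sets M = sigma_sets (space M) \<E>" and space: "space M \<in> \<E>" and E: "E \<in> sets M"
  shows "Lp_approx p M \<E> (indicator E)"
proof -
  interpret finite_measure M by fact
  have sub: "\<E> \<subseteq> sets M" unfolding gen by auto
  have "\<E> \<subseteq> Pow (space M)" using sub sets.space_closed by blast
  from stable this E[unfolded gen] show ?thesis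
  proof (induction rule: sigma_sets_induct_disjoint)
    case (basic A)
    then show ?case
      using p by (auto simp: Lp_approx_def step_fun_def intro!: exI[of _ "[(1, A)]"])
  next
    case empty
    then show ?case
      using p by (auto simp: Lp_approx_def intro!: exI[of _ "[]"])
  next
    \<comment> \<open>Membership of \<open>space M\<close> in \<open>\<E>\<close> enters here: the
      constant 1 has to be a step function itself.\<close>
    case (compl A)
    then have [measurable]: "A \<in> sets M" using gen by simp
    have "Lp_approx p M \<E> (\<lambda>_. 1)"
      unfolding Lp_approx_def using p space
      by (auto simp: step_fun_def intro!: exI[of _ "[(1, space M)]"] cong: nn_integral_cong)
    then have "Lp_approx p M \<E> (\<lambda>z. 1 + (-1) * indicator A z)"
      using compl by (intro Lp_approx_add Lp_approx_scale p sub) auto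
    then show ?case
      by (subst (asm) Lp_approx_cong[where g = "indicator (space M - A)"]) (auto split: split_indicator)
  next
    case (union A)
    then have [measurable]: "A i \<in> sets M" for i using gen by auto
    let ?g = "\<lambda>n z. \<Sum>i<n. indicator (A i) z :: real"
    have g: "?g n z = indicator (\<Union>i<n. A i) z" for n z
      using union by (subst indicator_UN_disjoint) (auto simp: disjoint_family_on_def)
    have approx: "Lp_approx p M \<E> (?g n)" for n
    proof (induction n)
      case 0
      then show ?case using p by (auto simp: Lp_approx_def intro!: exI[of _ "[]"])
    next
      case (Suc n)
      then show ?case
        using Lp_approx_add[OF p sub _ _ Suc union(3)[of n]] by (simp add: add.commute)
    qed
    \<comment> \<open>The difference of the two indicators takes only the values 0 and 1, so its
      \<open>p\<close>-th power is the indicator of the tail. Its measure vanishes in the limit by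
      continuity from above, where finiteness of \<open>M\<close> is used.\<close>
    have *: "(\<integral>\<^sup>+z. ennreal (\<bar>indicator (\<Union>i. A i) z - ?g n z\<bar> powr p) \<partial>M)
        = emeasure M ((\<Union>i. A i) - (\<Union>i<n. A i))" for n
    proof -
      have "(\<integral>\<^sup>+z. ennreal (\<bar>indicator (\<Union>i. A i) z - ?g n z\<bar> powr p) \<partial>M)
          = (\<integral>\<^sup>+z. indicator ((\<Union>i. A i) - (\<Union>i<n. A i)) z \<partial>M)"
        unfolding g using p
        by (intro nn_integral_cong) (auto simp: indicator_def)
      then show ?thesis by simp
    qed
    have "(\<lambda>n. emeasure M ((\<Union>i. A i) - (\<Union>i<n. A i))) \<longlonglongrightarrow> emeasure M (\<Inter>n. (\<Union>i. A i) - (\<Union>i<n. A i))"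
      by (intro Lim_emeasure_decseq) (auto simp: decseq_def)
    moreover have "(\<Inter>n. (\<Union>i. A i) - (\<Union>i<n. A i)) = {}" by auto
    ultimately have lim: "(\<lambda>n. \<integral>\<^sup>+z. ennreal (\<bar>indicator (\<Union>i. A i) z - ?g n z\<bar> powr p) \<partial>M) \<longlonglongrightarrow> 0"
      unfolding * by (simp only: emeasure_empty)
    show ?case
      by (rule Lp_approx_LIMSEQ[OF p sub _ _ approx lim]) measurable
  qed
qed

text \<open>Monotone class induction on nonnegative functions. Every function met on the way to
  \<open>f\<close> lies below \<open>f\<close>, so it inherits a finite \<open>L^p\<close> norm, and
  \<open>\<bar>f\<bar> powr p\<close> is the dominating function for the monotone limit.\<close>

lemma Lp_approx_nonneg:
  assumes fin: "finite_measure M" and p: "p > 0" and stable: "Int_stable \<E>"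
    and gen: "sets M = sigma_sets (space M) \<E>" and space: "space M \<in> \<E>"
    and f: "f \<in> borel_measurable M" "\<And>z. f z \<ge> 0"
    and int: "(\<integral>\<^sup>+z. ennreal (\<bar>f z\<bar> powr p) \<partial>M) < \<infinity>"
  shows "Lp_approx p M \<E> f"
  using f int
proof (induction rule: borel_measurable_induct_real)
  have sub: "\<E> \<subseteq> sets M" unfolding gen by auto
  {
    case (set A)
    then show ?case by (intro Lp_approx_indicator assms)
  next
    case (mult u c)
    \<comment> \<open>Finiteness for \<open>c * u\<close> yields finiteness for \<open>u\<close>
      only if \<open>c \<noteq> 0\<close>.\<close>
    show ?case
    proof (cases "c = 0")
      case True
      then show ?thesis using p by (auto simp: Lp_approx_def intro!: exI[of _ "[]"])
    next
      case False
      have [measurable]: "u \<in> borel_measurable M" by fact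
      have "(\<integral>\<^sup>+z. ennreal (\<bar>c * u z\<bar> powr p) \<partial>M)
          = ennreal (\<bar>c\<bar> powr p) * (\<integral>\<^sup>+z. ennreal (\<bar>u z\<bar> powr p) \<partial>M)"
        by (simp add: ennreal_mult nn_integral_cmult abs_mult powr_mult)
      then have "(\<integral>\<^sup>+z. ennreal (\<bar>u z\<bar> powr p) \<partial>M) < \<infinity>"
        using mult.prems False by (auto simp: ennreal_mult_less_top)
      then show ?thesis
        using mult by (intro Lp_approx_scale p sub) auto
    qed
  next
    case (add u v)
    have "(\<integral>\<^sup>+z. ennreal (\<bar>u z\<bar> powr p) \<partial>M) \<le> (\<integral>\<^sup>+z. ennreal (\<bar>v z + u z\<bar> powr p) \<partial>M)"
      "(\<integral>\<^sup>+z. ennreal (\<bar>v z\<bar> powr p) \<partial>M) \<le> (\<integral>\<^sup>+z. ennreal (\<bar>v z + u z\<bar> powr p) \<partial>M)"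
      using add p by (auto intro!: nn_integral_mono ennreal_leI powr_mono2)
    then show ?case
      using add by (intro Lp_approx_add p sub) (auto simp: le_less_trans)
  next
    case (seq U)
    have [measurable]: "U i \<in> borel_measurable M" for i by fact
    have lim: "(\<lambda>i. U i z) \<longlonglongrightarrow> f z" if "z \<in> space M" for z
      using seq that by auto
    have le: "U i z \<le> f z" if "z \<in> space M" for i z
      using lim[OF that] \<open>incseq U\<close> by (intro incseq_le[of "\<lambda>i. U i z"]) (auto simp: incseq_def le_fun_def)
    have le': "\<bar>U i z\<bar> \<le> \<bar>f z\<bar>" if "z \<in> space M" for i z
      using le[OF that, of i] seq(2)[of i z] by linarith
    have le'': "\<bar>f z - U i z\<bar> \<le> \<bar>f z\<bar>" if "z \<in> space M" for i z
      using le[OF that, of i] seq(2)[of i z] by linarith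
    have "(\<integral>\<^sup>+z. ennreal (\<bar>U i z\<bar> powr p) \<partial>M) \<le> (\<integral>\<^sup>+z. ennreal (\<bar>f z\<bar> powr p) \<partial>M)" for i
      using p le' by (intro nn_integral_mono ennreal_leI powr_mono2) auto
    then have "(\<integral>\<^sup>+z. ennreal (\<bar>U i z\<bar> powr p) \<partial>M) < \<infinity>" for i
      using seq.prems le_less_trans by blast
    then have approx: "Lp_approx p M \<E> (U i)" for i
      using seq by auto
    have [measurable]: "f \<in> borel_measurable M" by fact
    have "(\<lambda>i. \<integral>\<^sup>+z. ennreal (\<bar>f z - U i z\<bar> powr p) \<partial>M) \<longlonglongrightarrow> (\<integral>\<^sup>+z. 0 \<partial>M)"
    proof (rule nn_integral_dominated_convergence[where w = "\<lambda>z. ennreal (\<bar>f z\<bar> powr p)"])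
      show "AE z in M. ennreal (\<bar>f z - U i z\<bar> powr p) \<le> ennreal (\<bar>f z\<bar> powr p)" for i
        using p by (intro AE_I2 ennreal_leI powr_mono2 le'') simp_all
      show "AE z in M. (\<lambda>i. ennreal (\<bar>f z - U i z\<bar> powr p)) \<longlonglongrightarrow> 0"
      proof (intro AE_I2)
        fix z assume "z \<in> space M"
        then have "(\<lambda>i. \<bar>f z - U i z\<bar>) \<longlonglongrightarrow> \<bar>f z - f z\<bar>"
          by (intro tendsto_intros lim)
        then have "(\<lambda>i. \<bar>f z - U i z\<bar> powr p) \<longlonglongrightarrow> 0"
          using p tendsto_powr'[of "\<lambda>i. \<bar>f z - U i z\<bar>" 0 sequentially "\<lambda>_. p" p] by simp
        then show "(\<lambda>i. ennreal (\<bar>f z - U i z\<bar> powr p)) \<longlonglongrightarrow> 0"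
          by (drule_tac tendsto_ennrealI) simp
      qed
    qed (use seq.prems in simp_all)
    then have lim': "(\<lambda>i. \<integral>\<^sup>+z. ennreal (\<bar>f z - U i z\<bar> powr p) \<partial>M) \<longlonglongrightarrow> 0"
      by simp
    show ?case
      by (rule Lp_approx_LIMSEQ[OF p sub _ _ approx lim']) measurable
  }
qed

subsection \<open>Distances and couplings\<close>

text \<open>The argument has the form \<open>((x, x'), (y, y'))\<close>: its two components are
  independent draws from the coupling, each of which carries one point of either space.\<close>

abbreviation overlay :: "('a \<Rightarrow> 'a \<Rightarrow> real) \<Rightarrow> ('b \<Rightarrow> 'b \<Rightarrow> real) \<Rightarrow> ('a \<times> 'b) \<times> ('a \<times> 'b) \<Rightarrow> real" where
  "overlay W W' z \<equiv> W (fst (fst z)) (fst (snd z)) - W' (snd (fst z)) (snd (snd z))"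

lemma ennreal_root_less_iff:
  assumes "p > 0" "e > 0"
  shows "ennreal_root p x < ennreal e \<longleftrightarrow> x < ennreal (e powr p)"
proof (cases x)
  case (real r)
  have "r powr (1 / p) < e \<longleftrightarrow> r < e powr p"
  proof
    assume "r powr (1 / p) < e"
    then have "(r powr (1 / p)) powr p < e powr p"
      using assms by (intro powr_less_mono2) auto
    then show "r < e powr p" using assms real by (simp add: powr_powr)
  next
    assume "r < e powr p"
    then have "r powr (1 / p) < (e powr p) powr (1 / p)"
      using assms real by (intro powr_less_mono2) auto
    then show "r powr (1 / p) < e" using assms by (simp add: powr_powr)
  qed
  then show ?thesis using real assms by (simp add: ennreal_root_def ennreal_less_iff)
qed (simp add: ennreal_root_def)

text \<open>The infimum need not be attained, so vanishing of the distance is turned into couplings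
  of arbitrarily small cost. The \<open>p\<close>-th root is absorbed into the choice of
  \<open>e\<close>.\<close>

lemma delta_p_eq_0_iff:
  assumes "p > 0"
  shows "delta_p p M W M' W' = 0 \<longleftrightarrow> (\<forall>e>0. \<exists>\<nu>\<in>couplings M M'.
    (\<integral>\<^sup>+z. ennreal (\<bar>overlay W W' z\<bar> powr p) \<partial>(\<nu> \<Otimes>\<^sub>M \<nu>)) < ennreal e)"
proof
  assume 0: "delta_p p M W M' W' = 0"
  show "\<forall>e>0. \<exists>\<nu>\<in>couplings M M'.
    (\<integral>\<^sup>+z. ennreal (\<bar>overlay W W' z\<bar> powr p) \<partial>(\<nu> \<Otimes>\<^sub>M \<nu>)) < ennreal e"
  proof (intro allI impI)
    fix e :: real assume e: "e > 0"
    then have "delta_p p M W M' W' < ennreal (e powr (1 / p))"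
      by (simp add: 0)
    then obtain \<nu> where "\<nu> \<in> couplings M M'" "ennreal_root p
        (\<integral>\<^sup>+z. ennreal (\<bar>overlay W W' z\<bar> powr p) \<partial>(\<nu> \<Otimes>\<^sub>M \<nu>)) < ennreal (e powr (1 / p))"
      unfolding delta_p_def by (auto simp: INF_less_iff)
    then show "\<exists>\<nu>\<in>couplings M M'.
        (\<integral>\<^sup>+z. ennreal (\<bar>overlay W W' z\<bar> powr p) \<partial>(\<nu> \<Otimes>\<^sub>M \<nu>)) < ennreal e"
      using assms e by (intro bexI[of _ \<nu>]) (auto simp: ennreal_root_less_iff powr_powr)
  qed
next
  assume *: "\<forall>e>0. \<exists>\<nu>\<in>couplings M M'.
    (\<integral>\<^sup>+z. ennreal (\<bar>overlay W W' z\<bar> powr p) \<partial>(\<nu> \<Otimes>\<^sub>M \<nu>)) < ennreal e"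
  have le: "delta_p p M W M' W' \<le> 0 + ennreal e" if e: "e > 0" for e
  proof -
    obtain \<nu> where "\<nu> \<in> couplings M M'"
      "(\<integral>\<^sup>+z. ennreal (\<bar>overlay W W' z\<bar> powr p) \<partial>(\<nu> \<Otimes>\<^sub>M \<nu>)) < ennreal (e powr p)"
      using *[rule_format, of "e powr p"] e by auto
    then show ?thesis
      unfolding delta_p_def add_0 using assms e
      by (intro INF_lower2[of \<nu>]) (auto simp: ennreal_root_less_iff[symmetric] intro: less_imp_le)
  qed
  have "delta_p p M W M' W' \<le> 0"
    by (rule ennreal_le_epsilon) (rule le)
  then show "delta_p p M W M' W' = 0" by simp
qed

lemma delta_cut_eq_0_iff:
  "delta_cut M W M' W' = 0 \<longleftrightarrow> (\<forall>e>0. \<exists>\<nu>\<in>couplings M M'.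
    \<forall>S\<in>sets (M \<Otimes>\<^sub>M M'). \<forall>T\<in>sets (M \<Otimes>\<^sub>M M').
      \<bar>set_lebesgue_integral (\<nu> \<Otimes>\<^sub>M \<nu>) (S \<times> T) (overlay W W')\<bar> \<le> e)"
    (is "_ \<longleftrightarrow> ?R")
proof
  assume 0: "delta_cut M W M' W' = 0"
  show ?R
  proof (intro allI impI)
    fix e :: real assume e: "e > 0"
    then have "delta_cut M W M' W' < ereal e" by (simp add: 0)
    then obtain \<nu> where \<nu>: "\<nu> \<in> couplings M M'" "(SUP S \<in> sets (M \<Otimes>\<^sub>M M'). SUP T \<in> sets (M \<Otimes>\<^sub>M M').
        ereal \<bar>set_lebesgue_integral (\<nu> \<Otimes>\<^sub>M \<nu>) (S \<times> T) (overlay W W')\<bar>) < ereal e"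
      unfolding delta_cut_def by (auto simp: INF_less_iff)
    then have "(SUP S \<in> sets (M \<Otimes>\<^sub>M M'). SUP T \<in> sets (M \<Otimes>\<^sub>M M').
        ereal \<bar>set_lebesgue_integral (\<nu> \<Otimes>\<^sub>M \<nu>) (S \<times> T) (overlay W W')\<bar>) \<le> ereal e"
      by simp
    then show "\<exists>\<nu>\<in>couplings M M'. \<forall>S\<in>sets (M \<Otimes>\<^sub>M M'). \<forall>T\<in>sets (M \<Otimes>\<^sub>M M').
        \<bar>set_lebesgue_integral (\<nu> \<Otimes>\<^sub>M \<nu>) (S \<times> T) (overlay W W')\<bar> \<le> e"
      using \<nu>(1) by (intro bexI[of _ \<nu>]) (auto simp: SUP_le_iff)
  qed
next
  assume R: ?R
  have le: "delta_cut M W M' W' \<le> 0 + ereal e" if e: "e > 0" for e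
  proof -
    obtain \<nu> where "\<nu> \<in> couplings M M'" "\<forall>S\<in>sets (M \<Otimes>\<^sub>M M'). \<forall>T\<in>sets (M \<Otimes>\<^sub>M M').
        \<bar>set_lebesgue_integral (\<nu> \<Otimes>\<^sub>M \<nu>) (S \<times> T) (overlay W W')\<bar> \<le> e"
      using R e by blast
    then show ?thesis
      unfolding delta_cut_def add_0
      by (intro INF_lower2[of \<nu>]) (auto simp: SUP_le_iff)
  qed
  have "delta_cut M W M' W' \<le> 0"
    by (rule ereal_le_epsilon2) (use le in blast)
  \<comment> \<open>A supremum in \<open>ereal\<close> could be negative a priori; the empty
    rectangle, with integral 0, excludes this.\<close>
  moreover have "0 \<le> delta_cut M W M' W'"
    unfolding delta_cut_def
    by (intro INF_greatest SUP_upper2[of "{}"]) auto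
  ultimately show "delta_cut M W M' W' = 0" by simp
qed

section \<open>Couplings and squares of measure-preserving maps\<close>

lemma couplingsD:
  assumes "\<nu> \<in> couplings M M'"
  shows "sets \<nu> = sets (M \<Otimes>\<^sub>M M')" "distr \<nu> M fst = M" "distr \<nu> M' snd = M'"
    "fst \<in> measurable \<nu> M" "snd \<in> measurable \<nu> M'" "space \<nu> = space M \<times> space M'"
proof -
  show *: "sets \<nu> = sets (M \<Otimes>\<^sub>M M')" "distr \<nu> M fst = M" "distr \<nu> M' snd = M'"
    using assms by (auto simp: couplings_def)
  show "fst \<in> measurable \<nu> M" "snd \<in> measurable \<nu> M'"
    by (auto cong: measurable_cong_sets simp: *(1))
  show "space \<nu> = space M \<times> space M'"
    using sets_eq_imp_space_eq[OF *(1)] by (simp add: space_pair_measure)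
qed

lemma prob_space_coupling:
  assumes "\<nu> \<in> couplings M M'" "prob_space M"
  shows "prob_space \<nu>"
  using assms couplingsD[OF assms(1)] by (metis prob_space_distrD)

lemma distr_pair_square:
  assumes "prob_space M" "f \<in> measurable M N" "distr M N f = N"
  shows "distr (M \<Otimes>\<^sub>M M) (N \<Otimes>\<^sub>M N) (\<lambda>z. (f (fst z), f (snd z))) = N \<Otimes>\<^sub>M N"
proof -
  interpret prob_space M by fact
  interpret N: prob_space "distr M N f"
    by (rule prob_space_distr) fact
  have "distr M N f \<Otimes>\<^sub>M distr M N f = distr (M \<Otimes>\<^sub>M M) (N \<Otimes>\<^sub>M N) (\<lambda>(x, y). (f x, f y))"
    by (intro pair_measure_distr assms N.sigma_finite_measure_axioms)
  then show ?thesis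
    by (simp add: assms(3) case_prod_unfold)
qed

lemma measurable_pair_square:
  assumes [measurable]: "f \<in> measurable M N"
  shows "(\<lambda>z. (f (fst z), f (snd z))) \<in> measurable (M \<Otimes>\<^sub>M M) (N \<Otimes>\<^sub>M N)"
  by measurable

lemma nn_integral_pair_square:
  assumes "prob_space M" and [measurable]: "f \<in> measurable M N" and "distr M N f = N"
    and [measurable]: "g \<in> borel_measurable (N \<Otimes>\<^sub>M N)"
  shows "(\<integral>\<^sup>+z. g (f (fst z), f (snd z)) \<partial>(M \<Otimes>\<^sub>M M)) = (\<integral>\<^sup>+z. g z \<partial>(N \<Otimes>\<^sub>M N))"
  by (subst distr_pair_square[OF assms(1-3), symmetric]) (simp add: nn_integral_distr)

lemma AE_pair_square:
  assumes "prob_space M" and [measurable]: "f \<in> measurable M N" and "distr M N f = N"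
    and "AE z in N \<Otimes>\<^sub>M N. Q (fst z) (snd z)"
  shows "AE z in M \<Otimes>\<^sub>M M. Q (f (fst z)) (f (snd z))"
  using AE_distrD[OF measurable_pair_square[OF assms(2)], where P = "\<lambda>z. Q (fst z) (snd z)",
      unfolded distr_pair_square[OF assms(1-3)], OF assms(4)]
  by simp

lemma AE_pair_square_both:
  assumes "prob_space M" "AE x in M. Q x"
  shows "AE z in M \<Otimes>\<^sub>M M. Q (fst z) \<and> Q (snd z)"
proof -
  interpret prob_space M by fact
  obtain Z where Z: "Z \<in> null_sets M" "{x \<in> space M. \<not> Q x} \<subseteq> Z"
    using assms(2) by (auto simp: eventually_ae_filter)
  then have [measurable]: "Z \<in> sets M" by auto
  have "Z \<times> space M \<in> null_sets (M \<Otimes>\<^sub>M M)" "space M \<times> Z \<in> null_sets (M \<Otimes>\<^sub>M M)"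
    using Z(1) by (auto simp: null_sets_def emeasure_pair_measure_Times)
  then have "Z \<times> space M \<union> space M \<times> Z \<in> null_sets (M \<Otimes>\<^sub>M M)" by blast
  then show ?thesis
    by (rule AE_I') (use Z(2) in \<open>auto simp: space_pair_measure\<close>)
qed

lemma borel_measurable_graphon:
  assumes "graphon M W" "f \<in> measurable L M" "g \<in> measurable L M"
  shows "(\<lambda>z. W (f z) (g z)) \<in> borel_measurable L"
proof -
  have "(\<lambda>(x, y). W x y) \<circ> (\<lambda>z. (f z, g z)) \<in> borel_measurable L"
    using assms by (intro measurable_comp[of _ _ "M \<Otimes>\<^sub>M M"]) (auto simp: graphon_def)
  then show ?thesis by (simp add: comp_def)
qed

text \<open>The cell of \<open>D\<close> consists of the points that lie in exactly the members
  \<open>D\<close> of \<open>\<A>\<close>. Its preimages \<open>a D\<close> and \<open>a' D\<close>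
  have the common mass \<open>N(cell D)\<close>. Coupling them independently and giving the result
  this mass leads to the density \<open>1 / N(cell D)\<close> on \<open>a D \<times> a' D\<close>
  with respect to the product measure.\<close>

lemma partition_coupling:
  fixes \<phi> :: "'a \<Rightarrow> 'c" and \<phi>' :: "'b \<Rightarrow> 'c"
  assumes "prob_space M" "prob_space M'"
    and \<phi>[measurable]: "\<phi> \<in> measurable M N" and d: "distr M N \<phi> = N"
    and \<phi>'[measurable]: "\<phi>' \<in> measurable M' N" and d': "distr M' N \<phi>' = N"
    and fin: "finite \<A>" and \<A>: "\<A> \<subseteq> sets N"
  obtains \<nu> where "\<nu> \<in> couplings M M'" "AE z in \<nu>. \<forall>A\<in>\<A>. \<phi> (fst z) \<in> A \<longleftrightarrow> \<phi>' (snd z) \<in> A"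
proof -
  interpret M: prob_space M by fact
  interpret M': prob_space M' by fact
  define cell where "cell D = {x \<in> space N. {A\<in>\<A>. x \<in> A} = D}" for D
  define a where "a D = \<phi> -` cell D \<inter> space M" for D
  define a' where "a' D = \<phi>' -` cell D \<inter> space M'" for D
  have cell[measurable]: "cell D \<in> sets N" for D
  proof (cases "D \<subseteq> \<A>")
    case True
    then have "cell D = {x \<in> space N. (\<forall>A\<in>\<A>. x \<in> A \<longleftrightarrow> A \<in> D)}"
      by (auto simp: cell_def)
    also have "\<dots> \<in> sets N"
      using \<A> fin by (intro sets.sets_Collect_finite_All) (auto intro!: sets.sets_Collect sets.sets_Collect_const sets_Collect_single' simp: pred_def)
    finally show ?thesis .
  next
    case False
    then have "cell D = {}" by (auto simp: cell_def)
    then show ?thesis by simp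
  qed
  have [measurable]: "a D \<in> sets M" "a' D \<in> sets M'" for D
    by (auto simp: a_def a'_def)
  have eq: "emeasure M (a D) = emeasure N (cell D)" for D
    unfolding a_def by (subst emeasure_distr[symmetric, of _ _ N]) (auto simp: d)
  have eq': "emeasure M' (a' D) = emeasure N (cell D)" for D
    unfolding a'_def by (subst emeasure_distr[symmetric, of _ _ N]) (auto simp: d')
  \<comment> \<open>For a null cell this is \<open>\<infinity>\<close>. The factor then sits on a
    null rectangle, and \<open>\<infinity> * 0 = 0\<close>.\<close>
  define c where "c D = inverse (emeasure N (cell D))" for D
  define h where "h z = (\<Sum>D\<in>Pow \<A>. c D * indicator (a D \<times> a' D) z)" for z
  have h[measurable]: "h \<in> borel_measurable (M \<Otimes>\<^sub>M M')"
    unfolding h_def by measurable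
  define \<nu> where "\<nu> = density (M \<Otimes>\<^sub>M M') h"
  have rect: "emeasure \<nu> (A \<times> B) = (\<Sum>D\<in>Pow \<A>. c D * (emeasure M (A \<inter> a D) * emeasure M' (B \<inter> a' D)))"
    if [measurable]: "A \<in> sets M" "B \<in> sets M'" for A B
  proof -
    have "emeasure \<nu> (A \<times> B) = (\<integral>\<^sup>+z. h z * indicator (A \<times> B) z \<partial>(M \<Otimes>\<^sub>M M'))"
      unfolding \<nu>_def by (intro emeasure_density) auto
    also have "\<dots> = (\<integral>\<^sup>+z. (\<Sum>D\<in>Pow \<A>. c D * indicator ((A \<inter> a D) \<times> (B \<inter> a' D)) z) \<partial>(M \<Otimes>\<^sub>M M'))"
      unfolding h_def sum_distrib_right
      by (intro nn_integral_cong sum.cong) (auto split: split_indicator)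
    also have "\<dots> = (\<Sum>D\<in>Pow \<A>. c D * emeasure (M \<Otimes>\<^sub>M M') ((A \<inter> a D) \<times> (B \<inter> a' D)))"
      by (subst nn_integral_sum) (auto intro!: sum.cong nn_integral_cmult_indicator)
    finally show ?thesis
      by (simp add: M'.emeasure_pair_measure_Times)
  qed
  \<comment> \<open>The bound on \<open>x\<close> settles the null cells, where \<open>c D\<close>
    is not a true reciprocal: there \<open>x = 0\<close> and both sides vanish.\<close>
  have cancel: "c D * (x * emeasure N (cell D)) = x" if "x \<le> emeasure N (cell D)" for D x
  proof (cases "emeasure N (cell D) = 0")
    case True
    then show ?thesis using that by simp
  next
    case False
    have "emeasure N (cell D) \<noteq> \<infinity>"
      using eq[of D] M.emeasure_finite by (metis infinity_ennreal_def)
    then have "x * emeasure N (cell D) / emeasure N (cell D) = x"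
      using False by (intro ennreal_mult_divide_eq) (auto simp: top_unique)
    then show ?thesis
      by (simp add: c_def divide_ennreal_def mult.commute)
  qed
  have disj: "x \<in> a D \<Longrightarrow> x \<in> a D' \<Longrightarrow> D = D'" for x D D'
    by (auto simp: a_def cell_def)
  have disj': "x \<in> a' D \<Longrightarrow> x \<in> a' D' \<Longrightarrow> D = D'" for x D D'
    by (auto simp: a'_def cell_def)
  have part: "(\<Sum>D\<in>Pow \<A>. emeasure M (A \<inter> a D)) = emeasure M A" if [measurable]: "A \<in> sets M" for A
  proof -
    have "(\<Sum>D\<in>Pow \<A>. emeasure M (A \<inter> a D)) = emeasure M (\<Union>D\<in>Pow \<A>. A \<inter> a D)"
      using fin disj by (intro sum_emeasure) (auto simp: disjoint_family_on_def)
    also have "(\<Union>D\<in>Pow \<A>. A \<inter> a D) = A"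
      using sets.sets_into_space[OF that] measurable_space[OF \<phi>] by (auto simp: a_def cell_def)
    finally show ?thesis .
  qed
  have part': "(\<Sum>D\<in>Pow \<A>. emeasure M' (A \<inter> a' D)) = emeasure M' A" if [measurable]: "A \<in> sets M'" for A
  proof -
    have "(\<Sum>D\<in>Pow \<A>. emeasure M' (A \<inter> a' D)) = emeasure M' (\<Union>D\<in>Pow \<A>. A \<inter> a' D)"
      using fin disj' by (intro sum_emeasure) (auto simp: disjoint_family_on_def)
    also have "(\<Union>D\<in>Pow \<A>. A \<inter> a' D) = A"
      using sets.sets_into_space[OF that] measurable_space[OF \<phi>'] by (auto simp: a'_def cell_def)
    finally show ?thesis .
  qed
  have sets_\<nu>[measurable_cong]: "sets \<nu> = sets (M \<Otimes>\<^sub>M M')" by (simp add: \<nu>_def)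
  have space_\<nu>: "space \<nu> = space M \<times> space M'" by (simp add: \<nu>_def space_pair_measure)
  have "distr \<nu> M fst = M"
  proof (rule measure_eqI)
    fix A assume "A \<in> sets (distr \<nu> M fst)"
    then have A[measurable]: "A \<in> sets M" by simp
    have "emeasure (distr \<nu> M fst) A = emeasure \<nu> (A \<times> space M')"
      using sets.sets_into_space[OF A]
      by (subst emeasure_distr) (auto simp: space_\<nu> intro!: arg_cong[where f = "emeasure \<nu>"])
    also have "\<dots> = (\<Sum>D\<in>Pow \<A>. c D * (emeasure M (A \<inter> a D) * emeasure M' (space M' \<inter> a' D)))"
      by (rule rect) auto
    also have "\<dots> = (\<Sum>D\<in>Pow \<A>. c D * (emeasure M (A \<inter> a D) * emeasure N (cell D)))"
      by (intro sum.cong refl) (simp add: eq'[symmetric] a'_def Int_ac)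
    also have "\<dots> = (\<Sum>D\<in>Pow \<A>. emeasure M (A \<inter> a D))"
      by (intro sum.cong refl cancel) (simp add: eq[symmetric] emeasure_mono)
    also have "\<dots> = emeasure M A" by (rule part) fact
    finally show "emeasure (distr \<nu> M fst) A = emeasure M A" .
  qed simp
  moreover have "distr \<nu> M' snd = M'"
  proof (rule measure_eqI)
    fix A assume "A \<in> sets (distr \<nu> M' snd)"
    then have A[measurable]: "A \<in> sets M'" by simp
    have "emeasure (distr \<nu> M' snd) A = emeasure \<nu> (space M \<times> A)"
      using sets.sets_into_space[OF A]
      by (subst emeasure_distr) (auto simp: space_\<nu> intro!: arg_cong[where f = "emeasure \<nu>"])
    also have "\<dots> = (\<Sum>D\<in>Pow \<A>. c D * (emeasure M (space M \<inter> a D) * emeasure M' (A \<inter> a' D)))"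
      by (rule rect) auto
    also have "\<dots> = (\<Sum>D\<in>Pow \<A>. c D * (emeasure M' (A \<inter> a' D) * emeasure N (cell D)))"
      by (intro sum.cong refl) (simp add: eq[symmetric] a_def Int_ac mult.commute)
    also have "\<dots> = (\<Sum>D\<in>Pow \<A>. emeasure M' (A \<inter> a' D))"
      by (intro sum.cong refl cancel) (simp add: eq'[symmetric] emeasure_mono)
    also have "\<dots> = emeasure M' A" by (rule part') fact
    finally show "emeasure (distr \<nu> M' snd) A = emeasure M' A" .
  qed simp
  ultimately have "\<nu> \<in> couplings M M'"
    using sets_\<nu> by (simp add: couplings_def)
  moreover have "AE z in \<nu>. \<forall>A\<in>\<A>. \<phi> (fst z) \<in> A \<longleftrightarrow> \<phi>' (snd z) \<in> A"
    unfolding \<nu>_def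
  proof (subst AE_density[OF h], intro AE_I2 impI)
    fix z assume "0 < h z"
    then obtain D where "z \<in> a D \<times> a' D"
      unfolding h_def by (metis (no_types, lifting) indicator_simps(2) less_irrefl mult_zero_right sum.neutral)
    then have "{A \<in> \<A>. \<phi> (fst z) \<in> A} = {A \<in> \<A>. \<phi>' (snd z) \<in> A}"
      by (cases z) (simp add: a_def a'_def cell_def)
    then show "\<forall>A\<in>\<A>. \<phi> (fst z) \<in> A \<longleftrightarrow> \<phi>' (snd z) \<in> A"
      by blast
  qed
  ultimately show ?thesis by (rule that)
qed

lemma distr_pair_coupling:
  assumes "prob_space M" and \<nu>: "\<nu> \<in> couplings M M'"
  shows "distr (\<nu> \<Otimes>\<^sub>M \<nu>) (M \<Otimes>\<^sub>M M) (\<lambda>z. (fst (fst z), fst (snd z))) = M \<Otimes>\<^sub>M M"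
    and "distr (\<nu> \<Otimes>\<^sub>M \<nu>) (M' \<Otimes>\<^sub>M M') (\<lambda>z. (snd (fst z), snd (snd z))) = M' \<Otimes>\<^sub>M M'"
  by (rule distr_pair_square couplingsD[OF \<nu>] prob_space_coupling[OF \<nu> assms(1)])+

lemma measure_preserving_comp:
  assumes "f \<in> measurable L M" "distr L M f = M" "g \<in> measurable M N" "distr M N g = N"
  shows "(\<lambda>x. g (f x)) \<in> measurable L N" "distr L N (\<lambda>x. g (f x)) = N"
proof -
  show "(\<lambda>x. g (f x)) \<in> measurable L N"
    using assms(1,3) by measurable
  show "distr L N (\<lambda>x. g (f x)) = N"
    using distr_distr[OF assms(3,1)] assms(2,4) by (simp add: comp_def)
qed

text \<open>The finitely many sides of the rectangles generate the partition for the coupling: a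
  step function does not change when each coordinate moves within its cell.\<close>

lemma finite_rect_sides:
  fixes xs :: "('d \<times> ('a \<times> 'a) set) list"
  assumes "snd ` set xs \<subseteq> {A \<times> B | A B. A \<in> \<S> \<and> B \<in> \<S>}"
  shows "\<exists>\<A>. finite \<A> \<and> \<A> \<subseteq> \<S> \<and> (\<forall>c E. (c, E) \<in> set xs \<longrightarrow> (\<exists>A\<in>\<A>. \<exists>B\<in>\<A>. E = A \<times> B))"
  using assms
proof (induction xs)
  case Nil
  then show ?case by (intro exI[of _ "{}"]) simp
next
  case (Cons a xs)
  then obtain \<A> where \<A>: "finite \<A>" "\<A> \<subseteq> \<S>" "\<forall>c E. (c, E) \<in> set xs \<longrightarrow> (\<exists>A\<in>\<A>. \<exists>B\<in>\<A>. E = A \<times> B)"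
    by auto
  obtain A B where AB: "A \<in> \<S>" "B \<in> \<S>" "snd a = A \<times> B" using Cons.prems by auto
  show ?case
  proof (intro exI[of _ "insert A (insert B \<A>)"] conjI allI impI)
    fix c E assume "(c, E) \<in> set (a # xs)"
    then consider "E = A \<times> B" | "(c, E) \<in> set xs" using AB(3) by force
    then show "\<exists>A'\<in>insert A (insert B \<A>). \<exists>B'\<in>insert A (insert B \<A>). E = A' \<times> B'"
    proof cases
      case 2
      then obtain A' B' where "A' \<in> \<A>" "B' \<in> \<A>" "E = A' \<times> B'" using \<A>(3) by blast
      then show ?thesis by (intro bexI[of _ A'] bexI[of _ B']) simp_all
    qed (intro bexI[of _ A] bexI[of _ B], simp_all)
  qed (use \<A> AB in auto)
qed

lemma step_fun_rect_cong:
  assumes "\<And>c E. (c, E) \<in> set xs \<Longrightarrow> \<exists>A\<in>\<A>. \<exists>B\<in>\<A>. E = A \<times> B"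
    and "\<And>A. A \<in> \<A> \<Longrightarrow> x \<in> A \<longleftrightarrow> x' \<in> A" "\<And>A. A \<in> \<A> \<Longrightarrow> y \<in> A \<longleftrightarrow> y' \<in> A"
  shows "step_fun xs (x, y) = step_fun xs (x', y')"
  using assms(1)
proof (induction xs)
  case (Cons a xs)
  obtain c E where a: "a = (c, E)" by force
  obtain A B where "A \<in> \<A>" "B \<in> \<A>" "E = A \<times> B" using Cons.prems[of c E] a by auto
  then have "indicator E (x, y) = (indicator E (x', y') :: real)"
    using assms(2,3) by (auto simp: indicator_def)
  moreover have "step_fun xs (x, y) = step_fun xs (x', y')"
    by (rule Cons.IH, rule Cons.prems, erule list.set_intros(2))
  ultimately show ?case by (simp add: a)
qed simp

text \<open>Let \<open>V\<close> be a step function close to \<open>U\<close>. The distances of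
  \<open>W\<close> from the pullback of \<open>V\<close> by \<open>\<phi>\<close>, and of
  \<open>W'\<close> from its pullback by \<open>\<phi>'\<close>, depend on the marginals only and
  are small under every coupling. A coupling that respects the cells of \<open>V\<close> makes the
  two pullbacks equal almost everywhere, and the two errors add up.\<close>

lemma graphon_equiv_via_imp_delta_p:
  fixes N :: "'c measure"
  assumes p: "p > 0" and "prob_space M" "prob_space M'"
    and W: "graphon M W" and W': "graphon M' W'"
    and fin: "Lp_norm_pow p M W < \<infinity>" and equiv: "graphon_equiv_via M W M' W' N"
  shows "delta_p p M W M' W' = 0"
  unfolding delta_p_eq_0_iff[OF p]
proof (intro allI impI)
  fix e :: real assume e: "e > 0"
  define d where "d = e / 2 powr (p + 1)"
  have "d > 0" using e by (simp add: d_def)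
  obtain U \<phi> \<phi>' where N: "prob_space N" and U: "graphon N U"
    and \<phi>[measurable]: "\<phi> \<in> measurable M N" and d\<phi>: "distr M N \<phi> = N"
    and \<phi>'[measurable]: "\<phi>' \<in> measurable M' N" and d\<phi>': "distr M' N \<phi>' = N"
    and AE: "AE z in M \<Otimes>\<^sub>M M. W (fst z) (snd z) = U (\<phi> (fst z)) (\<phi> (snd z))"
    and AE': "AE z in M' \<Otimes>\<^sub>M M'. W' (fst z) (snd z) = U (\<phi>' (fst z)) (\<phi>' (snd z))"
    using equiv unfolding graphon_equiv_via_def by blast
  interpret N: prob_space N by fact
  interpret NN: pair_prob_space N N ..
  let ?U = "\<lambda>z. U (fst z) (snd z)"
  let ?\<E> = "{A \<times> B | A B. A \<in> sets N \<and> B \<in> sets N}"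
  have [measurable]: "?U \<in> borel_measurable (N \<Otimes>\<^sub>M N)"
    by (rule borel_measurable_graphon[OF U]) auto
  \<comment> \<open>The map \<open>\<phi>\<close> preserves measure, so \<open>U\<close> inherits
    its finite \<open>L^p\<close> norm from \<open>W\<close>.\<close>
  have "(\<integral>\<^sup>+z. ennreal (\<bar>?U z\<bar> powr p) \<partial>(N \<Otimes>\<^sub>M N))
      = (\<integral>\<^sup>+z. ennreal (\<bar>U (\<phi> (fst z)) (\<phi> (snd z))\<bar> powr p) \<partial>(M \<Otimes>\<^sub>M M))"
    by (subst nn_integral_pair_square[OF assms(2) \<phi> d\<phi>, symmetric]) auto
  also have "\<dots> = Lp_norm_pow p M W"
    unfolding Lp_norm_pow_def by (rule nn_integral_cong_AE) (use AE in auto)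
  finally have finU: "(\<integral>\<^sup>+z. ennreal (\<bar>?U z\<bar> powr p) \<partial>(N \<Otimes>\<^sub>M N)) < \<infinity>"
    using fin by simp
  have "Lp_approx p (N \<Otimes>\<^sub>M N) ?\<E> ?U"
  proof (rule Lp_approx_nonneg[OF _ p _ _ _ _ _ finU])
    show "finite_measure (N \<Otimes>\<^sub>M N)" by unfold_locales
    show "Int_stable ?\<E>" by (rule Int_stable_pair_measure_generator)
    show "sets (N \<Otimes>\<^sub>M N) = sigma_sets (space (N \<Otimes>\<^sub>M N)) ?\<E>"
      by (simp add: sets_pair_measure space_pair_measure)
    show "space (N \<Otimes>\<^sub>M N) \<in> ?\<E>" by (auto simp: space_pair_measure)
    show "0 \<le> ?U z" for z using U by (simp add: graphon_def)
  qed measurable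
  then obtain xs where xs: "snd ` set xs \<subseteq> ?\<E>"
    and small: "(\<integral>\<^sup>+z. ennreal (\<bar>?U z - step_fun xs z\<bar> powr p) \<partial>(N \<Otimes>\<^sub>M N)) < ennreal d"
    using \<open>d > 0\<close> by (rule Lp_approxD)
  have V[measurable]: "step_fun xs \<in> borel_measurable (N \<Otimes>\<^sub>M N)"
    using xs by (intro borel_measurable_step_fun) auto
  obtain \<A> where \<A>: "finite \<A>" "\<A> \<subseteq> sets N"
    and rect: "\<And>c E. (c, E) \<in> set xs \<Longrightarrow> \<exists>A\<in>\<A>. \<exists>B\<in>\<A>. E = A \<times> B"
    using finite_rect_sides[OF xs] by blast
  obtain \<nu> where \<nu>: "\<nu> \<in> couplings M M'" and agree: "AE z in \<nu>. \<forall>A\<in>\<A>. \<phi> (fst z) \<in> A \<longleftrightarrow> \<phi>' (snd z) \<in> A"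
    using partition_coupling[OF assms(2,3) \<phi> d\<phi> \<phi>' d\<phi>' \<A>] by blast
  note \<nu>D = couplingsD[OF \<nu>]
  have prob: "prob_space \<nu>" by (rule prob_space_coupling[OF \<nu> assms(2)])
  note [measurable] = \<nu>D(4,5)
  have [measurable]: "(\<lambda>z. W (fst (fst z)) (fst (snd z))) \<in> borel_measurable (\<nu> \<Otimes>\<^sub>M \<nu>)"
    "(\<lambda>z. W' (snd (fst z)) (snd (snd z))) \<in> borel_measurable (\<nu> \<Otimes>\<^sub>M \<nu>)"
    by (rule borel_measurable_graphon[OF W] borel_measurable_graphon[OF W'], measurable)+
  define V where "V x y = step_fun xs (x, y)" for x y
  have V_eq: "step_fun xs z = V (fst z) (snd z)" for z by (simp add: V_def)
  have V2[measurable]: "(\<lambda>z. V (fst z) (snd z)) \<in> borel_measurable (N \<Otimes>\<^sub>M N)"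
    using V by (simp add: V_def)
  note f = measure_preserving_comp[OF \<nu>D(4) \<nu>D(2) \<phi> d\<phi>]
  note f' = measure_preserving_comp[OF \<nu>D(5) \<nu>D(3) \<phi>' d\<phi>']
  note [measurable] = f(1) f'(1)
  have pull: "(\<lambda>z. V (g (fst z)) (g (snd z))) \<in> borel_measurable (\<nu> \<Otimes>\<^sub>M \<nu>)"
    if "g \<in> measurable \<nu> N" for g
    using measurable_compose[OF measurable_pair_square[OF that] V2] by simp
  note [measurable] = pull[OF f(1)] pull[OF f'(1)]
  have AE1: "AE z in \<nu> \<Otimes>\<^sub>M \<nu>. W (fst (fst z)) (fst (snd z)) = U (\<phi> (fst (fst z))) (\<phi> (fst (snd z)))"
    by (rule AE_pair_square[OF prob \<nu>D(4) \<nu>D(2) AE])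
  have AE2: "AE z in \<nu> \<Otimes>\<^sub>M \<nu>. W' (snd (fst z)) (snd (snd z)) = U (\<phi>' (snd (fst z))) (\<phi>' (snd (snd z)))"
    by (rule AE_pair_square[OF prob \<nu>D(5) \<nu>D(3) AE'])
  \<comment> \<open>The only place where the special coupling matters: both independent draws
    respect the cells, hence all sides of the rectangles of \<open>V\<close>.\<close>
  have AE3: "AE z in \<nu> \<Otimes>\<^sub>M \<nu>. V (\<phi> (fst (fst z))) (\<phi> (fst (snd z))) = V (\<phi>' (snd (fst z))) (\<phi>' (snd (snd z)))"
    using AE_pair_square_both[OF prob agree]
  proof (rule AE_mp, intro AE_I2 impI)
    fix z assume "(\<forall>A\<in>\<A>. \<phi> (fst (fst z)) \<in> A \<longleftrightarrow> \<phi>' (snd (fst z)) \<in> A) \<and>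
      (\<forall>A\<in>\<A>. \<phi> (fst (snd z)) \<in> A \<longleftrightarrow> \<phi>' (snd (snd z)) \<in> A)"
    then show "V (\<phi> (fst (fst z))) (\<phi> (fst (snd z))) = V (\<phi>' (snd (fst z))) (\<phi>' (snd (snd z)))"
      unfolding V_def by (intro step_fun_rect_cong[OF rect]) simp_all
  qed
  have 1: "(\<integral>\<^sup>+z. ennreal (\<bar>W (fst (fst z)) (fst (snd z)) - V (\<phi> (fst (fst z))) (\<phi> (fst (snd z)))\<bar> powr p) \<partial>(\<nu> \<Otimes>\<^sub>M \<nu>))
      < ennreal d"
  proof -
    have "(\<integral>\<^sup>+z. ennreal (\<bar>W (fst (fst z)) (fst (snd z)) - V (\<phi> (fst (fst z))) (\<phi> (fst (snd z)))\<bar> powr p) \<partial>(\<nu> \<Otimes>\<^sub>M \<nu>))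
      = (\<integral>\<^sup>+z. ennreal (\<bar>U (\<phi> (fst (fst z))) (\<phi> (fst (snd z))) - V (\<phi> (fst (fst z))) (\<phi> (fst (snd z)))\<bar> powr p) \<partial>(\<nu> \<Otimes>\<^sub>M \<nu>))"
      by (rule nn_integral_cong_AE) (use AE1 in eventually_elim, simp)
    also have "\<dots> = (\<integral>\<^sup>+z. ennreal (\<bar>?U z - V (fst z) (snd z)\<bar> powr p) \<partial>(N \<Otimes>\<^sub>M N))"
      by (subst nn_integral_pair_square[OF prob f, symmetric]) auto
    finally show ?thesis using small by (simp add: V_eq)
  qed
  have 2: "(\<integral>\<^sup>+z. ennreal (\<bar>V (\<phi> (fst (fst z))) (\<phi> (fst (snd z))) - W' (snd (fst z)) (snd (snd z))\<bar> powr p) \<partial>(\<nu> \<Otimes>\<^sub>M \<nu>))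
      < ennreal d"
  proof -
    have "(\<integral>\<^sup>+z. ennreal (\<bar>V (\<phi> (fst (fst z))) (\<phi> (fst (snd z))) - W' (snd (fst z)) (snd (snd z))\<bar> powr p) \<partial>(\<nu> \<Otimes>\<^sub>M \<nu>))
      = (\<integral>\<^sup>+z. ennreal (\<bar>U (\<phi>' (snd (fst z))) (\<phi>' (snd (snd z))) - V (\<phi>' (snd (fst z))) (\<phi>' (snd (snd z)))\<bar> powr p) \<partial>(\<nu> \<Otimes>\<^sub>M \<nu>))"
      by (rule nn_integral_cong_AE) (use AE2 AE3 in eventually_elim, simp add: abs_minus_commute)
    also have "\<dots> = (\<integral>\<^sup>+z. ennreal (\<bar>?U z - V (fst z) (snd z)\<bar> powr p) \<partial>(N \<Otimes>\<^sub>M N))"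
      by (subst nn_integral_pair_square[OF prob f', symmetric]) auto
    finally show ?thesis using small by (simp add: V_eq)
  qed
  have "(\<integral>\<^sup>+z. ennreal (\<bar>overlay W W' z\<bar> powr p) \<partial>(\<nu> \<Otimes>\<^sub>M \<nu>))
    = (\<integral>\<^sup>+z. ennreal (\<bar>(W (fst (fst z)) (fst (snd z)) - V (\<phi> (fst (fst z))) (\<phi> (fst (snd z))))
      + (V (\<phi> (fst (fst z))) (\<phi> (fst (snd z))) - W' (snd (fst z)) (snd (snd z)))\<bar> powr p) \<partial>(\<nu> \<Otimes>\<^sub>M \<nu>))"
    by simp
  also have "\<dots> \<le> ennreal (2 powr p) *
     ((\<integral>\<^sup>+z. ennreal (\<bar>W (fst (fst z)) (fst (snd z)) - V (\<phi> (fst (fst z))) (\<phi> (fst (snd z)))\<bar> powr p) \<partial>(\<nu> \<Otimes>\<^sub>M \<nu>))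
     + (\<integral>\<^sup>+z. ennreal (\<bar>V (\<phi> (fst (fst z))) (\<phi> (fst (snd z))) - W' (snd (fst z)) (snd (snd z))\<bar> powr p) \<partial>(\<nu> \<Otimes>\<^sub>M \<nu>)))"
    by (intro nn_integral_powr_add_le p) measurable
  also have "\<dots> < ennreal e"
    using 1 2 by (intro ennreal_two_powr_bound p e) (simp_all add: d_def)
  finally show "\<exists>\<nu>\<in>couplings M M'.
      (\<integral>\<^sup>+z. ennreal (\<bar>overlay W W' z\<bar> powr p) \<partial>(\<nu> \<Otimes>\<^sub>M \<nu>)) < ennreal e"
    using \<nu> by blast
qed

text \<open>Compares \<open>L^1\<close> with \<open>L^p\<close> on a probability space, as Jensen's
  inequality would. Above the threshold \<open>d\<close> write
  \<open>a = a powr (1 - p) * a powr p\<close> and use that the exponent \<open>1 - p\<close> is not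
  positive.\<close>

lemma le_add_powr_mult:
  fixes a d p :: real
  assumes "p \<ge> 1" "d > 0" "a \<ge> 0"
  shows "a \<le> d + d powr (1 - p) * a powr p"
proof (cases "a \<le> d")
  case True
  then show ?thesis by (simp add: add_increasing2)
next
  case False
  then have "a = a powr (1 - p) * a powr p"
    using assms by (simp flip: powr_add)
  also have "\<dots> \<le> d powr (1 - p) * a powr p"
    using False assms by (intro mult_right_mono powr_mono2') auto
  finally show ?thesis using assms by linarith
qed

text \<open>Outside the integrable case the Bochner integral is 0 by convention, so the bound
  persists.\<close>

lemma abs_set_lebesgue_integral_le:
  fixes f :: "'a \<Rightarrow> real"
  shows "ennreal \<bar>set_lebesgue_integral M A f\<bar> \<le> (\<integral>\<^sup>+z. ennreal \<bar>f z\<bar> \<partial>M)"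
proof (cases "set_integrable M A f")
  case True
  have "ennreal \<bar>set_lebesgue_integral M A f\<bar> \<le> (\<integral>\<^sup>+z. ennreal (norm (indicator A z *\<^sub>R f z)) \<partial>M)"
    using integral_norm_bound_ennreal[OF True[unfolded set_integrable_def]]
    by (simp add: set_lebesgue_integral_def)
  also have "\<dots> \<le> (\<integral>\<^sup>+z. ennreal \<bar>f z\<bar> \<partial>M)"
    by (intro nn_integral_mono) (auto split: split_indicator)
  finally show ?thesis .
qed (simp add: set_lebesgue_integral_def set_integrable_def not_integrable_integral_eq)

text \<open>The \<open>L^1\<close> norm of the difference bounds the integrals over all rectangles
  at once, for one and the same coupling.\<close>

lemma delta_p_imp_delta_cut:
  assumes p: "p \<ge> 1" and "prob_space M"
    and W: "graphon M W" and W': "graphon M' W'" and 0: "delta_p p M W M' W' = 0"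
  shows "delta_cut M W M' W' = 0"
  unfolding delta_cut_eq_0_iff
proof (intro allI impI)
  fix e :: real assume e: "e > 0"
  \<comment> \<open>With a cost below \<open>d powr p\<close> the threshold inequality gives
    \<open>d + d powr (1 - p) * d powr p = 2 * d = e\<close>.\<close>
  define d where "d = e / 2"
  have d: "d > 0" using e by (simp add: d_def)
  obtain \<nu> where \<nu>: "\<nu> \<in> couplings M M'"
    and small: "(\<integral>\<^sup>+z. ennreal (\<bar>overlay W W' z\<bar> powr p) \<partial>(\<nu> \<Otimes>\<^sub>M \<nu>)) < ennreal (d powr p)"
    using 0[unfolded delta_p_eq_0_iff[OF less_le_trans[OF zero_less_one p]], rule_format, of "d powr p"] d
    by auto
  interpret \<nu>: prob_space \<nu> by (rule prob_space_coupling[OF \<nu> assms(2)])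
  interpret \<nu>\<nu>: pair_prob_space \<nu> \<nu> ..
  note [measurable] = couplingsD(4,5)[OF \<nu>]
  have [measurable]: "(\<lambda>z. W (fst (fst z)) (fst (snd z))) \<in> borel_measurable (\<nu> \<Otimes>\<^sub>M \<nu>)"
    "(\<lambda>z. W' (snd (fst z)) (snd (snd z))) \<in> borel_measurable (\<nu> \<Otimes>\<^sub>M \<nu>)"
    by (rule borel_measurable_graphon[OF W] borel_measurable_graphon[OF W'], measurable)+
  have "(\<integral>\<^sup>+z. ennreal \<bar>overlay W W' z\<bar> \<partial>(\<nu> \<Otimes>\<^sub>M \<nu>))
      \<le> (\<integral>\<^sup>+z. ennreal d + ennreal (d powr (1 - p)) * ennreal (\<bar>overlay W W' z\<bar> powr p) \<partial>(\<nu> \<Otimes>\<^sub>M \<nu>))"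
    using d le_add_powr_mult[OF p d, of "\<bar>overlay W W' z\<bar>" for z]
    by (intro nn_integral_mono) (simp flip: ennreal_plus ennreal_mult)
  also have "\<dots> = ennreal d + ennreal (d powr (1 - p)) * (\<integral>\<^sup>+z. ennreal (\<bar>overlay W W' z\<bar> powr p) \<partial>(\<nu> \<Otimes>\<^sub>M \<nu>))"
    by (subst nn_integral_add) (auto simp: nn_integral_cmult \<nu>\<nu>.emeasure_space_1)
  also have "\<dots> \<le> ennreal d + ennreal (d powr (1 - p)) * ennreal (d powr p)"
    using small by (intro add_left_mono mult_left_mono) auto
  also have "\<dots> = ennreal e"
    using d by (simp add: d_def flip: ennreal_plus ennreal_mult powr_add)
  finally have "(\<integral>\<^sup>+z. ennreal \<bar>overlay W W' z\<bar> \<partial>(\<nu> \<Otimes>\<^sub>M \<nu>)) \<le> ennreal e" .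
  then have "ennreal \<bar>set_lebesgue_integral (\<nu> \<Otimes>\<^sub>M \<nu>) A (overlay W W')\<bar> \<le> ennreal e" for A
    by (rule order_trans[OF abs_set_lebesgue_integral_le])
  then have le: "\<bar>set_lebesgue_integral (\<nu> \<Otimes>\<^sub>M \<nu>) A (overlay W W')\<bar> \<le> e" for A
    using e by (simp add: ennreal_le_iff)
  show "\<exists>\<nu>\<in>couplings M M'. \<forall>S\<in>sets (M \<Otimes>\<^sub>M M'). \<forall>T\<in>sets (M \<Otimes>\<^sub>M M').
      \<bar>set_lebesgue_integral (\<nu> \<Otimes>\<^sub>M \<nu>) (S \<times> T) (overlay W W')\<bar> \<le> e"
    by (intro bexI[OF _ \<nu>] ballI le)
qed

subsection \<open>Factorization through the Cantor space\<close>

text \<open>Makes the type \<open>nat \<Rightarrow> bool\<close> second countable, so that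
  measurability into it can be checked coordinatewise and its Borel sets are compatible with
  products.\<close>

instance bool :: second_countable_topology
proof
  show "\<exists>B::bool set set. countable B \<and> open = generate_topology B"
  proof (intro exI[of _ UNIV] conjI ext)
    show "open S = generate_topology UNIV S" for S :: "bool set"
      by (simp add: discrete_topology_class.open_discrete generate_topology.Basis)
  qed (simp add: countable_finite)
qed

text \<open>The Marczewski function of a sequence of sets: whatever the sequence generates becomes a
  preimage of a Borel set of the Cantor space.\<close>

definition bits :: "(nat \<Rightarrow> 'a set) \<Rightarrow> 'a \<Rightarrow> nat \<Rightarrow> bool" where
  "bits A x = (\<lambda>i. x \<in> A i)"

lemma measurable_bits:
  assumes "\<And>i. A i \<in> sets C"
  shows "bits A \<in> measurable C borel"
  unfolding bits_def
proof (rule measurable_coordinatewise_then_product)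
  fix i
  have "{x \<in> space C. x \<in> A i} \<in> sets C"
    using assms by (metis sets.Int_space_eq1 Collect_conj_eq Collect_mem_eq)
  then have "(\<lambda>x. x \<in> A i) \<in> measurable C (count_space UNIV)"
    by (simp add: pred_def)
  then show "(\<lambda>x. x \<in> A i) \<in> borel_measurable C"
    by (rule measurable_compose) simp
qed

text \<open>Inverse to interleaving by the pairing function: it reads one sequence out of a single
  point that codes countably many.\<close>

definition bit_row :: "nat \<Rightarrow> (nat \<Rightarrow> bool) \<Rightarrow> nat \<Rightarrow> bool" where
  "bit_row i b = (\<lambda>j. b (prod_encode (i, j)))"

lemma measurable_bit_row [measurable]: "bit_row i \<in> borel_measurable borel"
  unfolding bit_row_def
  by (intro measurable_coordinatewise_then_product measurable_product_coordinates)

lemma bit_row_bits: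
  "bit_row i (bits (\<lambda>n. case prod_decode n of (i, j) \<Rightarrow> A i j) x) = bits (A i) x"
  by (simp add: bit_row_def bits_def)

text \<open>Each set of the sequence comes with its own coding sequence. All of them are interleaved
  into one, so a single map into the Cantor space serves every \<open>E i\<close>;
  \<open>bit_row\<close> restores the individual codes.\<close>

lemma factor_sets_bits:
  fixes E :: "nat \<Rightarrow> ('a \<times> 'a) set"
  assumes "\<And>i. \<exists>A E'. (\<forall>j. A j \<in> sets C) \<and> E' \<in> sets (borel \<Otimes>\<^sub>M borel) \<and>
      (\<forall>x\<in>space C. \<forall>y\<in>space C. (x, y) \<in> E i \<longleftrightarrow> (bits A x, bits A y) \<in> E')"
  obtains A E' where "\<And>j. A j \<in> sets C" "\<And>i. E' i \<in> sets (borel \<Otimes>\<^sub>M borel)"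
      "\<And>i x y. x \<in> space C \<Longrightarrow> y \<in> space C \<Longrightarrow> (x, y) \<in> E i \<longleftrightarrow> (bits A x, bits A y) \<in> E' i"
proof -
  obtain A E' where A: "\<And>i j. A i j \<in> sets C" and E': "\<And>i. E' i \<in> sets (borel \<Otimes>\<^sub>M borel)"
    and iff: "\<And>i. \<forall>x\<in>space C. \<forall>y\<in>space C. (x, y) \<in> E i \<longleftrightarrow> (bits (A i) x, bits (A i) y) \<in> E' i"
    using assms by metis
  let ?B = "\<lambda>n. case prod_decode n of (i, j) \<Rightarrow> A i j"
  show ?thesis
  proof (rule that[of ?B "\<lambda>i. (\<lambda>z. (bit_row i (fst z), bit_row i (snd z))) -` E' i \<inter> space (borel \<Otimes>\<^sub>M borel)"])
    show "(\<lambda>z. (bit_row i (fst z), bit_row i (snd z))) -` E' i \<inter> space (borel \<Otimes>\<^sub>M borel)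
        \<in> sets (borel \<Otimes>\<^sub>M borel)" for i
      using E' by (intro measurable_sets[OF measurable_pair_square[OF measurable_bit_row]])
    show "?B j \<in> sets C" for j using A by (simp split: prod.split)
  qed (use iff in \<open>simp add: space_pair_measure bit_row_bits\<close>)
qed

text \<open>The sets that depend on countably many members of \<open>sets C\<close> form a
  \<sigma>-algebra containing the rectangles. The union step is where the codes must be
  merged.\<close>

lemma factor_set_bits:
  assumes "E \<in> sets (C \<Otimes>\<^sub>M C)"
  shows "\<exists>A E'. (\<forall>j. A j \<in> sets C) \<and> E' \<in> sets (borel \<Otimes>\<^sub>M borel) \<and>
      (\<forall>x\<in>space C. \<forall>y\<in>space C. (x, y) \<in> E \<longleftrightarrow> (bits A x, bits A y) \<in> E')"
  using assms[unfolded sets_pair_measure]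
proof (induction rule: sigma_sets.induct)
  case (Basic E)
  then obtain A B where E: "A \<in> sets C" "B \<in> sets C" "E = A \<times> B" by auto
  \<comment> \<open>For the rectangle \<open>A \<times> B\<close>, bit 0 will record membership in
    \<open>A\<close> and every other bit membership in \<open>B\<close>; the rectangle is seen in
    bit 0 of the first point and bit 1 of the second.\<close>
  have "(\<lambda>z. (fst z :: nat \<Rightarrow> bool) 0) \<in> borel_measurable (borel \<Otimes>\<^sub>M (borel :: (nat \<Rightarrow> bool) measure))"
    "(\<lambda>z. (snd z :: nat \<Rightarrow> bool) 1) \<in> borel_measurable ((borel :: (nat \<Rightarrow> bool) measure) \<Otimes>\<^sub>M borel)"
    by (rule measurable_compose[OF measurable_fst measurable_product_coordinates]
        measurable_compose[OF measurable_snd measurable_product_coordinates])+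
  note m = this[THEN measurable_sets, OF borel_singleton[OF sets.empty_sets, of True], unfolded space_pair_measure space_borel UNIV_Times_UNIV]
  have "((\<lambda>z. (fst z :: nat \<Rightarrow> bool) 0) -` {True} \<inter> UNIV) \<inter> ((\<lambda>z. (snd z :: nat \<Rightarrow> bool) 1) -` {True} \<inter> UNIV)
      \<in> sets (borel \<Otimes>\<^sub>M borel)"
    by (rule sets.Int[OF m])
  also have "((\<lambda>z. (fst z :: nat \<Rightarrow> bool) 0) -` {True} \<inter> UNIV) \<inter> ((\<lambda>z. (snd z :: nat \<Rightarrow> bool) 1) -` {True} \<inter> UNIV)
      = {z. fst z 0 \<and> snd z 1}" by auto
  finally have "{z. (fst z :: nat \<Rightarrow> bool) 0 \<and> (snd z :: nat \<Rightarrow> bool) 1} \<in> sets (borel \<Otimes>\<^sub>M borel)" .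
  then show ?case
    using E by (intro exI[of _ "\<lambda>i. if i = 0 then A else B"] exI[of _ "{z. fst z 0 \<and> snd z 1}"])
      (auto simp: bits_def)
next
  case Empty
  show ?case by (intro exI[of _ "\<lambda>_. {}"] exI[of _ "{}"]) auto
next
  case (Compl E)
  then obtain A E' where A: "\<forall>j. A j \<in> sets C" "E' \<in> sets (borel \<Otimes>\<^sub>M borel)"
    "\<forall>x\<in>space C. \<forall>y\<in>space C. (x, y) \<in> E \<longleftrightarrow> (bits A x, bits A y) \<in> E'" by blast
  have "UNIV - E' \<in> sets (borel \<Otimes>\<^sub>M borel)"
    using sets.compl_sets[OF A(2)] by (simp only: space_pair_measure space_borel UNIV_Times_UNIV)
  then show ?case
    using A by (intro exI[of _ A] exI[of _ "UNIV - E'"]) auto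
next
  case (Union E)
  obtain A E' where "\<And>j. A j \<in> sets C" "\<And>i. E' i \<in> sets (borel \<Otimes>\<^sub>M borel)"
      "\<And>i x y. x \<in> space C \<Longrightarrow> y \<in> space C \<Longrightarrow> (x, y) \<in> E i \<longleftrightarrow> (bits A x, bits A y) \<in> E' i"
    using factor_sets_bits[of C E] Union by blast
  then show ?case
    by (intro exI[of _ A] exI[of _ "\<Union>i. E' i"]) auto
qed

text \<open>Recovers a value from the countably many questions whether it exceeds a rational.
  Negative rationals become 0 under \<open>ennreal\<close> and contribute nothing.\<close>

lemma ennreal_eq_SUP_rat:
  fixes x :: ennreal
  shows "x = (SUP n::nat. ennreal (real_of_rat (from_nat n)) * indicator {y. ennreal (real_of_rat (from_nat n)) < y} x)"
    (is "_ = (SUP n. ?r n * ?i n)")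
proof (rule antisym)
  show "x \<le> (SUP n. ?r n * ?i n)"
  proof (rule dense_le)
    fix y assume "y < x"
    then obtain q :: rat where q: "y < ennreal (real_of_rat q)" "ennreal (real_of_rat q) < x"
      using ennreal_rat_dense by blast
    have "y \<le> ?r (to_nat q) * ?i (to_nat q)" using q by simp
    then show "y \<le> (SUP n. ?r n * ?i n)" by (rule SUP_upper2[OF UNIV_I])
  qed
  show "(SUP n. ?r n * ?i n) \<le> x"
    by (rule SUP_least) (auto split: split_indicator)
qed

text \<open>A Doob-Dynkin factorization: the superlevel sets at rational thresholds are coded
  together, and the function is rebuilt from them as a supremum. Thresholds in
  \<open>ennreal\<close> see only the positive part, whence \<open>max 0\<close>.\<close>

lemma factor_fun_bits:
  fixes f :: "'a \<times> 'a \<Rightarrow> real"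
  assumes f[measurable]: "f \<in> borel_measurable (C \<Otimes>\<^sub>M C)"
  obtains A V where "\<And>i. A i \<in> sets C" "V \<in> borel_measurable (borel \<Otimes>\<^sub>M borel)" "\<And>w. 0 \<le> V w"
    "\<And>x y. x \<in> space C \<Longrightarrow> y \<in> space C \<Longrightarrow> max 0 (f (x, y)) = V (bits A x, bits A y)"
proof -
  let ?r = "\<lambda>n::nat. ennreal (real_of_rat (from_nat n))"
  let ?E = "\<lambda>n. {z \<in> space (C \<Otimes>\<^sub>M C). ?r n < ennreal (f z)}"
  have E: "?E n \<in> sets (C \<Otimes>\<^sub>M C)" for n by measurable
  obtain A E' where A: "\<And>j. A j \<in> sets C" and E'[measurable]: "\<And>i. E' i \<in> sets (borel \<Otimes>\<^sub>M borel)"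
    and iff: "\<And>i x y. x \<in> space C \<Longrightarrow> y \<in> space C \<Longrightarrow> (x, y) \<in> ?E i \<longleftrightarrow> (bits A x, bits A y) \<in> E' i"
    using factor_sets_bits[of C ?E, OF factor_set_bits[OF E]] by blast
  \<comment> \<open>Away from the coded pairs the supremum may be infinite; \<open>enn2real\<close>
    then returns 0, so \<open>V\<close> is real and nonnegative on the whole square.\<close>
  define V where "V w = enn2real (SUP n. ?r n * indicator (E' n) w)" for w
  show ?thesis
  proof (rule that[OF A, of V])
    show "V \<in> borel_measurable (borel \<Otimes>\<^sub>M borel)" unfolding V_def by measurable
    show "0 \<le> V w" for w by (simp add: V_def)
    fix x y assume xy: "x \<in> space C" "y \<in> space C"
    have "indicator (E' n) (bits A x, bits A y) = (indicator {u. ?r n < u} (ennreal (f (x, y))) :: ennreal)" for n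
      using iff[OF xy, of n] xy by (auto simp: indicator_def space_pair_measure)
    then have "V (bits A x, bits A y) = enn2real (ennreal (f (x, y)))"
      unfolding V_def by (simp flip: ennreal_eq_SUP_rat)
    then show "max 0 (f (x, y)) = V (bits A x, bits A y)" 
      by (cases "f (x, y) \<ge> 0") (simp_all add: max_def ennreal_neg)
  qed
qed

subsection \<open>Limits of couplings\<close>

lemma compact_UNIV_bits: "compact (UNIV :: (nat \<Rightarrow> bool) set)"
proof -
  have "compactin (product_topology (\<lambda>_::nat. euclidean :: bool topology) UNIV) (PiE UNIV (\<lambda>_. UNIV))"
    by (subst compactin_PiE) (simp add: finite_imp_compact)
  then show ?thesis by (simp add: euclidean_product_topology PiE_UNIV_domain)
qed

text \<open>Pulls a cluster point of the images back to a proper filter on the indices, in place of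
  a subsequence.\<close>

lemma inf_filtercomap_neq_bot:
  assumes "inf F (filtermap f G) \<noteq> bot"
  shows "inf (filtercomap f F) G \<noteq> bot"
proof
  assume "inf (filtercomap f F) G = bot"
  then have "eventually (\<lambda>_. False) (inf (filtercomap f F) G)" by simp
  then obtain Q R where QR: "eventually Q (filtercomap f F)" "eventually R G" "\<And>n. \<not> (Q n \<and> R n)"
    by (auto simp: eventually_inf)
  then obtain Q' where Q': "eventually Q' F" "\<And>n. Q' (f n) \<Longrightarrow> Q n"
    by (auto simp: eventually_filtercomap)
  have "eventually (\<lambda>n. \<not> Q' (f n)) G"
    using QR(2) by (rule eventually_mono) (use QR(3) Q'(2) in blast)
  then have "eventually (\<lambda>x. \<not> Q' x) (filtermap f G)"
    by (simp add: eventually_filtermap)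
  with Q'(1) have "eventually (\<lambda>_. False) (inf F (filtermap f G))"
    unfolding eventually_inf by (intro exI[of _ Q'] exI[of _ "\<lambda>x. \<not> Q' x"]) simp
  then show False using assms by (simp add: trivial_limit_def)
qed

text \<open>Tychonoff's theorem for the cube over an arbitrary index type. Such a cube need not be
  sequentially compact, so the limits are taken along a filter \<open>G\<close> finer than
  \<open>sequentially\<close>.\<close>

lemma unit_interval_cluster_point:
  fixes m :: "nat \<Rightarrow> 'i \<Rightarrow> real"
  assumes "\<And>n i. m n i \<in> {0..1}"
  obtains G L where "G \<noteq> bot" "G \<le> sequentially" "\<And>i. ((\<lambda>n. m n i) \<longlongrightarrow> L i) G"
proof -
  let ?K = "PiE UNIV (\<lambda>_::'i. {0..1::real})"
  have "compactin (product_topology (\<lambda>_::'i. euclidean :: real topology) UNIV) ?K"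
    by (subst compactin_PiE) simp
  then have "compact ?K" by (simp add: euclidean_product_topology)
  moreover have "eventually (\<lambda>x. x \<in> ?K) (filtermap m sequentially)"
    using assms by (simp add: eventually_filtermap PiE_UNIV_domain)
  ultimately obtain L where L: "inf (nhds L) (filtermap m sequentially) \<noteq> bot"
    unfolding compact_filter by (metis filtermap_bot_iff trivial_limit_sequentially)
  \<comment> \<open>The indices whose images approach \<open>L\<close>, intersected with the tails
    of the sequence.\<close>
  define G where "G = inf (filtercomap m (nhds L)) sequentially"
  have "filterlim m (nhds L) G"
    unfolding G_def by (rule filterlim_mono[OF filterlim_filtercomap order_refl inf_le1])
  then have "((\<lambda>n. m n i) \<longlongrightarrow> L i) G" for i
    by (rule continuous_on_tendsto_compose[OF continuous_on_product_coordinates]) simp_all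
  moreover have "G \<noteq> bot"
    unfolding G_def by (rule inf_filtercomap_neq_bot[OF L])
  ultimately show ?thesis
    by (intro that[of G L]) (simp_all add: G_def)
qed

text \<open>For the Cantor space and its square this algebra generates the Borel sets; preimages
  under continuous maps stay in it.\<close>

definition clopens :: "'k::topological_space set set" where
  "clopens = {C. open C \<and> closed C}"

lemma algebra_clopens: "algebra UNIV clopens"
  by (auto simp: algebra_iff_Un clopens_def open_Compl closed_Compl Compl_eq_Diff_UNIV[symmetric])

text \<open>Compactness turns countable additivity on clopen sets into finite additivity: continuity
  at the empty set is trivial along a sequence that becomes empty after finitely many steps.\<close>

lemma decseq_clopens_empty:
  fixes A :: "nat \<Rightarrow> 'k::topological_space set"
  assumes "compact (UNIV :: 'k set)" "range A \<subseteq> clopens" "decseq A" "(\<Inter>i. A i) = {}"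
  obtains n where "A n = {}"
proof (rule ccontr)
  assume "\<not> thesis"
  then have ne: "A n \<noteq> {}" for n using that by blast
  have fip: "UNIV \<inter> \<Inter>F \<noteq> {}" if F: "finite F" "F \<subseteq> range A" for F
  proof -
    obtain I where I: "finite I" "F = A ` I"
      using finite_subset_image[OF F] by blast
    \<comment> \<open>The inserted 0 gives the maximum a meaning when the finite family is
      empty.\<close>
    have "A (Max (insert 0 I)) \<subseteq> A i" if "i \<in> I" for i
      by (rule decseqD[OF assms(3)], rule Max_ge) (use I that in simp_all)
    then have "A (Max (insert 0 I)) \<subseteq> UNIV \<inter> \<Inter>F"
      unfolding I(2) by blast
    then show ?thesis using ne[of "Max (insert 0 I)"] by blast
  qed
  have closed: "closed T" if "T \<in> range A" for T
    using assms(2) that by (auto simp: clopens_def)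
  have "UNIV \<inter> \<Inter>(range A) \<noteq> {}"
    by (rule compact_imp_fip[OF assms(1) closed fip])
  then show False using assms(4) by simp
qed

text \<open>Weak compactness of probability measures in a form that needs no test functions:
  convergence on clopen sets, with the limit extended by Caratheodory's theorem.\<close>

lemma prob_measures_cluster_clopens:
  fixes P :: "nat \<Rightarrow> 'k::topological_space measure"
  assumes K: "compact (UNIV :: 'k set)" and P: "\<And>n. prob_space (P n)"
    and sp: "\<And>n. space (P n) = UNIV" and clop: "\<And>n. clopens \<subseteq> sets (P n)"
  obtains G \<nu> where "G \<noteq> bot" "G \<le> sequentially" "prob_space \<nu>" "space \<nu> = UNIV"
    "sets \<nu> = sigma_sets UNIV clopens"
    "\<And>C. C \<in> clopens \<Longrightarrow> ((\<lambda>n. measure (P n) C) \<longlongrightarrow> measure \<nu> C) G"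
proof -
  have unit: "measure (P n) C \<in> {0..1}" for n C
    using prob_space.prob_le_1[OF P] by simp
  \<comment> \<open>The cube is indexed by all sets. Only the values of \<open>L\<close> on clopen
    sets are used afterwards, since elsewhere \<open>L\<close> may fail to be countably
    additive.\<close>
  obtain G L where G: "G \<noteq> bot" "G \<le> sequentially"
    and L: "\<And>C. ((\<lambda>n. measure (P n) C) \<longlongrightarrow> L C) G"
    by (rule unit_interval_cluster_point[of "\<lambda>n C. measure (P n) C", OF unit]) (rule that, assumption+)
  have L0: "L C \<ge> 0" for C
    by (rule tendsto_lowerbound[OF L _ G(1)]) simp
  have "((\<lambda>n. measure (P n) UNIV) \<longlongrightarrow> 1) G"
    using prob_space.prob_space[OF P] sp by simp
  then have L1: "L UNIV = 1" using tendsto_unique[OF G(1) L] by blast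
  have Ladd: "L (A \<union> B) = L A + L B" if "A \<in> clopens" "B \<in> clopens" "A \<inter> B = {}" for A B
  proof -
    have "measure (P n) (A \<union> B) = measure (P n) A + measure (P n) B" for n
    proof -
      interpret prob_space "P n" by (rule P)
      show ?thesis using that clop by (intro finite_measure_Union) auto
    qed
    then have "((\<lambda>n. measure (P n) (A \<union> B)) \<longlongrightarrow> L A + L B) G"
      using tendsto_add[OF L L] by simp
    then show ?thesis using tendsto_unique[OF G(1) L] by blast
  qed
  interpret algebra UNIV "clopens :: 'k set set" by (rule algebra_clopens)
  have Lempty: "L {} = 0" using Ladd[of "{}" "{}"] by simp
  obtain \<mu> where \<mu>: "\<And>C. C \<in> clopens \<Longrightarrow> \<mu> C = ennreal (L C)"
    and ms: "measure_space UNIV (sigma_sets UNIV clopens) \<mu>"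
  proof -
    have "\<exists>\<mu> :: 'k set \<Rightarrow> ennreal. (\<forall>s\<in>clopens. \<mu> s = ennreal (L s)) \<and> measure_space UNIV (sigma_sets UNIV clopens) \<mu>"
    proof (rule caratheodory_empty_continuous)
      show "positive clopens (\<lambda>s. ennreal (L s))" by (simp add: positive_def Lempty)
      show "additive clopens (\<lambda>s. ennreal (L s))" by (simp add: additive_def Ladd L0 flip: ennreal_plus)
      fix A :: "nat \<Rightarrow> 'k set" assume A: "range A \<subseteq> clopens" "decseq A" "(\<Inter>i. A i) = {}"
      then obtain n where "A n = {}" using decseq_clopens_empty[OF K] by blast
      then have "eventually (\<lambda>i. ennreal (L (A i)) = 0) sequentially"
        using decseqD[OF A(2)] Lempty by (intro eventually_sequentiallyI[of n]) force
      then show "(\<lambda>i. ennreal (L (A i))) \<longlonglongrightarrow> 0" by (rule tendsto_eventually)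
    qed simp
    then show ?thesis using that by blast
  qed
  define \<nu> where "\<nu> = measure_of UNIV clopens \<mu>"
  have sets: "sets \<nu> = sigma_sets UNIV clopens" and space: "space \<nu> = UNIV"
    by (simp_all add: \<nu>_def)
  have em: "emeasure \<nu> C = ennreal (L C)" if "C \<in> clopens" for C
  proof -
    have "emeasure \<nu> C = \<mu> C"
      by (rule emeasure_measure_of[OF \<nu>_def])
        (use ms that in \<open>simp_all add: sets measure_space_def sigma_sets.Basic\<close>)
    then show ?thesis using \<mu>[OF that] by simp
  qed
  have "prob_space \<nu>"
    by standard (simp add: space em L1)
  moreover have "((\<lambda>n. measure (P n) C) \<longlongrightarrow> measure \<nu> C) G" if "C \<in> clopens" for C
    using L[of C] em[OF that] L0[of C] by (simp add: measure_def)
  ultimately show ?thesis using that[OF G _ space sets] by blast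
qed

section \<open>Generators of product spaces and vanishing integrals\<close>

lemma AE_zero_generator:
  fixes d :: "'a \<Rightarrow> real"
  assumes "finite_measure M" and int: "integrable M d" and stable: "Int_stable \<E>"
    and gen: "sets M = sigma_sets (space M) \<E>" and space: "space M \<in> \<E>"
    and zero: "\<And>E. E \<in> \<E> \<Longrightarrow> set_lebesgue_integral M E d = 0"
  shows "AE x in M. d x = 0"
proof -
  interpret finite_measure M by fact
  have sub: "\<E> \<subseteq> Pow (space M)" using gen sets.space_closed by (metis sigma_sets.Basic subset_iff)
  have si: "set_integrable M A d" if "A \<in> sets M" for A
    unfolding set_integrable_def using that int by (rule integrable_mult_indicator)
  have "set_lebesgue_integral M A d = 0" if "A \<in> sets M" for A
    using stable sub that[unfolded gen]
  proof (induction rule: sigma_sets_induct_disjoint)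
    case (basic A)
    then show ?case by (rule zero)
  next
    case empty
    show ?case by (simp add: set_lebesgue_integral_def)
  next
    case (compl A)
    then have A: "A \<in> sets M" using gen by simp
    have "set_lebesgue_integral M (A \<union> (space M - A)) d
        = set_lebesgue_integral M A d + set_lebesgue_integral M (space M - A) d"
      using A by (intro set_integral_Un si) auto
    moreover have "A \<union> (space M - A) = space M" using sets.sets_into_space[OF A] by blast
    ultimately show ?case using zero[OF space] compl by simp
  next
    case (union A)
    have A: "A i \<in> sets M" for i using union(2) gen by auto
    have "set_lebesgue_integral M (\<Union>i. A i) d = (\<Sum>i. set_lebesgue_integral M (A i) d)"
      using union(1) A by (intro lebesgue_integral_countable_add si) (auto simp: disjoint_family_on_def)
    then show ?case using union(3) by simp
  qed
  \<comment> \<open>Two integrable densities with the same integrals over all measurable sets agree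
    almost everywhere; the second one is the constant 0.\<close>
  then show ?thesis
    using density_unique_real[OF int, of "\<lambda>_. 0"] by (simp add: set_lebesgue_integral_def)
qed

text \<open>A coordinate of \<open>T\<close> maps continuously into a discrete space, so its
  preimages are clopen. Used with the identity and with the two projections, this shows that clopen
  sets generate the Borel sets of the Cantor space and of its square.\<close>

lemma measurable_clopens_bits:
  fixes T :: "'k::topological_space \<Rightarrow> nat \<Rightarrow> bool"
  assumes "continuous_on UNIV T"
  shows "T \<in> measurable (sigma UNIV clopens) borel"
proof (rule measurable_coordinatewise_then_product)
  fix i
  have cont: "continuous_on UNIV (\<lambda>x. T x i)"
    using continuous_on_compose2[OF continuous_on_product_coordinates assms] by simp
  show "(\<lambda>x. T x i) \<in> borel_measurable (sigma UNIV clopens)"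
  proof (rule measurableI)
    fix A :: "bool set"
    have "open ((\<lambda>x. T x i) -` A)" "closed ((\<lambda>x. T x i) -` A)"
      using cont by (auto intro!: open_vimage closed_vimage simp: closed_def discrete_topology_class.open_discrete)
    then show "(\<lambda>x. T x i) -` A \<inter> space (sigma UNIV clopens) \<in> sets (sigma UNIV clopens)"
      by (simp add: clopens_def sigma_sets.Basic)
  qed simp
qed

lemma clopens_subset_borel: "clopens \<subseteq> sets borel"
  by (auto simp: clopens_def)

lemma sets_borel_bits: "sets (borel :: (nat \<Rightarrow> bool) measure) = sigma_sets UNIV clopens"
proof
  have id: "(\<lambda>x. x) \<in> measurable (sigma UNIV (clopens :: (nat \<Rightarrow> bool) set set)) borel"
    by (rule measurable_clopens_bits) (rule continuous_on_id)
  show "sets (borel :: (nat \<Rightarrow> bool) measure) \<subseteq> sigma_sets UNIV clopens"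
    using measurable_sets[OF id] by auto
  show "sigma_sets UNIV clopens \<subseteq> sets (borel :: (nat \<Rightarrow> bool) measure)"
    using clopens_subset_borel by (metis sets.sigma_sets_subset space_borel)
qed

lemma sets_borel_bits_pair:
  "sets (borel \<Otimes>\<^sub>M borel :: ((nat \<Rightarrow> bool) \<times> (nat \<Rightarrow> bool)) measure) = sigma_sets UNIV clopens"
proof
  have id: "(\<lambda>x. (fst x, snd x)) \<in> measurable (sigma UNIV (clopens :: ((nat \<Rightarrow> bool) \<times> (nat \<Rightarrow> bool)) set set)) (borel \<Otimes>\<^sub>M borel)"
    by (intro measurable_Pair measurable_clopens_bits continuous_on_fst continuous_on_snd continuous_on_id)
  show "sets (borel \<Otimes>\<^sub>M borel :: ((nat \<Rightarrow> bool) \<times> (nat \<Rightarrow> bool)) measure) \<subseteq> sigma_sets UNIV clopens"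
    using measurable_sets[OF id] by auto
  show "sigma_sets UNIV clopens \<subseteq> sets (borel \<Otimes>\<^sub>M borel :: ((nat \<Rightarrow> bool) \<times> (nat \<Rightarrow> bool)) measure)"
    unfolding borel_prod using clopens_subset_borel by (metis sets.sigma_sets_subset space_borel)
qed

lemma Int_stable_clopens: "Int_stable clopens"
  by (auto simp: Int_stable_def clopens_def)

lemma UNIV_in_clopens: "UNIV \<in> clopens"
  by (simp add: clopens_def)

lemma Int_stable_rect:
  assumes "Int_stable \<E>"
  shows "Int_stable {A \<times> B | A B. A \<in> \<E> \<and> B \<in> \<E>}"
  using assms unfolding Int_stable_def by (auto simp: Times_Int_Times) blast

lemma sets_pair_generator:
  assumes "sets M = sigma_sets (space M) \<E>" "space M \<in> \<E>"
  shows "sets (M \<Otimes>\<^sub>M M) = sigma_sets (space (M \<Otimes>\<^sub>M M)) {A \<times> B | A B. A \<in> \<E> \<and> B \<in> \<E>}"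
proof -
  have sub: "\<E> \<subseteq> Pow (space M)" using assms(1) sets.space_closed by (metis sigma_sets.Basic subset_iff)
  have "sets (M \<Otimes>\<^sub>M M) = sets (sigma (space M) \<E> \<Otimes>\<^sub>M sigma (space M) \<E>)"
    using sub assms(1) by (intro sets_pair_measure_cong) auto
  also have "\<dots> = sets (sigma (space M \<times> space M) {a \<times> b | a b. a \<in> \<E> \<and> b \<in> \<E>})"
    using sub assms(2) by (subst sigma_prod) (auto intro!: exI[of _ "{space M}"])
  also have "\<dots> = sigma_sets (space (M \<Otimes>\<^sub>M M)) {A \<times> B | A B. A \<in> \<E> \<and> B \<in> \<E>}"
    using sub by (subst sets_measure_of) (auto simp: space_pair_measure)
  finally show ?thesis .
qed

lemma has_bochner_integral_step_fun:
  fixes h :: "'b \<Rightarrow> real"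
  assumes "\<And>E. E \<in> snd ` set xs \<Longrightarrow> has_bochner_integral K (\<lambda>z. h z * indicator E (r z)) (J E)"
  shows "has_bochner_integral K (\<lambda>z. h z * step_fun xs (r z)) (\<Sum>(c, E)\<leftarrow>xs. c * J E)"
  using assms
proof (induction xs)
  case (Cons a xs)
  obtain c E where a: "a = (c, E)" by force
  have "has_bochner_integral K (\<lambda>z. h z * step_fun xs (r z)) (\<Sum>(c, E)\<leftarrow>xs. c * J E)"
    by (rule Cons.IH, rule Cons.prems) simp
  moreover have "has_bochner_integral K (\<lambda>z. c * (h z * indicator E (r z))) (c * J E)"
    by (rule has_bochner_integral_mult_right, rule Cons.prems) (simp add: a)
  ultimately have "has_bochner_integral K (\<lambda>z. c * (h z * indicator E (r z)) + h z * step_fun xs (r z)) (c * J E + (\<Sum>(c, E)\<leftarrow>xs. c * J E))"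
    by (intro has_bochner_integral_add)
  then show ?case by (simp add: a algebra_simps)
qed (simp add: has_bochner_integral_zero)

lemma tendsto_sum_list_weighted:
  fixes J :: "'n \<Rightarrow> 'e \<Rightarrow> real"
  assumes "\<And>E. E \<in> snd ` set xs \<Longrightarrow> ((\<lambda>n. J n E) \<longlongrightarrow> J' E) G"
  shows "((\<lambda>n. \<Sum>(c, E)\<leftarrow>xs. c * J n E) \<longlongrightarrow> (\<Sum>(c, E)\<leftarrow>xs. c * J' E)) G"
  using assms
proof (induction xs)
  case (Cons a xs)
  obtain c E where a: "a = (c, E)" by force
  have "((\<lambda>n. \<Sum>(c, E)\<leftarrow>xs. c * J n E) \<longlongrightarrow> (\<Sum>(c, E)\<leftarrow>xs. c * J' E)) G"
    by (rule Cons.IH, rule Cons.prems) simp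
  moreover have "((\<lambda>n. J n E) \<longlongrightarrow> J' E) G"
    by (rule Cons.prems) (simp add: a)
  ultimately show ?case unfolding a by (simp add: tendsto_intros)
qed simp

text \<open>The bound only involves the marginal, so it is uniform in the coupling.\<close>
lemma integral_pullback_close:
  fixes f g :: "'x \<times> 'x \<Rightarrow> real"
  assumes "prob_space K" and q[measurable]: "q \<in> measurable K \<mu>" and d: "distr K \<mu> q = \<mu>"
    and [measurable]: "f \<in> borel_measurable (\<mu> \<Otimes>\<^sub>M \<mu>)" "g \<in> borel_measurable (\<mu> \<Otimes>\<^sub>M \<mu>)"
    and h[measurable]: "h \<in> borel_measurable (K \<Otimes>\<^sub>M K)" and h1: "\<And>z. \<bar>h z\<bar> \<le> (1::real)"
    and close: "(\<integral>\<^sup>+z. ennreal \<bar>f z - g z\<bar> \<partial>(\<mu> \<Otimes>\<^sub>M \<mu>)) < ennreal e"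
    and f: "integrable (K \<Otimes>\<^sub>M K) (\<lambda>z. h z * f (q (fst z), q (snd z)))"
    and g: "integrable (K \<Otimes>\<^sub>M K) (\<lambda>z. h z * g (q (fst z), q (snd z)))"
  shows "\<bar>(\<integral>z. h z * f (q (fst z), q (snd z)) \<partial>(K \<Otimes>\<^sub>M K)) - (\<integral>z. h z * g (q (fst z), q (snd z)) \<partial>(K \<Otimes>\<^sub>M K))\<bar> < e"
proof -
  have e: "e > 0" using close by (metis ennreal_less_zero_iff le_less_trans zero_le)
  have "ennreal (norm (\<integral>z. h z * f (q (fst z), q (snd z)) - h z * g (q (fst z), q (snd z)) \<partial>(K \<Otimes>\<^sub>M K)))
      \<le> (\<integral>\<^sup>+z. ennreal (norm (h z * f (q (fst z), q (snd z)) - h z * g (q (fst z), q (snd z)))) \<partial>(K \<Otimes>\<^sub>M K))"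
    by (intro integral_norm_bound_ennreal Bochner_Integration.integrable_diff f g)
  also have "\<dots> \<le> (\<integral>\<^sup>+z. ennreal \<bar>f (q (fst z), q (snd z)) - g (q (fst z), q (snd z))\<bar> \<partial>(K \<Otimes>\<^sub>M K))"
    using h1 by (intro nn_integral_mono ennreal_leI)
      (simp add: right_diff_distrib[symmetric] abs_mult mult_left_le_one_le)
  also have "\<dots> = (\<integral>\<^sup>+z. ennreal \<bar>f z - g z\<bar> \<partial>(\<mu> \<Otimes>\<^sub>M \<mu>))"
    by (rule nn_integral_pair_square[OF assms(1) q d]) measurable
  finally have "ennreal \<bar>(\<integral>z. h z * f (q (fst z), q (snd z)) \<partial>(K \<Otimes>\<^sub>M K)) - (\<integral>z. h z * g (q (fst z), q (snd z)) \<partial>(K \<Otimes>\<^sub>M K))\<bar>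
      < ennreal e"
    using close f g by (simp add: le_less_trans)
  then show ?thesis using e by (simp add: ennreal_less_iff)
qed

lemma integrable_pair_square:
  fixes f :: "'x \<times> 'x \<Rightarrow> real"
  assumes "prob_space K" and q[measurable]: "q \<in> measurable K \<mu>" and d: "distr K \<mu> q = \<mu>"
    and f: "integrable (\<mu> \<Otimes>\<^sub>M \<mu>) f"
  shows "integrable (K \<Otimes>\<^sub>M K) (\<lambda>z. f (q (fst z), q (snd z)))"
  using integrable_distr[OF measurable_pair_square[OF q], of f] f
  by (simp add: distr_pair_square[OF assms(1-3)])

lemma integrable_mult_bounded:
  fixes f h :: "'x \<Rightarrow> real"
  assumes f: "integrable K f" and [measurable]: "h \<in> borel_measurable K" and "\<And>z. \<bar>h z\<bar> \<le> 1"
  shows "integrable K (\<lambda>z. h z * f z)"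
  using f by (rule Bochner_Integration.integrable_bound)
    (use assms borel_measurable_integrable[OF f] in \<open>auto simp: abs_mult mult_left_le_one_le\<close>)

text \<open>A three-epsilon argument. All the measures have the same image \<open>\<mu>\<close>
  under \<open>q\<close>, so replacing \<open>f\<close> by a step function costs at most
  \<open>e / 3\<close> for each of them, the limit included. For a rectangle
  \<open>A \<times> B\<close> the integral splits into two factors, the measures of
  \<open>S \<inter> q -\<close> A\<open>and\<close>T \<inter> q -\<open>B\<close>, and these
  converge.\<close>

lemma tendsto_integral_pullback:
  fixes f :: "'x \<times> 'x \<Rightarrow> real" and K :: "'n \<Rightarrow> 'k measure"
  assumes K: "\<And>n. prob_space (K n)" "\<And>n. q \<in> measurable (K n) \<mu>" "\<And>n. distr (K n) \<mu> q = \<mu>"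
    and L: "prob_space L" "q \<in> measurable L \<mu>" "distr L \<mu> q = \<mu>"
    and f: "integrable (\<mu> \<Otimes>\<^sub>M \<mu>) f"
    and approx: "Lp_approx 1 (\<mu> \<Otimes>\<^sub>M \<mu>) {A \<times> B | A B. A \<in> \<E> \<and> B \<in> \<E>} f" and \<E>: "\<E> \<subseteq> sets \<mu>"
    and ST: "\<And>n. S \<in> sets (K n)" "\<And>n. T \<in> sets (K n)" "S \<in> sets L" "T \<in> sets L"
    and lim: "\<And>A. A \<in> \<E> \<Longrightarrow> ((\<lambda>n. measure (K n) (S \<inter> q -` A)) \<longlongrightarrow> measure L (S \<inter> q -` A)) G"
      "\<And>A. A \<in> \<E> \<Longrightarrow> ((\<lambda>n. measure (K n) (T \<inter> q -` A)) \<longlongrightarrow> measure L (T \<inter> q -` A)) G"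
  shows "((\<lambda>n. \<integral>z. indicator (S \<times> T) z * f (q (fst z), q (snd z)) \<partial>(K n \<Otimes>\<^sub>M K n))
    \<longlongrightarrow> (\<integral>z. indicator (S \<times> T) z * f (q (fst z), q (snd z)) \<partial>(L \<Otimes>\<^sub>M L))) G"
proof (rule tendstoI)
  fix e :: real assume e: "e > 0"
  then have e3: "e / 3 > 0" by simp
  obtain xs where xs: "snd ` set xs \<subseteq> {A \<times> B | A B. A \<in> \<E> \<and> B \<in> \<E>}"
    and close: "(\<integral>\<^sup>+z. ennreal (\<bar>f z - step_fun xs z\<bar> powr 1) \<partial>(\<mu> \<Otimes>\<^sub>M \<mu>)) < ennreal (e / 3)"
    using approx e3 by (rule Lp_approxD)
  have f_meas[measurable]: "f \<in> borel_measurable (\<mu> \<Otimes>\<^sub>M \<mu>)" using f by simp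
  have step[measurable]: "step_fun xs \<in> borel_measurable (\<mu> \<Otimes>\<^sub>M \<mu>)"
    using xs \<E> by (intro borel_measurable_step_fun) (auto simp: subset_iff)
  define J :: "'k measure \<Rightarrow> ('x \<times> 'x) set \<Rightarrow> real" where "J \<kappa> E = (\<integral>z. indicator (S \<times> T) z * indicator E (q (fst z), q (snd z)) \<partial>(\<kappa> \<Otimes>\<^sub>M \<kappa>))"
    for \<kappa> E
  define I where "I \<kappa> g = (\<integral>z. indicator (S \<times> T) z * g (q (fst z), q (snd z)) \<partial>(\<kappa> \<Otimes>\<^sub>M \<kappa>))"
    for \<kappa> :: "'k measure" and g :: "'x \<times> 'x \<Rightarrow> real"
  \<comment> \<open>Stated for an arbitrary measure with the right image, so that it applies to the
    sequence and to the limit alike.\<close>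
  have main: "\<bar>I \<kappa> f - I \<kappa> (step_fun xs)\<bar> < e / 3 \<and> I \<kappa> (step_fun xs) = (\<Sum>(c, E)\<leftarrow>xs. c * J \<kappa> E)
      \<and> (\<forall>A\<in>\<E>. \<forall>B\<in>\<E>. J \<kappa> (A \<times> B) = measure \<kappa> (S \<inter> q -` A) * measure \<kappa> (T \<inter> q -` B))"
    if \<kappa>: "prob_space \<kappa>" and q[measurable]: "q \<in> measurable \<kappa> \<mu>" and d: "distr \<kappa> \<mu> q = \<mu>"
      and [measurable]: "S \<in> sets \<kappa>" "T \<in> sets \<kappa>" for \<kappa>
  proof -
    interpret \<kappa>: prob_space \<kappa> by fact
    interpret \<kappa>\<kappa>: pair_prob_space \<kappa> \<kappa> ..
    have h: "(indicator (S \<times> T) :: _ \<Rightarrow> real) \<in> borel_measurable (\<kappa> \<Otimes>\<^sub>M \<kappa>)"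
      by measurable
    have h1: "\<bar>indicator (S \<times> T) z :: real\<bar> \<le> 1" for z by (simp add: indicator_def)
    have "has_bochner_integral (\<kappa> \<Otimes>\<^sub>M \<kappa>) (\<lambda>z. indicator (S \<times> T) z * indicator E (q (fst z), q (snd z))) (J \<kappa> E)"
      if "E \<in> snd ` set xs" for E
    proof -
      have E: "E \<in> sets (\<mu> \<Otimes>\<^sub>M \<mu>)" using xs \<E> that by (force simp: subset_iff)
      have "(\<lambda>z. indicator E (q (fst z), q (snd z)) :: real) \<in> borel_measurable (\<kappa> \<Otimes>\<^sub>M \<kappa>)"
        using measurable_compose[OF measurable_pair_square[OF q] borel_measurable_indicator[OF E]] .
      then have "integrable (\<kappa> \<Otimes>\<^sub>M \<kappa>) (\<lambda>z. indicator E (q (fst z), q (snd z)) :: real)"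
        by (rule \<kappa>\<kappa>.P.integrable_const_bound[where B = 1, rotated]) (simp add: indicator_def)
      from integrable_mult_bounded[OF this h h1] show ?thesis
        unfolding J_def by (simp add: has_bochner_integral_iff)
    qed
    from has_bochner_integral_step_fun[OF this]
    have hb: "has_bochner_integral (\<kappa> \<Otimes>\<^sub>M \<kappa>) (\<lambda>z. indicator (S \<times> T) z * step_fun xs (q (fst z), q (snd z)))
        (\<Sum>(c, E)\<leftarrow>xs. c * J \<kappa> E)" .
    have "\<bar>I \<kappa> f - I \<kappa> (step_fun xs)\<bar> < e / 3"
      unfolding I_def
    proof (rule integral_pullback_close[OF \<kappa> q d f_meas step h h1])
      show "(\<integral>\<^sup>+z. ennreal \<bar>f z - step_fun xs z\<bar> \<partial>(\<mu> \<Otimes>\<^sub>M \<mu>)) < ennreal (e / 3)"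
        using close by simp
      show "integrable (\<kappa> \<Otimes>\<^sub>M \<kappa>) (\<lambda>z. indicator (S \<times> T) z * f (q (fst z), q (snd z)))"
        by (rule integrable_mult_bounded[OF integrable_pair_square[OF \<kappa> q d f] h h1])
      show "integrable (\<kappa> \<Otimes>\<^sub>M \<kappa>) (\<lambda>z. indicator (S \<times> T) z * step_fun xs (q (fst z), q (snd z)))"
        using hb by (simp add: has_bochner_integral_iff)
    qed
    moreover have "I \<kappa> (step_fun xs) = (\<Sum>(c, E)\<leftarrow>xs. c * J \<kappa> E)"
      unfolding I_def using hb by (rule has_bochner_integral_integral_eq)
    moreover have "J \<kappa> (A \<times> B) = measure \<kappa> (S \<inter> q -` A) * measure \<kappa> (T \<inter> q -` B)"
      if "A \<in> \<E>" "B \<in> \<E>" for A B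
    proof -
      have *: "S \<inter> q -` A \<in> sets \<kappa>" if "S \<in> sets \<kappa>" "A \<in> \<E>" for S A
      proof -
        have "S \<inter> (q -` A \<inter> space \<kappa>) \<in> sets \<kappa>"
          by (rule sets.Int[OF that(1) measurable_sets[OF q]]) (use that \<E> in blast)
        moreover have "S \<inter> (q -` A \<inter> space \<kappa>) = S \<inter> q -` A"
          using sets.sets_into_space[OF that(1)] by blast
        ultimately show ?thesis by simp
      qed
      have "J \<kappa> (A \<times> B) = (\<integral>z. indicator ((S \<inter> q -` A) \<times> (T \<inter> q -` B)) z \<partial>(\<kappa> \<Otimes>\<^sub>M \<kappa>))"
        unfolding J_def by (intro Bochner_Integration.integral_cong) (auto simp: indicator_def)
      also have "\<dots> = measure (\<kappa> \<Otimes>\<^sub>M \<kappa>) ((S \<inter> q -` A) \<times> (T \<inter> q -` B))"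
        using *[of S A] *[of T B] that by simp
      also have "\<dots> = measure \<kappa> (S \<inter> q -` A) * measure \<kappa> (T \<inter> q -` B)"
        using *[of S A] *[of T B] that
        by (simp add: measure_def \<kappa>.emeasure_pair_measure_Times enn2real_mult)
      finally show ?thesis .
    qed
    ultimately show ?thesis by blast
  qed
  note mainK = main[OF K ST(1,2)] and mainL = main[OF L ST(3,4)]
  have "((\<lambda>n. \<Sum>(c, E)\<leftarrow>xs. c * J (K n) E) \<longlongrightarrow> (\<Sum>(c, E)\<leftarrow>xs. c * J L E)) G"
  proof (rule tendsto_sum_list_weighted)
    fix E assume "E \<in> snd ` set xs"
    then obtain A B where AB: "A \<in> \<E>" "B \<in> \<E>" "E = A \<times> B" using xs by force
    have "((\<lambda>n. measure (K n) (S \<inter> q -` A) * measure (K n) (T \<inter> q -` B))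
        \<longlongrightarrow> measure L (S \<inter> q -` A) * measure L (T \<inter> q -` B)) G"
      using AB by (intro tendsto_mult lim)
    then show "((\<lambda>n. J (K n) E) \<longlongrightarrow> J L E) G"
      using mainK mainL AB by simp
  qed
  then have "((\<lambda>n. I (K n) (step_fun xs)) \<longlongrightarrow> I L (step_fun xs)) G"
    using mainK mainL by simp
  from tendstoD[OF this e3]
  have "eventually (\<lambda>n. dist (I (K n) f) (I L f) < e) G"
  proof eventually_elim
    case (elim n)
    then show ?case
      using mainK[of n] mainL unfolding dist_real_def by linarith
  qed
  then show "eventually (\<lambda>n. dist (\<integral>z. indicator (S \<times> T) z * f (q (fst z), q (snd z)) \<partial>(K n \<Otimes>\<^sub>M K n))
      (\<integral>z. indicator (S \<times> T) z * f (q (fst z), q (snd z)) \<partial>(L \<Otimes>\<^sub>M L)) < e) G"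
    by (simp add: I_def)
qed

section \<open>Limit couplings on the Cantor space\<close>

lemma limit_coupling:
  fixes \<mu> \<mu>' :: "(nat \<Rightarrow> bool) measure" and \<kappa> :: "nat \<Rightarrow> ((nat \<Rightarrow> bool) \<times> (nat \<Rightarrow> bool)) measure"
  assumes \<mu>: "prob_space \<mu>" "sets \<mu> = sets borel" and \<mu>': "prob_space \<mu>'" "sets \<mu>' = sets borel"
    and \<kappa>: "\<And>n. \<kappa> n \<in> couplings \<mu> \<mu>'"
  obtains G \<nu> where "G \<noteq> bot" "G \<le> sequentially" "\<nu> \<in> couplings \<mu> \<mu>'"
    "\<And>C. C \<in> clopens \<Longrightarrow> ((\<lambda>n. measure (\<kappa> n) C) \<longlongrightarrow> measure \<nu> C) G"
proof -
  have sets_pair: "sets (\<mu> \<Otimes>\<^sub>M \<mu>') = sigma_sets UNIV clopens"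
    using sets_pair_measure_cong[OF \<mu>(2) \<mu>'(2)] sets_borel_bits_pair by simp
  have space: "space \<mu> = UNIV" "space \<mu>' = UNIV"
    using sets_eq_imp_space_eq[OF \<mu>(2)] sets_eq_imp_space_eq[OF \<mu>'(2)] by simp_all
  have K: "compact (UNIV :: ((nat \<Rightarrow> bool) \<times> (nat \<Rightarrow> bool)) set)"
    using compact_Times[OF compact_UNIV_bits compact_UNIV_bits] by simp
  have prob: "prob_space (\<kappa> n)" for n by (rule prob_space_coupling[OF \<kappa> \<mu>(1)])
  have sets_\<kappa>: "sets (\<kappa> n) = sigma_sets UNIV clopens" for n
    using couplingsD(1)[OF \<kappa>[of n]] sets_pair by simp
  have sp_\<kappa>: "space (\<kappa> n) = UNIV" for n using couplingsD(6)[OF \<kappa>[of n]] space by simp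
  have clop: "clopens \<subseteq> sets (\<kappa> n)" for n unfolding sets_\<kappa> by auto
  obtain G \<nu> where G: "G \<noteq> bot" "G \<le> sequentially" and \<nu>: "prob_space \<nu>" "space \<nu> = UNIV"
    "sets \<nu> = sigma_sets UNIV clopens"
    and lim: "\<And>C. C \<in> clopens \<Longrightarrow> ((\<lambda>n. measure (\<kappa> n) C) \<longlongrightarrow> measure \<nu> C) G"
    by (rule prob_measures_cluster_clopens[OF K prob sp_\<kappa> clop]) (rule that, assumption+)
  interpret \<nu>: prob_space \<nu> by fact
  \<comment> \<open>Both projections are continuous, so they pull clopen sets back to clopen sets.
    There the measure is constant along the sequence, and clopen sets determine a probability
    measure on the Cantor space.\<close>
  have marginal: "distr \<nu> \<rho> q = \<rho>"
    if \<rho>: "prob_space \<rho>" "sets \<rho> = sets (borel :: (nat \<Rightarrow> bool) measure)"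
      and q[measurable]: "q \<in> measurable \<nu> \<rho>" "\<And>n. q \<in> measurable (\<kappa> n) \<rho>"
      and cont: "continuous_on UNIV q" and d: "\<And>n. distr (\<kappa> n) \<rho> q = \<rho>" for \<rho> q
  proof (rule measure_eqI_generator_eq[OF Int_stable_clopens, where \<Omega> = UNIV and A = "\<lambda>_. UNIV"])
    interpret \<rho>: prob_space \<rho> by fact
    show "sets (distr \<nu> \<rho> q) = sigma_sets UNIV clopens" "sets \<rho> = sigma_sets UNIV clopens"
      using \<rho>(2) sets_borel_bits by simp_all
    fix C :: "(nat \<Rightarrow> bool) set" assume C: "C \<in> clopens"
    have Cs[measurable]: "C \<in> sets \<rho>" using C \<rho>(2) clopens_subset_borel by auto
    have qC: "q -` C \<in> clopens"
      using C cont by (auto simp: clopens_def intro: open_vimage closed_vimage)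
    have "measure (\<kappa> n) (q -` C) = measure \<rho> C" for n
      using measure_distr[OF q(2) Cs, of n] d[of n] by (simp add: sp_\<kappa>)
    then have "measure \<nu> (q -` C) = measure \<rho> C"
      using tendsto_unique[OF G(1) lim[OF qC]] by simp
    then have "measure (distr \<nu> \<rho> q) C = measure \<rho> C"
      using measure_distr[OF q(1) Cs] \<nu>(2) by simp
    then show "emeasure (distr \<nu> \<rho> q) C = emeasure \<rho> C"
      using prob_space.prob_space_distr[OF \<nu>(1) q(1)]
      by (simp add: \<rho>.emeasure_eq_measure finite_measure.emeasure_eq_measure prob_space_def)
  next
    interpret \<rho>': prob_space "distr \<nu> \<rho> q" by (rule \<nu>.prob_space_distr) fact
    show "emeasure (distr \<nu> \<rho> q) UNIV \<noteq> \<infinity>" by simp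
  qed (auto simp: UNIV_in_clopens)
  have sets_\<nu>: "sets \<nu> = sets (\<mu> \<Otimes>\<^sub>M \<mu>')" using \<nu>(3) sets_pair by simp
  have "\<nu> \<in> couplings \<mu> \<mu>'"
    unfolding couplings_def
  proof (intro CollectI conjI)
    show "distr \<nu> \<mu> fst = \<mu>"
      by (rule marginal[OF \<mu> _ couplingsD(4)[OF \<kappa>] _ couplingsD(2)[OF \<kappa>]])
        (auto cong: measurable_cong_sets simp: sets_\<nu> intro: continuous_on_fst continuous_on_id)
    show "distr \<nu> \<mu>' snd = \<mu>'"
      by (rule marginal[OF \<mu>' _ couplingsD(5)[OF \<kappa>] _ couplingsD(3)[OF \<kappa>]])
        (auto cong: measurable_cong_sets simp: sets_\<nu> intro: continuous_on_snd continuous_on_id)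
  qed fact
  then show ?thesis using lim by (rule that[OF G])
qed

text \<open>For each clopen rectangle the integral of the difference converges to its value under
  the limit coupling, while the cut condition sends it to 0. Clopen rectangles generate the square
  of the product space, so the difference vanishes almost everywhere. Convergence for each fixed
  rectangle is enough.\<close>

lemma limit_coupling_AE_eq:
  fixes \<mu> \<mu>' :: "(nat \<Rightarrow> bool) measure" and \<kappa> :: "nat \<Rightarrow> ((nat \<Rightarrow> bool) \<times> (nat \<Rightarrow> bool)) measure"
    and f f' :: "(nat \<Rightarrow> bool) \<times> (nat \<Rightarrow> bool) \<Rightarrow> real"
  assumes \<mu>: "prob_space \<mu>" "sets \<mu> = sets borel" and \<mu>': "prob_space \<mu>'" "sets \<mu>' = sets borel"
    and f: "integrable (\<mu> \<Otimes>\<^sub>M \<mu>) f" "\<And>z. f z \<ge> 0" and f': "integrable (\<mu>' \<Otimes>\<^sub>M \<mu>') f'" "\<And>z. f' z \<ge> 0"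
    and \<kappa>: "\<And>n. \<kappa> n \<in> couplings \<mu> \<mu>'"
    and cut: "\<And>S T. S \<in> sets (\<mu> \<Otimes>\<^sub>M \<mu>') \<Longrightarrow> T \<in> sets (\<mu> \<Otimes>\<^sub>M \<mu>') \<Longrightarrow>
      (\<lambda>n. \<integral>z. indicator (S \<times> T) z * (f (fst (fst z), fst (snd z)) - f' (snd (fst z), snd (snd z))) \<partial>(\<kappa> n \<Otimes>\<^sub>M \<kappa> n)) \<longlonglongrightarrow> 0"
  obtains \<nu> where "\<nu> \<in> couplings \<mu> \<mu>'"
    "AE z in \<nu> \<Otimes>\<^sub>M \<nu>. f (fst (fst z), fst (snd z)) = f' (snd (fst z), snd (snd z))"
proof -
  obtain G \<nu> where G: "G \<noteq> bot" "G \<le> sequentially" and \<nu>: "\<nu> \<in> couplings \<mu> \<mu>'"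
    and lim: "\<And>C. C \<in> clopens \<Longrightarrow> ((\<lambda>n. measure (\<kappa> n) C) \<longlongrightarrow> measure \<nu> C) G"
    by (rule limit_coupling[OF \<mu> \<mu>' \<kappa>]) (rule that, assumption+)
  have sets_pair: "sets (\<mu> \<Otimes>\<^sub>M \<mu>') = sigma_sets UNIV clopens"
    using sets_pair_measure_cong[OF \<mu>(2) \<mu>'(2)] sets_borel_bits_pair by simp
  have clop: "C \<in> sets (\<mu> \<Otimes>\<^sub>M \<mu>')" if "C \<in> clopens" for C
    unfolding sets_pair using that by auto
  have sets_\<nu>: "sets \<nu> = sigma_sets UNIV clopens" "space \<nu> = UNIV"
    using couplingsD(1,6)[OF \<nu>] sets_pair sets_eq_imp_space_eq[OF \<mu>(2)] sets_eq_imp_space_eq[OF \<mu>'(2)]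
    by simp_all
  have prob: "prob_space (\<kappa> n)" for n by (rule prob_space_coupling[OF \<kappa> \<mu>(1)])
  have prob\<nu>: "prob_space \<nu>" by (rule prob_space_coupling[OF \<nu> \<mu>(1)])
  have approx: "Lp_approx 1 (\<rho> \<Otimes>\<^sub>M \<rho>) {A \<times> B | A B. A \<in> clopens \<and> B \<in> clopens} g"
    if \<rho>: "prob_space \<rho>" "sets \<rho> = sets (borel :: (nat \<Rightarrow> bool) measure)"
      and g: "integrable (\<rho> \<Otimes>\<^sub>M \<rho>) g" "\<And>z. g z \<ge> 0" for \<rho> g
  proof -
    interpret \<rho>: prob_space \<rho> by fact
    interpret \<rho>\<rho>: pair_prob_space \<rho> \<rho> ..
    have space: "space \<rho> = UNIV" using sets_eq_imp_space_eq[OF \<rho>(2)] by simp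
    show ?thesis
    proof (rule Lp_approx_nonneg[OF \<rho>\<rho>.P.finite_measure_axioms _ Int_stable_rect[OF Int_stable_clopens]])
      show "sets (\<rho> \<Otimes>\<^sub>M \<rho>) = sigma_sets (space (\<rho> \<Otimes>\<^sub>M \<rho>)) {A \<times> B | A B. A \<in> clopens \<and> B \<in> clopens}"
        by (rule sets_pair_generator) (simp_all add: space \<rho>(2) sets_borel_bits UNIV_in_clopens)
      show "space (\<rho> \<Otimes>\<^sub>M \<rho>) \<in> {A \<times> B | A B. A \<in> clopens \<and> B \<in> clopens}"
        using UNIV_in_clopens by (intro CollectI exI[of _ UNIV]) (simp add: space_pair_measure space)
      show "(\<integral>\<^sup>+z. ennreal (\<bar>g z\<bar> powr 1) \<partial>(\<rho> \<Otimes>\<^sub>M \<rho>)) < \<infinity>"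
        using g by (simp add: integrable_iff_bounded)
    qed (use g in simp_all)
  qed
  have conv: "((\<lambda>n. \<integral>z. indicator (S \<times> T) z * g (q (fst z), q (snd z)) \<partial>(\<kappa> n \<Otimes>\<^sub>M \<kappa> n))
      \<longlongrightarrow> (\<integral>z. indicator (S \<times> T) z * g (q (fst z), q (snd z)) \<partial>(\<nu> \<Otimes>\<^sub>M \<nu>))) G"
    if ST: "S \<in> clopens" "T \<in> clopens" and \<rho>: "prob_space \<rho>" "sets \<rho> = sets (borel :: (nat \<Rightarrow> bool) measure)"
      and g: "integrable (\<rho> \<Otimes>\<^sub>M \<rho>) g" "\<And>z. g z \<ge> 0"
      and q: "\<And>n. q \<in> measurable (\<kappa> n) \<rho>" "\<And>n. distr (\<kappa> n) \<rho> q = \<rho>"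
        "q \<in> measurable \<nu> \<rho>" "distr \<nu> \<rho> q = \<rho>" and cont: "continuous_on UNIV q"
    for S T \<rho> q and g :: "(nat \<Rightarrow> bool) \<times> (nat \<Rightarrow> bool) \<Rightarrow> real"
  proof (rule tendsto_integral_pullback[where \<mu> = \<rho> and \<E> = clopens])
    show "prob_space (\<kappa> n)" "q \<in> measurable (\<kappa> n) \<rho>" "distr (\<kappa> n) \<rho> q = \<rho>" for n
      by (rule prob q)+
    show "prob_space \<nu>" "q \<in> measurable \<nu> \<rho>" "distr \<nu> \<rho> q = \<rho>" "integrable (\<rho> \<Otimes>\<^sub>M \<rho>) g"
      by (rule prob\<nu> q g)+
    show "Lp_approx 1 (\<rho> \<Otimes>\<^sub>M \<rho>) {A \<times> B | A B. A \<in> clopens \<and> B \<in> clopens} g"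
      by (rule approx) fact+
    show "clopens \<subseteq> sets \<rho>" using \<rho>(2) clopens_subset_borel by auto
    show "S \<in> sets (\<kappa> n)" "T \<in> sets (\<kappa> n)" "S \<in> sets \<nu>" "T \<in> sets \<nu>" for n
      using clop ST couplingsD(1)[OF \<kappa>] couplingsD(1)[OF \<nu>] by simp_all
    \<comment> \<open>Convergence on clopen sets reaches the sets that the factorized integrals
      require, since \<open>q\<close> is continuous.\<close>
    have clop': "S \<inter> q -` A \<in> clopens" if "S \<in> clopens" "A \<in> clopens" for S A
      using that cont by (auto simp: clopens_def intro: open_vimage closed_vimage)
    show "((\<lambda>n. measure (\<kappa> n) (S \<inter> q -` A)) \<longlongrightarrow> measure \<nu> (S \<inter> q -` A)) G"
      "((\<lambda>n. measure (\<kappa> n) (T \<inter> q -` A)) \<longlongrightarrow> measure \<nu> (T \<inter> q -` A)) G" if "A \<in> clopens" for A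
      by (rule lim[OF clop'[OF ST(1) that]] lim[OF clop'[OF ST(2) that]])+
  qed
  have ind: "(indicator (S \<times> T) :: _ \<Rightarrow> real) \<in> borel_measurable (\<rho> \<Otimes>\<^sub>M \<rho>)"
    if "\<rho> \<in> couplings \<mu> \<mu>'" "S \<in> clopens" "T \<in> clopens" for \<rho> S T
    using clop that(2,3) couplingsD(1)[OF that(1)] by (intro borel_measurable_indicator pair_measureI) simp_all
  have int: "integrable (\<rho> \<Otimes>\<^sub>M \<rho>) (\<lambda>z. f (fst (fst z), fst (snd z)))"
    "integrable (\<rho> \<Otimes>\<^sub>M \<rho>) (\<lambda>z. f' (snd (fst z), snd (snd z)))" if "\<rho> \<in> couplings \<mu> \<mu>'" for \<rho>
    by (rule integrable_pair_square[OF prob_space_coupling[OF that \<mu>(1)] couplingsD(4,2)[OF that] f(1)]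
        integrable_pair_square[OF prob_space_coupling[OF that \<mu>(1)] couplingsD(5,3)[OF that] f'(1)])+
  have h1: "\<bar>indicator A z :: real\<bar> \<le> 1" for A :: "'z set" and z by (simp add: indicator_def)
  define D where "D z = f (fst (fst z), fst (snd z)) - f' (snd (fst z), snd (snd z))" for z
  \<comment> \<open>The difference is not a function of one marginal, but each of its two terms is;
    the convergence result is applied to them separately.\<close>
  have split: "(\<integral>z. indicator (S \<times> T) z * D z \<partial>(\<rho> \<Otimes>\<^sub>M \<rho>))
      = (\<integral>z. indicator (S \<times> T) z * f (fst (fst z), fst (snd z)) \<partial>(\<rho> \<Otimes>\<^sub>M \<rho>))
      - (\<integral>z. indicator (S \<times> T) z * f' (snd (fst z), snd (snd z)) \<partial>(\<rho> \<Otimes>\<^sub>M \<rho>))"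
    if "\<rho> \<in> couplings \<mu> \<mu>'" "S \<in> clopens" "T \<in> clopens" for \<rho> S T
    unfolding D_def right_diff_distrib
    by (intro Bochner_Integration.integral_diff integrable_mult_bounded int that ind h1)
  have zero: "set_lebesgue_integral (\<nu> \<Otimes>\<^sub>M \<nu>) (S \<times> T) D = 0"
    if ST: "S \<in> clopens" "T \<in> clopens" for S T
  proof -
    have 1: "((\<lambda>n. \<integral>z. indicator (S \<times> T) z * f (fst (fst z), fst (snd z)) \<partial>(\<kappa> n \<Otimes>\<^sub>M \<kappa> n))
      \<longlongrightarrow> (\<integral>z. indicator (S \<times> T) z * f (fst (fst z), fst (snd z)) \<partial>(\<nu> \<Otimes>\<^sub>M \<nu>))) G"
      by (rule conv[OF ST \<mu> f couplingsD(4)[OF \<kappa>] couplingsD(2)[OF \<kappa>] couplingsD(4)[OF \<nu>] couplingsD(2)[OF \<nu>]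
            continuous_on_fst[OF continuous_on_id]])
    have 2: "((\<lambda>n. \<integral>z. indicator (S \<times> T) z * f' (snd (fst z), snd (snd z)) \<partial>(\<kappa> n \<Otimes>\<^sub>M \<kappa> n))
      \<longlongrightarrow> (\<integral>z. indicator (S \<times> T) z * f' (snd (fst z), snd (snd z)) \<partial>(\<nu> \<Otimes>\<^sub>M \<nu>))) G"
      by (rule conv[OF ST \<mu>' f' couplingsD(5)[OF \<kappa>] couplingsD(3)[OF \<kappa>] couplingsD(5)[OF \<nu>] couplingsD(3)[OF \<nu>]
            continuous_on_snd[OF continuous_on_id]])
    have "((\<lambda>n. \<integral>z. indicator (S \<times> T) z * D z \<partial>(\<kappa> n \<Otimes>\<^sub>M \<kappa> n))
        \<longlongrightarrow> (\<integral>z. indicator (S \<times> T) z * D z \<partial>(\<nu> \<Otimes>\<^sub>M \<nu>))) G"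
      using tendsto_diff[OF 1 2] split[OF \<kappa> ST] split[OF \<nu> ST] by simp
    moreover have "((\<lambda>n. \<integral>z. indicator (S \<times> T) z * D z \<partial>(\<kappa> n \<Otimes>\<^sub>M \<kappa> n)) \<longlongrightarrow> 0) G"
      using tendsto_mono[OF G(2) cut[OF clop[OF ST(1)] clop[OF ST(2)]]] by (simp add: D_def)
    ultimately show ?thesis
      using tendsto_unique[OF G(1)] by (auto simp: set_lebesgue_integral_def)
  qed
  interpret \<nu>: prob_space \<nu> by (rule prob\<nu>)
  interpret \<nu>\<nu>: pair_prob_space \<nu> \<nu> ..
  have "AE z in \<nu> \<Otimes>\<^sub>M \<nu>. D z = 0"
  proof (rule AE_zero_generator[OF \<nu>\<nu>.P.finite_measure_axioms _ Int_stable_rect[OF Int_stable_clopens]])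
    show "integrable (\<nu> \<Otimes>\<^sub>M \<nu>) D"
      unfolding D_def by (intro Bochner_Integration.integrable_diff int \<nu>)
    show "sets (\<nu> \<Otimes>\<^sub>M \<nu>) = sigma_sets (space (\<nu> \<Otimes>\<^sub>M \<nu>)) {A \<times> B | A B. A \<in> clopens \<and> B \<in> clopens}"
      by (rule sets_pair_generator) (simp_all add: sets_\<nu> UNIV_in_clopens)
    show "space (\<nu> \<Otimes>\<^sub>M \<nu>) \<in> {A \<times> B | A B. A \<in> clopens \<and> B \<in> clopens}"
      using UNIV_in_clopens by (intro CollectI exI[of _ UNIV]) (simp add: space_pair_measure sets_\<nu>)
  qed (use zero in auto)
  then show ?thesis
    by (intro that[OF \<nu>]) (simp add: D_def)
qed

subsection \<open>The common factor of a coupling\<close>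

text \<open>The conditional probability of \<open>A\<close>, clipped to the unit interval. A version
  of it obeys these bounds only almost everywhere, whereas the weights used below must obey them at
  every point.\<close>

lemma cond_indicator:
  assumes "prob_space M" and C: "subalgebra M C" and A[measurable]: "A \<in> sets M"
  obtains a :: "'a \<Rightarrow> real" where "a \<in> borel_measurable C" "\<And>x. 0 \<le> a x" "\<And>x. a x \<le> 1"
    "\<And>h. h \<in> borel_measurable C \<Longrightarrow> integrable M h \<Longrightarrow> (\<integral>x. indicator A x * h x \<partial>M) = (\<integral>x. a x * h x \<partial>M)"
proof -
  interpret prob_space M by fact
  interpret finite_measure_subalgebra M C by unfold_locales (rule C)
  let ?e = "real_cond_exp M C (indicator A)"
  have int: "integrable M (indicator A :: 'a \<Rightarrow> real)"
    by (rule integrable_real_indicator) (simp_all add: emeasure_eq_measure)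
  have AE: "AE x in M. max 0 (min 1 (?e x)) = ?e x"
    using real_cond_exp_ge_c[OF int, of 0] real_cond_exp_le_c[OF int, of 1] by (auto simp: indicator_def)
  show ?thesis
  proof (rule that[of "\<lambda>x. max 0 (min 1 (?e x))"])
    show "(\<lambda>x. max 0 (min 1 (?e x))) \<in> borel_measurable C" by measurable
    fix h :: "'a \<Rightarrow> real" assume h: "h \<in> borel_measurable C" "integrable M h"
    have hM: "h \<in> borel_measurable M" using h(2) by simp
    have "integrable M (\<lambda>x. indicator A x * h x)"
      using integrable_mult_indicator[OF A h(2)] by simp
    then have "integrable M (\<lambda>x. h x * indicator A x)" by (simp add: mult.commute)
    from real_cond_exp_intg(2)[OF this h(1)]
    have "(\<integral>x. indicator A x * h x \<partial>M) = (\<integral>x. ?e x * h x \<partial>M)"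
      by (simp add: mult.commute)
    also have "\<dots> = (\<integral>x. max 0 (min 1 (?e x)) * h x \<partial>M)"
      by (rule integral_cong_AE) (use hM AE in \<open>auto intro: borel_measurable_times\<close>)
    finally show "(\<integral>x. indicator A x * h x \<partial>M) = (\<integral>x. max 0 (min 1 (?e x)) * h x \<partial>M)" .
  qed simp_all
qed

text \<open>Weights with values in the unit interval cover indicators and conditional probabilities,
  and a product with them remains integrable. Both variables are listed because \<open>k\<close>
  need not be symmetric.\<close>

definition sections_measurable :: "'a measure \<Rightarrow> 'a measure \<Rightarrow> ('a \<times> 'a \<Rightarrow> real) \<Rightarrow> bool" where
  "sections_measurable M C k \<longleftrightarrow> (\<forall>b\<in>borel_measurable M. (\<forall>y. 0 \<le> b y \<and> b y \<le> 1) \<longrightarrow>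
     (\<lambda>x. \<integral>y. b y * k (x, y) \<partial>M) \<in> borel_measurable C \<and> (\<lambda>y. \<integral>x. b x * k (x, y) \<partial>M) \<in> borel_measurable C)"

lemma integrable_mult_unit:
  fixes k :: "'a \<Rightarrow> real"
  assumes "integrable M k" "a \<in> borel_measurable M" "\<And>x. 0 \<le> a x" "\<And>x. a x \<le> 1"
  shows "integrable M (\<lambda>x. a x * k x)"
  by (rule integrable_mult_bounded) (use assms in simp_all)

text \<open>Since the sections are \<open>C\<close>-measurable, \<open>A\<close> and then \<open>B\<close> may be replaced by their conditional
  probabilities, one variable at a time.\<close>
lemma integral_rect_conditioned:
  assumes "prob_space M" and C: "subalgebra M C" and k: "integrable (M \<Otimes>\<^sub>M M) k"
    and sec: "sections_measurable M C k"
    and A: "A \<in> sets M" and B: "B \<in> sets M"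
    and a: "a \<in> borel_measurable C" "\<And>x. 0 \<le> a x" "\<And>x. a x \<le> 1"
    and a_eq: "\<And>h. h \<in> borel_measurable C \<Longrightarrow> integrable M h \<Longrightarrow> (\<integral>x. indicator A x * h x \<partial>M) = (\<integral>x. a x * h x \<partial>M)"
    and b: "b \<in> borel_measurable C" "\<And>x. 0 \<le> b x" "\<And>x. b x \<le> (1::real)"
    and b_eq: "\<And>h. h \<in> borel_measurable C \<Longrightarrow> integrable M h \<Longrightarrow> (\<integral>x. indicator B x * h x \<partial>M) = (\<integral>x. b x * h x \<partial>M)"
  shows "(\<integral>z. indicator A (fst z) * indicator B (snd z) * k z \<partial>(M \<Otimes>\<^sub>M M))
    = (\<integral>z. a (fst z) * b (snd z) * k z \<partial>(M \<Otimes>\<^sub>M M))"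
proof -
  interpret M: prob_space M by fact
  interpret MM: pair_prob_space M M ..
  have aM: "a \<in> borel_measurable M" and bM: "b \<in> borel_measurable M"
    using a(1) b(1) measurable_from_subalg[OF C] by auto
  have iA: "(indicator A :: 'a \<Rightarrow> real) \<in> borel_measurable M" "(indicator B :: 'a \<Rightarrow> real) \<in> borel_measurable M"
    using A B by auto
  have int: "integrable (M \<Otimes>\<^sub>M M) (\<lambda>z. u (fst z) * v (snd z) * k z)"
    if [measurable]: "u \<in> borel_measurable M" "v \<in> borel_measurable M"
      and uv: "\<And>x. 0 \<le> u x" "\<And>x. u x \<le> 1" "\<And>x. 0 \<le> v x" "\<And>x. v x \<le> 1" for u v :: "'a \<Rightarrow> real"
    by (rule integrable_mult_unit[OF k]) (use uv in \<open>simp_all add: mult_le_one\<close>)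
  have fst: "(\<integral>z. u (fst z) * v (snd z) * k z \<partial>(M \<Otimes>\<^sub>M M)) = (\<integral>x. u x * (\<integral>y. v y * k (x, y) \<partial>M) \<partial>M)"
    and intf: "integrable M (\<lambda>x. u x * (\<integral>y. v y * k (x, y) \<partial>M))"
    and snd: "(\<integral>z. u (fst z) * v (snd z) * k z \<partial>(M \<Otimes>\<^sub>M M)) = (\<integral>y. v y * (\<integral>x. u x * k (x, y) \<partial>M) \<partial>M)"
    and ints: "integrable M (\<lambda>y. v y * (\<integral>x. u x * k (x, y) \<partial>M))"
    if uv: "u \<in> borel_measurable M" "v \<in> borel_measurable M"
       "\<And>x. 0 \<le> u x" "\<And>x. u x \<le> 1" "\<And>x. 0 \<le> v x" "\<And>x. v x \<le> 1" for u v :: "'a \<Rightarrow> real"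
  proof -
    note i = int[OF uv]
    have i': "integrable (M \<Otimes>\<^sub>M M) (\<lambda>(x, y). u x * v y * k (x, y))"
      using i by (simp add: case_prod_unfold)
    have sw: "v y * (\<integral>x. u x * k (x, y) \<partial>M) = (\<integral>x. u x * v y * k (x, y) \<partial>M)" for y
      by (simp add: ac_simps flip: integral_mult_right_zero)
    have sw': "u x * (\<integral>y. v y * k (x, y) \<partial>M) = (\<integral>y. u x * v y * k (x, y) \<partial>M)" for x
      by (simp add: ac_simps flip: integral_mult_right_zero)
    show "(\<integral>z. u (fst z) * v (snd z) * k z \<partial>(M \<Otimes>\<^sub>M M)) = (\<integral>x. u x * (\<integral>y. v y * k (x, y) \<partial>M) \<partial>M)"
      using MM.integral_fst'[OF i] by (simp add: sw')
    show "integrable M (\<lambda>x. u x * (\<integral>y. v y * k (x, y) \<partial>M))"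
      using MM.integrable_fst'[OF i] by (simp add: sw')
    show "(\<integral>z. u (fst z) * v (snd z) * k z \<partial>(M \<Otimes>\<^sub>M M)) = (\<integral>y. v y * (\<integral>x. u x * k (x, y) \<partial>M) \<partial>M)"
      using MM.integral_snd[OF i'] by (simp add: sw case_prod_unfold)
    show "integrable M (\<lambda>y. v y * (\<integral>x. u x * k (x, y) \<partial>M))"
      using MM.integrable_snd[OF i'] by (simp add: sw)
  qed
  have i1: "0 \<le> (indicator D x :: real)" "(indicator D x :: real) \<le> 1" for D and x :: 'a
    by (auto simp: indicator_def)
  \<comment> \<open>With this constant weight, \<open>intf\<close> and \<open>ints\<close> yield
    integrability of the sections themselves, which \<open>a_eq\<close> and \<open>b_eq\<close>
    require.\<close>
  have one: "(\<lambda>_. 1 :: real) \<in> borel_measurable M" by simp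
  have secf: "(\<lambda>x. \<integral>y. indicator B y * k (x, y) \<partial>M) \<in> borel_measurable C"
    using sec iA i1 unfolding sections_measurable_def by blast
  have secs: "(\<lambda>y. \<integral>x. a x * k (x, y) \<partial>M) \<in> borel_measurable C"
    using sec aM a unfolding sections_measurable_def by blast
  have "(\<integral>z. indicator A (fst z) * indicator B (snd z) * k z \<partial>(M \<Otimes>\<^sub>M M))
      = (\<integral>x. indicator A x * (\<integral>y. indicator B y * k (x, y) \<partial>M) \<partial>M)"
    by (rule fst[OF iA i1 i1])
  also have "\<dots> = (\<integral>x. a x * (\<integral>y. indicator B y * k (x, y) \<partial>M) \<partial>M)"
    using intf[OF one iA(2) _ _ i1] by (intro a_eq secf) simp
  also have "\<dots> = (\<integral>z. a (fst z) * indicator B (snd z) * k z \<partial>(M \<Otimes>\<^sub>M M))"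
    by (rule fst[OF aM iA(2) a(2,3) i1, symmetric])
  also have "\<dots> = (\<integral>y. indicator B y * (\<integral>x. a x * k (x, y) \<partial>M) \<partial>M)"
    by (rule snd[OF aM iA(2) a(2,3) i1])
  also have "\<dots> = (\<integral>y. b y * (\<integral>x. a x * k (x, y) \<partial>M) \<partial>M)"
    using ints[OF aM one a(2,3)] by (intro b_eq secs) simp
  also have "\<dots> = (\<integral>z. a (fst z) * b (snd z) * k z \<partial>(M \<Otimes>\<^sub>M M))"
    by (rule snd[OF aM bM a(2,3) b(2,3), symmetric])
  finally show ?thesis .
qed

lemma measurable_pair_subalg:
  assumes "subalgebra M C" "h \<in> borel_measurable (C \<Otimes>\<^sub>M C)"
  shows "h \<in> borel_measurable (C \<Otimes>\<^sub>M M)" "h \<in> borel_measurable (M \<Otimes>\<^sub>M C)" "h \<in> borel_measurable (M \<Otimes>\<^sub>M M)"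
proof -
  have id: "(\<lambda>x. x) \<in> measurable M C"
    using assms(1) by (auto simp: measurable_def subalgebra_def)
  have f: "fst \<in> measurable (M \<Otimes>\<^sub>M K) C" for K :: "'d measure"
    using measurable_compose[OF measurable_fst id] .
  have s: "snd \<in> measurable (K \<Otimes>\<^sub>M M) C" for K :: "'d measure"
    using measurable_compose[OF measurable_snd id] .
  have "(\<lambda>z. (fst z, snd z)) \<in> measurable (C \<Otimes>\<^sub>M M) (C \<Otimes>\<^sub>M C)"
    "(\<lambda>z. (fst z, snd z)) \<in> measurable (M \<Otimes>\<^sub>M C) (C \<Otimes>\<^sub>M C)"
    "(\<lambda>z. (fst z, snd z)) \<in> measurable (M \<Otimes>\<^sub>M M) (C \<Otimes>\<^sub>M C)"
    by (rule measurable_Pair f s measurable_fst measurable_snd)+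
  from this[THEN measurable_compose, OF assms(2)]
  show "h \<in> borel_measurable (C \<Otimes>\<^sub>M M)" "h \<in> borel_measurable (M \<Otimes>\<^sub>M C)" "h \<in> borel_measurable (M \<Otimes>\<^sub>M M)"
    by simp_all
qed

text \<open>Lets the replacement of indicators by conditional probabilities run for the conditional
  expectation exactly as for the original function.\<close>

lemma sections_measurable_product:
  assumes "prob_space M" and C: "subalgebra M C" and h: "h \<in> borel_measurable (C \<Otimes>\<^sub>M C)"
  shows "sections_measurable M C h"
  unfolding sections_measurable_def
proof (intro ballI impI conjI)
  interpret prob_space M by fact
  note hm = measurable_pair_subalg[OF C h]
  fix b :: "'a \<Rightarrow> real" assume b[measurable]: "b \<in> borel_measurable M"
  have "(\<lambda>(x, y). b y * h (x, y)) \<in> borel_measurable (C \<Otimes>\<^sub>M M)"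
    using hm(1) by measurable
  then show "(\<lambda>x. \<integral>y. b y * h (x, y) \<partial>M) \<in> borel_measurable C"
    by (rule borel_measurable_lebesgue_integral)
  have "(\<lambda>z. h (snd z, fst z)) \<in> borel_measurable (C \<Otimes>\<^sub>M M)"
    by (rule measurable_compose[OF _ hm(2), of "\<lambda>z. (snd z, fst z)"]) measurable
  then have "(\<lambda>(y, x). b x * h (x, y)) \<in> borel_measurable (C \<Otimes>\<^sub>M M)"
    unfolding case_prod_unfold by measurable
  then show "(\<lambda>y. \<integral>x. b x * h (x, y) \<partial>M) \<in> borel_measurable C"
    by (rule borel_measurable_lebesgue_integral)
qed

text \<open>The candidate \<open>g\<close> is the conditional expectation of \<open>f\<close> given
  \<open>C \<otimes> C\<close>. Over \<open>A \<times> B\<close> the integral of \<open>f\<close>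
  equals that of \<open>a(x) b(y) f(x,y)\<close>, where \<open>a\<close> and \<open>b\<close> are
  the conditional probabilities of \<open>A\<close> and \<open>B\<close>. In this form
  \<open>f\<close> may be exchanged for \<open>g\<close>, and the replacement is then undone.
  Rectangles determine \<open>f - g\<close>.\<close>

lemma sections_measurable_imp_product_measurable:
  assumes "prob_space M" and C: "subalgebra M C" and f: "integrable (M \<Otimes>\<^sub>M M) f"
    and sec: "sections_measurable M C f"
  obtains g where "g \<in> borel_measurable (C \<Otimes>\<^sub>M C)" "AE z in M \<Otimes>\<^sub>M M. f z = g z"
proof -
  interpret M: prob_space M by fact
  interpret MM: pair_prob_space M M ..
  have sub: "subalgebra (M \<Otimes>\<^sub>M M) (C \<Otimes>\<^sub>M C)"
    unfolding subalgebra_def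
  proof (intro conjI)
    show "space (C \<Otimes>\<^sub>M C) = space (M \<Otimes>\<^sub>M M)"
      using C by (simp add: subalgebra_def space_pair_measure)
    show "sets (C \<Otimes>\<^sub>M C) \<subseteq> sets (M \<Otimes>\<^sub>M M)"
      using C by (intro sets_pair_in_sets) (auto simp: subalgebra_def)
  qed
  interpret E: finite_measure_subalgebra "M \<Otimes>\<^sub>M M" "C \<Otimes>\<^sub>M C"
    by unfold_locales (rule sub)
  define g where "g = real_cond_exp (M \<Otimes>\<^sub>M M) (C \<Otimes>\<^sub>M C) f"
  have g: "g \<in> borel_measurable (C \<Otimes>\<^sub>M C)" unfolding g_def by simp
  have gi: "integrable (M \<Otimes>\<^sub>M M) g" unfolding g_def using f by (rule E.real_cond_exp_int)
  have secg: "sections_measurable M C g" by (rule sections_measurable_product[OF assms(1) C g])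
  have idC: "(\<lambda>x. x) \<in> measurable M C"
    using C by (auto simp: measurable_def subalgebra_def)
  have eq: "(\<integral>z. indicator A (fst z) * indicator B (snd z) * f z \<partial>(M \<Otimes>\<^sub>M M))
      = (\<integral>z. indicator A (fst z) * indicator B (snd z) * g z \<partial>(M \<Otimes>\<^sub>M M))"
    if A: "A \<in> sets M" and B: "B \<in> sets M" for A B
  proof -
    obtain a :: "'a \<Rightarrow> real" where a: "a \<in> borel_measurable C" "\<And>x. 0 \<le> a x" "\<And>x. a x \<le> 1"
      and a_eq: "\<And>h. h \<in> borel_measurable C \<Longrightarrow> integrable M h \<Longrightarrow> (\<integral>x. indicator A x * h x \<partial>M) = (\<integral>x. a x * h x \<partial>M)"
      by (rule cond_indicator[OF assms(1) C A]) (rule that, assumption+)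
    obtain b :: "'a \<Rightarrow> real" where b: "b \<in> borel_measurable C" "\<And>x. 0 \<le> b x" "\<And>x. b x \<le> 1"
      and b_eq: "\<And>h. h \<in> borel_measurable C \<Longrightarrow> integrable M h \<Longrightarrow> (\<integral>x. indicator B x * h x \<partial>M) = (\<integral>x. b x * h x \<partial>M)"
      by (rule cond_indicator[OF assms(1) C B]) (rule that, assumption+)
    have ab: "(\<lambda>z. a (fst z) * b (snd z)) \<in> borel_measurable (C \<Otimes>\<^sub>M C)"
      using a(1) b(1) by measurable
    have "integrable (M \<Otimes>\<^sub>M M) (\<lambda>z. a (fst z) * b (snd z) * f z)"
      by (rule integrable_mult_unit[OF f measurable_pair_subalg(3)[OF C ab]])
        (use a b in \<open>simp_all add: mult_le_one\<close>)
    \<comment> \<open>The defining property of the conditional expectation, available because the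
      weight is measurable for the product of the small \<sigma>-algebras.\<close>
    then have ab_eq: "(\<integral>z. a (fst z) * b (snd z) * g z \<partial>(M \<Otimes>\<^sub>M M)) = (\<integral>z. a (fst z) * b (snd z) * f z \<partial>(M \<Otimes>\<^sub>M M))"
      unfolding g_def using borel_measurable_integrable[OF f] by (intro E.real_cond_exp_intg(2) ab)
    show ?thesis
    proof (rule trans[OF _ trans[OF ab_eq[symmetric]]])
      show "(\<integral>z. indicator A (fst z) * indicator B (snd z) * f z \<partial>(M \<Otimes>\<^sub>M M))
          = (\<integral>z. a (fst z) * b (snd z) * f z \<partial>(M \<Otimes>\<^sub>M M))"
        by (rule integral_rect_conditioned[OF assms(1) C f sec A B a _ b]) (erule (1) a_eq, erule (1) b_eq)
      show "(\<integral>z. a (fst z) * b (snd z) * g z \<partial>(M \<Otimes>\<^sub>M M))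
          = (\<integral>z. indicator A (fst z) * indicator B (snd z) * g z \<partial>(M \<Otimes>\<^sub>M M))"
        by (rule integral_rect_conditioned[OF assms(1) C gi secg A B a _ b, symmetric]) (erule (1) a_eq, erule (1) b_eq)
    qed
  qed
  have "AE z in M \<Otimes>\<^sub>M M. f z - g z = 0"
  proof (rule AE_zero_generator[OF MM.P.finite_measure_axioms _ Int_stable_pair_measure_generator])
    show "sets (M \<Otimes>\<^sub>M M) = sigma_sets (space (M \<Otimes>\<^sub>M M)) {a \<times> b | a b. a \<in> sets M \<and> b \<in> sets M}"
      by (simp add: sets_pair_measure space_pair_measure)
    show "space (M \<Otimes>\<^sub>M M) \<in> {a \<times> b | a b. a \<in> sets M \<and> b \<in> sets M}"
      by (auto simp: space_pair_measure)
    show "integrable (M \<Otimes>\<^sub>M M) (\<lambda>z. f z - g z)" using f gi by simp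
    fix E assume "E \<in> {a \<times> b | a b. a \<in> sets M \<and> b \<in> sets M}"
    then obtain A B where AB: "A \<in> sets M" "B \<in> sets M" "E = A \<times> B" by blast
    have E: "indicator E z = (indicator A (fst z) * indicator B (snd z) :: real)" for z
      unfolding AB(3) by (simp add: indicator_def mem_Times_iff)
    have int: "integrable (M \<Otimes>\<^sub>M M) (\<lambda>z. indicator A (fst z) * indicator B (snd z) * k z)"
      if "integrable (M \<Otimes>\<^sub>M M) k" for k :: "_ \<Rightarrow> real"
    proof -
      have "E \<in> sets (M \<Otimes>\<^sub>M M)" using AB by simp
      from integrable_mult_indicator[OF this that] show ?thesis unfolding E by simp
    qed
    show "set_lebesgue_integral (M \<Otimes>\<^sub>M M) E (\<lambda>z. f z - g z) = 0"
      unfolding set_lebesgue_integral_def using eq[OF AB(1,2)] int[OF f] int[OF gi]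
      by (simp add: E right_diff_distrib)
  qed
  then show ?thesis by (intro that[OF g]) simp
qed

definition shared_sets :: "'a measure \<Rightarrow> 'b measure \<Rightarrow> ('a \<times> 'b) measure \<Rightarrow> 'a set set" where
  "shared_sets M M' \<nu> = {A \<in> sets M. \<exists>A'\<in>sets M'. AE z in \<nu>. fst z \<in> A \<longleftrightarrow> snd z \<in> A'}"

text \<open>The shared sets already form a \<sigma>-algebra: complements and countable unions of
  partners are partners again.\<close>

lemma sets_sigma_shared:
  assumes \<nu>: "\<nu> \<in> couplings M M'"
  shows "sets (sigma (space M) (shared_sets M M' \<nu>)) = shared_sets M M' \<nu>"
proof -
  have sub: "shared_sets M M' \<nu> \<subseteq> Pow (space M)"
    using sets.space_closed by (auto simp: shared_sets_def)
  have "A \<in> shared_sets M M' \<nu>" if "A \<in> sigma_sets (space M) (shared_sets M M' \<nu>)" for A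
    using that
  proof induction
    case Empty
    show ?case by (auto simp: shared_sets_def)
  next
    case (Compl A)
    then obtain A' where A: "A \<in> sets M" "A' \<in> sets M'" "AE z in \<nu>. fst z \<in> A \<longleftrightarrow> snd z \<in> A'"
      by (auto simp: shared_sets_def)
    \<comment> \<open>Complements are relative to the two spaces, so both coordinates must be known
      to lie in them.\<close>
    have "AE z in \<nu>. z \<in> space \<nu>" by simp
    then have "AE z in \<nu>. fst z \<in> space M - A \<longleftrightarrow> snd z \<in> space M' - A'"
      using A(3) by eventually_elim (auto simp: couplingsD(6)[OF \<nu>])
    moreover have "space M - A \<in> sets M" "space M' - A' \<in> sets M'" using A(1,2) by auto
    ultimately show ?case unfolding shared_sets_def by blast
  next
    case (Union A)
    then obtain A' where A: "\<And>i. A i \<in> sets M" "\<And>i. A' i \<in> sets M'"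
      "\<And>i. AE z in \<nu>. fst z \<in> A i \<longleftrightarrow> snd z \<in> A' i"
      unfolding shared_sets_def by simp metis
    have "AE z in \<nu>. \<forall>i. fst z \<in> A i \<longleftrightarrow> snd z \<in> A' i"
      using A(3) by (simp add: AE_all_countable)
    then have "AE z in \<nu>. fst z \<in> (\<Union>i. A i) \<longleftrightarrow> snd z \<in> (\<Union>i. A' i)"
      by eventually_elim simp
    moreover have "(\<Union>i. A i) \<in> sets M" "(\<Union>i. A' i) \<in> sets M'" using A by auto
    ultimately show ?case unfolding shared_sets_def by blast
  qed auto
  then show ?thesis
    using sub by (auto simp: sigma_sets.Basic)
qed

lemma subalgebra_shared:
  assumes "\<nu> \<in> couplings M M'"
  shows "subalgebra M (sigma (space M) (shared_sets M M' \<nu>))"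
  unfolding subalgebra_def using sets_sigma_shared[OF assms]
  by (auto simp: shared_sets_def space_measure_of_conv)

text \<open>The preimages of a Borel set under \<open>g\<close> and \<open>g'\<close> are partners
  of each other.\<close>

lemma borel_measurable_shared:
  fixes g :: "'a \<Rightarrow> real" and g' :: "'b \<Rightarrow> real"
  assumes \<nu>: "\<nu> \<in> couplings M M'" and g: "g \<in> borel_measurable M" and g': "g' \<in> borel_measurable M'"
    and AE: "AE z in \<nu>. g (fst z) = g' (snd z)"
  shows "g \<in> borel_measurable (sigma (space M) (shared_sets M M' \<nu>))"
proof (rule measurableI)
  fix B :: "real set" assume B: "B \<in> sets borel"
  have "AE z in \<nu>. z \<in> space \<nu>" by simp
  then have "AE z in \<nu>. fst z \<in> g -` B \<inter> space M \<longleftrightarrow> snd z \<in> g' -` B \<inter> space M'"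
    using AE by eventually_elim (auto simp: couplingsD(6)[OF \<nu>])
  then have "g -` B \<inter> space M \<in> shared_sets M M' \<nu>"
    using measurable_sets[OF g B] measurable_sets[OF g' B] unfolding shared_sets_def by blast
  then show "g -` B \<inter> space (sigma (space M) (shared_sets M M' \<nu>)) \<in> sets (sigma (space M) (shared_sets M M' \<nu>))"
    by (simp add: sets_sigma_shared[OF \<nu>] space_measure_of_conv)
qed simp

text \<open>Since \<open>M\<close> is a marginal of \<open>\<nu>\<close>, the integral over
  \<open>y\<close> can be taken over \<open>w = (y, y')\<close> with respect to
  \<open>\<nu>\<close>. There \<open>f(x,y)\<close> may be replaced by \<open>f'(x',y')\<close> for
  almost every \<open>(x, x')\<close>. The weight still involves \<open>y\<close>, but it is
  integrated out, and what remains is a function of \<open>x'\<close> alone.\<close>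

lemma section_shared:
  fixes f :: "'a \<times> 'a \<Rightarrow> real" and f' :: "'b \<times> 'b \<Rightarrow> real"
  assumes M: "prob_space M" and \<nu>: "\<nu> \<in> couplings M M'"
    and f: "f \<in> borel_measurable (M \<Otimes>\<^sub>M M)" and f': "f' \<in> borel_measurable (M' \<Otimes>\<^sub>M M')"
    and AE: "AE z in \<nu> \<Otimes>\<^sub>M \<nu>. f (fst (fst z), fst (snd z)) = f' (snd (fst z), snd (snd z))"
    and b: "b \<in> borel_measurable M"
  shows "(\<lambda>x. \<integral>y. b y * f (x, y) \<partial>M) \<in> borel_measurable (sigma (space M) (shared_sets M M' \<nu>))"
proof (rule borel_measurable_shared[OF \<nu>, where g' = "\<lambda>x'. \<integral>w. b (fst w) * f' (x', snd w) \<partial>\<nu>"])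
  interpret M: prob_space M by fact
  interpret \<nu>: prob_space \<nu> by (rule prob_space_coupling[OF \<nu> M])
  interpret \<nu>\<nu>: pair_prob_space \<nu> \<nu> ..
  note [measurable] = couplingsD(4,5)[OF \<nu>] b f f'
  show "(\<lambda>x. \<integral>y. b y * f (x, y) \<partial>M) \<in> borel_measurable M" by measurable
  show "(\<lambda>x'. \<integral>w. b (fst w) * f' (x', snd w) \<partial>\<nu>) \<in> borel_measurable M'" by measurable
  have "AE z in \<nu>. AE w in \<nu>. f (fst z, fst w) = f' (snd z, snd w)"
    using \<nu>\<nu>.AE_pair[OF AE] by simp
  moreover have "AE z in \<nu>. z \<in> space \<nu>" by simp
  ultimately show "AE z in \<nu>. (\<integral>y. b y * f (fst z, y) \<partial>M) = (\<integral>w. b (fst w) * f' (snd z, snd w) \<partial>\<nu>)"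
  proof eventually_elim
    case (elim z)
    have z[measurable]: "fst z \<in> space M" "snd z \<in> space M'"
      using elim(2) by (simp_all add: couplingsD(6)[OF \<nu>] mem_Times_iff)
    have "(\<integral>y. b y * f (fst z, y) \<partial>M) = (\<integral>y. b y * f (fst z, y) \<partial>(distr \<nu> M fst))"
      by (simp add: couplingsD(2)[OF \<nu>])
    also have "\<dots> = (\<integral>w. b (fst w) * f (fst z, fst w) \<partial>\<nu>)"
      by (rule integral_distr) measurable
    also have "\<dots> = (\<integral>w. b (fst w) * f' (snd z, snd w) \<partial>\<nu>)"
    proof (rule integral_cong_AE)
      show "AE w in \<nu>. b (fst w) * f (fst z, fst w) = b (fst w) * f' (snd z, snd w)"
        using elim(1) by eventually_elim simp
    qed measurable
    finally show ?case .
  qed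
qed

lemma AE_pair_swap:
  assumes "prob_space K" "AE z in K \<Otimes>\<^sub>M K. Q (fst z) (snd z)"
  shows "AE z in K \<Otimes>\<^sub>M K. Q (snd z) (fst z)"
proof -
  interpret prob_space K by fact
  interpret pair_prob_space K K ..
  have "AE z in distr (K \<Otimes>\<^sub>M K) (K \<Otimes>\<^sub>M K) (\<lambda>(x, y). (y, x)). Q (fst z) (snd z)"
    unfolding distr_pair_swap[symmetric] by (rule assms(2))
  from AE_distrD[OF measurable_pair_swap' this] show ?thesis
    by (simp add: case_prod_unfold)
qed

text \<open>Sections in the other variable are reduced to the preceding case by exchanging the
  arguments of \<open>f\<close> and \<open>f'\<close>.\<close>

lemma sections_measurable_shared:
  fixes f :: "'a \<times> 'a \<Rightarrow> real" and f' :: "'b \<times> 'b \<Rightarrow> real"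
  assumes M: "prob_space M" and \<nu>: "\<nu> \<in> couplings M M'"
    and f: "f \<in> borel_measurable (M \<Otimes>\<^sub>M M)" and f': "f' \<in> borel_measurable (M' \<Otimes>\<^sub>M M')"
    and AE: "AE z in \<nu> \<Otimes>\<^sub>M \<nu>. f (fst (fst z), fst (snd z)) = f' (snd (fst z), snd (snd z))"
  shows "sections_measurable M (sigma (space M) (shared_sets M M' \<nu>)) f"
proof -
  have sw: "(\<lambda>z. f (snd z, fst z)) \<in> borel_measurable (M \<Otimes>\<^sub>M M)"
    by (rule measurable_compose[OF _ f, of "\<lambda>z. (snd z, fst z)"]) measurable
  have sw': "(\<lambda>z. f' (snd z, fst z)) \<in> borel_measurable (M' \<Otimes>\<^sub>M M')"
    by (rule measurable_compose[OF _ f', of "\<lambda>z. (snd z, fst z)"]) measurable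
  have "AE z in \<nu> \<Otimes>\<^sub>M \<nu>. f (fst (snd z), fst (fst z)) = f' (snd (snd z), snd (fst z))"
    using AE_pair_swap[OF prob_space_coupling[OF \<nu> M], of "\<lambda>u v. f (fst u, fst v) = f' (snd u, snd v)"] AE by simp
  then have AE': "AE z in \<nu> \<Otimes>\<^sub>M \<nu>. (\<lambda>z. f (snd z, fst z)) (fst (fst z), fst (snd z))
      = (\<lambda>z. f' (snd z, fst z)) (snd (fst z), snd (snd z))" by simp
  show ?thesis
    unfolding sections_measurable_def
    using section_shared[OF M \<nu> f f' AE] section_shared[OF M \<nu> sw sw' AE'] by simp
qed

text \<open>The function \<open>f\<close> is coded by shared sets \<open>A i\<close>. Their partners
  \<open>A' i\<close> produce, \<open>\<nu>\<close>-almost surely, the same bits, so the same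
  \<open>V\<close> represents \<open>f'\<close>: first under the square of \<open>\<nu>\<close>, and
  then on the second space because \<open>\<nu>\<close> has \<open>M'\<close> as its
  marginal.\<close>

lemma coupling_common_factor:
  fixes f :: "'a \<times> 'a \<Rightarrow> real" and f' :: "'b \<times> 'b \<Rightarrow> real"
  assumes M: "prob_space M" and \<nu>: "\<nu> \<in> couplings M M'"
    and f: "integrable (M \<Otimes>\<^sub>M M) f" "\<And>z. f z \<ge> 0" and f': "f' \<in> borel_measurable (M' \<Otimes>\<^sub>M M')"
    and AE: "AE z in \<nu> \<Otimes>\<^sub>M \<nu>. f (fst (fst z), fst (snd z)) = f' (snd (fst z), snd (snd z))"
  obtains A A' V where "\<And>i. A i \<in> sets M" "\<And>i. A' i \<in> sets M'" "V \<in> borel_measurable (borel \<Otimes>\<^sub>M borel)"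
    "\<And>w. 0 \<le> (V w :: real)" "AE z in \<nu>. bits A (fst z) = bits A' (snd z)"
    "AE z in M \<Otimes>\<^sub>M M. f z = V (bits A (fst z), bits A (snd z))"
    "AE z in M' \<Otimes>\<^sub>M M'. f' z = V (bits A' (fst z), bits A' (snd z))"
proof -
  let ?C = "sigma (space M) (shared_sets M M' \<nu>)"
  note C = subalgebra_shared[OF \<nu>]
  have \<nu>p: "prob_space \<nu>" by (rule prob_space_coupling[OF \<nu> M])
  obtain g where g: "g \<in> borel_measurable (?C \<Otimes>\<^sub>M ?C)" and fg: "AE z in M \<Otimes>\<^sub>M M. f z = g z"
    by (rule sections_measurable_imp_product_measurable[OF M C f(1)
          sections_measurable_shared[OF M \<nu> borel_measurable_integrable[OF f(1)] f' AE]]) (rule that, assumption+)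
  obtain A V where A: "\<And>i. A i \<in> sets ?C" and V[measurable]: "V \<in> borel_measurable (borel \<Otimes>\<^sub>M borel)" and V0: "\<And>w. 0 \<le> V w"
    and gV: "\<And>x y. x \<in> space ?C \<Longrightarrow> y \<in> space ?C \<Longrightarrow> max 0 (g (x, y)) = V (bits A x, bits A y)"
    by (rule factor_fun_bits[OF g]) (rule that, assumption+)
  have AM: "A i \<in> sets M" for i using A[of i] sets_sigma_shared[OF \<nu>] by (auto simp: shared_sets_def)
  have "\<exists>B. B \<in> sets M' \<and> (AE z in \<nu>. fst z \<in> A i \<longleftrightarrow> snd z \<in> B)" for i
  proof -
    have "A i \<in> shared_sets M M' \<nu>" using A[of i] sets_sigma_shared[OF \<nu>] by simp
    then show ?thesis unfolding shared_sets_def by auto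
  qed
  then have "\<forall>i. \<exists>B. B \<in> sets M' \<and> (AE z in \<nu>. fst z \<in> A i \<longleftrightarrow> snd z \<in> B)" ..
  from choice[OF this] obtain A' where
    A': "\<And>i. A' i \<in> sets M'" "\<And>i. AE z in \<nu>. fst z \<in> A i \<longleftrightarrow> snd z \<in> A' i"
    by blast
  have "AE z in \<nu>. \<forall>i. fst z \<in> A i \<longleftrightarrow> snd z \<in> A' i"
    using A'(2) by (simp add: AE_all_countable)
  then have bits: "AE z in \<nu>. bits A (fst z) = bits A' (snd z)"
    by eventually_elim (simp add: bits_def)
  have "AE z in M \<Otimes>\<^sub>M M. z \<in> space (M \<Otimes>\<^sub>M M)" by simp
  with fg have fV: "AE z in M \<Otimes>\<^sub>M M. f z = V (bits A (fst z), bits A (snd z))"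
  proof eventually_elim
    case (elim z)
    \<comment> \<open>The positive part does no harm: \<open>g\<close> agrees almost everywhere with
      the nonnegative \<open>f\<close>.\<close>
    then have "max 0 (g z) = V (bits A (fst z), bits A (snd z))"
      using gV[of "fst z" "snd z"] by (auto simp: space_pair_measure space_measure_of_conv)
    then show ?case using elim(1) f(2)[of z] by simp
  qed
  note mA' = measurable_bits[OF A'(1)]
  note [measurable] = f'
  have V'[measurable]: "(\<lambda>z. V (bits A' (fst z), bits A' (snd z))) \<in> borel_measurable (M' \<Otimes>\<^sub>M M')"
    using measurable_compose[OF measurable_pair_square[OF mA'] V] .
  have AEf: "AE z in \<nu> \<Otimes>\<^sub>M \<nu>. f (fst (fst z), fst (snd z)) = V (bits A (fst (fst z)), bits A (fst (snd z)))"
    using AE_pair_square[OF \<nu>p couplingsD(4,2)[OF \<nu>], of "\<lambda>x y. f (x, y) = V (bits A x, bits A y)"] fV by simp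
  have "AE z in \<nu> \<Otimes>\<^sub>M \<nu>. f' (snd (fst z), snd (snd z)) = V (bits A' (snd (fst z)), bits A' (snd (snd z)))"
    using AE AEf AE_pair_square_both[OF \<nu>p bits] by eventually_elim simp
  then have "AE z in distr (\<nu> \<Otimes>\<^sub>M \<nu>) (M' \<Otimes>\<^sub>M M') (\<lambda>z. (snd (fst z), snd (snd z))). f' z = V (bits A' (fst z), bits A' (snd z))"
    by (subst AE_distr_iff[OF measurable_pair_square[OF couplingsD(5)[OF \<nu>]]]) simp_all
  then have f'V: "AE z in M' \<Otimes>\<^sub>M M'. f' z = V (bits A' (fst z), bits A' (snd z))"
    unfolding distr_pair_coupling(2)[OF M \<nu>] .
  show ?thesis by (rule that[OF AM A'(1) V V0 bits fV f'V])
qed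

section \<open>Passage between the given spaces and the Cantor space\<close>

lemma distr_self:
  assumes "f \<in> measurable M N"
  shows "f \<in> measurable M (distr M N f)" "distr M (distr M N f) f = distr M N f"
  using assms by (auto intro: distr_cong)

lemma graphon_integrable:
  assumes "graphon M W"
  shows "integrable (M \<Otimes>\<^sub>M M) (\<lambda>z. W (fst z) (snd z))"
  unfolding integrable_iff_bounded real_norm_def
  using assms borel_measurable_graphon[OF assms measurable_fst measurable_snd]
  by (simp only: graphon_def)

text \<open>Reduces an arbitrary probability space to a law on the Cantor space. The identity holds
  at all points of the space, so integrals and couplings can be transported without exceptional
  sets.\<close>

lemma graphon_factor_bits:
  assumes M: "prob_space M" and W: "graphon M W"
  obtains \<psi> :: "'a \<Rightarrow> nat \<Rightarrow> bool" and U where "\<psi> \<in> measurable M borel"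
    "integrable (distr M borel \<psi> \<Otimes>\<^sub>M distr M borel \<psi>) U" "\<And>w. 0 \<le> (U w :: real)"
    "\<And>x y. x \<in> space M \<Longrightarrow> y \<in> space M \<Longrightarrow> W x y = U (\<psi> x, \<psi> y)"
proof -
  have W_meas: "(\<lambda>z. W (fst z) (snd z)) \<in> borel_measurable (M \<Otimes>\<^sub>M M)"
    by (rule borel_measurable_graphon[OF W]) simp_all
  obtain A U where A: "\<And>i. A i \<in> sets M" and U: "U \<in> borel_measurable (borel \<Otimes>\<^sub>M borel)" and U0: "\<And>w. 0 \<le> U w"
    and eq: "\<And>x y. x \<in> space M \<Longrightarrow> y \<in> space M \<Longrightarrow> max 0 (W (fst (x, y)) (snd (x, y))) = U (bits A x, bits A y)"
    by (rule factor_fun_bits[OF W_meas]) (rule that, assumption+)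
  have WU: "W x y = U (bits A x, bits A y)" if "x \<in> space M" "y \<in> space M" for x y
    using eq[OF that] W by (simp add: graphon_def)
  let ?\<mu> = "distr M borel (bits A)"
  note \<psi> = measurable_bits[OF A]
  have U\<mu>: "U \<in> borel_measurable (?\<mu> \<Otimes>\<^sub>M ?\<mu>)" using U by (simp cong: measurable_cong_sets)
  have "integrable (M \<Otimes>\<^sub>M M) (\<lambda>z. U (bits A (fst z), bits A (snd z)))"
    using graphon_integrable[OF W]
    by (rule Bochner_Integration.integrable_cong[THEN iffD1, OF refl, rotated])
      (auto simp: space_pair_measure WU)
  then have int: "integrable (?\<mu> \<Otimes>\<^sub>M ?\<mu>) U"
    using integrable_distr_eq[OF measurable_pair_square[OF distr_self(1)[OF \<psi>]] U\<mu>]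
      distr_pair_square[OF M distr_self[OF \<psi>]] by simp
  show ?thesis by (rule that[OF \<psi> int U0 WU])
qed

lemma bits_real_injection:
  obtains j :: "(nat \<Rightarrow> bool) \<Rightarrow> real" and k where "\<And>b. k (j b) = b"
proof -
  obtain g :: "nat set \<Rightarrow> real" where g: "bij_betw g UNIV UNIV"
    using nat_sets_eqpoll_reals unfolding eqpoll_def by blast
  have "(\<lambda>r i. i \<in> inv g r) (g (Collect b)) = b" for b
    using g by (simp add: bij_betw_def inv_f_f)
  then show ?thesis by (rule that)
qed

text \<open>The witness lives on \<open>real\<close> with the pulled back sigma-algebra, so an arbitrary injection of the
  Cantor space suffices; averaging \<open>V\<close> over both orders makes the graphon symmetric everywhere.\<close>

lemma graphon_equiv_bitsI:
  fixes \<phi> :: "'a \<Rightarrow> nat \<Rightarrow> bool" and \<phi>' :: "'b \<Rightarrow> nat \<Rightarrow> bool"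
  assumes M: "prob_space M" and M': "prob_space M'" and W: "graphon M W" and W': "graphon M' W'"
    and \<phi>: "\<phi> \<in> measurable M borel" and \<phi>': "\<phi>' \<in> measurable M' borel"
    and law: "distr M borel \<phi> = distr M' borel \<phi>'"
    and V: "V \<in> borel_measurable (borel \<Otimes>\<^sub>M borel)" "\<And>w. 0 \<le> V w"
    and AE: "AE z in M \<Otimes>\<^sub>M M. W (fst z) (snd z) = V (\<phi> (fst z), \<phi> (snd z))"
    and AE': "AE z in M' \<Otimes>\<^sub>M M'. W' (fst z) (snd z) = V (\<phi>' (fst z), \<phi>' (snd z))"
  shows "graphon_equiv M W M' W'"
proof -
  obtain j :: "(nat \<Rightarrow> bool) \<Rightarrow> real" and k where kj: "\<And>b. k (j b) = b"
    by (rule bits_real_injection) (rule that)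
  \<comment> \<open>In this \<sigma>-algebra \<open>k\<close> is measurable by construction, and
    \<open>j\<close> is measurable because \<open>k\<close> undoes it.\<close>
  let ?R = "vimage_algebra UNIV k (borel :: (nat \<Rightarrow> bool) measure)"
  have k: "k \<in> measurable ?R borel" by (rule measurable_vimage_algebra1) simp
  have j: "j \<in> measurable borel ?R"
    by (rule measurable_vimage_algebra2) (simp_all add: kj)
  define N where "N = distr M ?R (\<lambda>x. j (\<phi> x))"
  define U where "U s t = (V (k s, k t) + V (k t, k s)) / 2" for s t
  have m: "(\<lambda>x. j (\<phi> x)) \<in> measurable M ?R" "(\<lambda>x. j (\<phi>' x)) \<in> measurable M' ?R"
    by (rule measurable_compose[OF \<phi> j] measurable_compose[OF \<phi>' j])+
  have "N = distr (distr M borel \<phi>) ?R j"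
    unfolding N_def by (subst distr_distr[OF j \<phi>]) (simp add: comp_def)
  also have "\<dots> = distr M' ?R (\<lambda>x. j (\<phi>' x))"
    unfolding law by (subst distr_distr[OF j \<phi>']) (simp add: comp_def)
  finally have N': "N = distr M' ?R (\<lambda>x. j (\<phi>' x))" .
  have mN: "(\<lambda>x. j (\<phi> x)) \<in> measurable M N" "distr M N (\<lambda>x. j (\<phi> x)) = N"
    unfolding N_def by (rule distr_self[OF m(1)])+
  have mN': "(\<lambda>x. j (\<phi>' x)) \<in> measurable M' N" "distr M' N (\<lambda>x. j (\<phi>' x)) = N"
    unfolding N' by (rule distr_self[OF m(2)])+
  \<comment> \<open>As \<open>Y\<close> is symmetric, it agrees almost everywhere with
    \<open>V\<close> in either order of the arguments, hence also with the average.\<close>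
  have sym: "AE z in L \<Otimes>\<^sub>M L. Y (fst z) (snd z) = U (j (\<theta> (fst z))) (j (\<theta> (snd z)))"
    if L: "prob_space L" and Y: "graphon L Y"
      and ae: "AE z in L \<Otimes>\<^sub>M L. Y (fst z) (snd z) = V (\<theta> (fst z), \<theta> (snd z))"
    for L :: "'z measure" and Y and \<theta> :: "'z \<Rightarrow> nat \<Rightarrow> bool"
    using ae AE_pair_swap[OF L ae]
  proof eventually_elim
    case (elim z)
    have "Y (fst z) (snd z) = Y (snd z) (fst z)" using Y unfolding graphon_def by blast
    then show ?case using elim by (simp add: U_def kj)
  qed
  have kN[measurable]: "k \<in> measurable N borel" unfolding N_def using k by simp
  have UN: "(\<lambda>z. U (fst z) (snd z)) \<in> borel_measurable (N \<Otimes>\<^sub>M N)"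
  proof -
    have "(\<lambda>z. V (k (fst z), k (snd z))) \<in> borel_measurable (N \<Otimes>\<^sub>M N)"
      using measurable_compose[OF measurable_pair_square[OF kN] V(1)] .
    moreover have "(\<lambda>z. V (k (snd z), k (fst z))) \<in> borel_measurable (N \<Otimes>\<^sub>M N)"
      by (rule measurable_compose[OF _ V(1), of "\<lambda>z. (k (snd z), k (fst z))"]) measurable
    ultimately show ?thesis unfolding U_def by measurable
  qed
  have "(\<integral>\<^sup>+z. ennreal \<bar>U (fst z) (snd z)\<bar> \<partial>(N \<Otimes>\<^sub>M N))
      = (\<integral>\<^sup>+z. ennreal \<bar>U (j (\<phi> (fst z))) (j (\<phi> (snd z)))\<bar> \<partial>(M \<Otimes>\<^sub>M M))"
    using UN by (subst nn_integral_pair_square[OF M mN, symmetric]) simp_all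
  also have "\<dots> = (\<integral>\<^sup>+z. ennreal \<bar>W (fst z) (snd z)\<bar> \<partial>(M \<Otimes>\<^sub>M M))"
    by (rule nn_integral_cong_AE) (use sym[OF M W AE] in eventually_elim, simp)
  also have "\<dots> < \<infinity>" using W by (simp only: graphon_def)
  finally have "graphon N U"
    using UN V(2) by (simp add: graphon_def case_prod_unfold U_def add.commute)
  moreover have "prob_space N"
    unfolding N_def by (rule prob_space.prob_space_distr[OF M m(1)])
  ultimately have "graphon_equiv_via M W M' W' N"
    unfolding graphon_equiv_via_def
    using mN mN' sym[OF M W AE] sym[OF M' W' AE'] by blast
  then show ?thesis unfolding graphon_equiv_def by blast
qed

lemma delta_cut_imp_graphon_equiv:
  fixes W :: "'a \<Rightarrow> 'a \<Rightarrow> real" and W' :: "'b \<Rightarrow> 'b \<Rightarrow> real"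
  assumes M: "prob_space M" and M': "prob_space M'" and W: "graphon M W" and W': "graphon M' W'"
    and 0: "delta_cut M W M' W' = 0"
  shows "graphon_equiv M W M' W'"
proof -
  obtain \<psi> :: "'a \<Rightarrow> nat \<Rightarrow> bool" and U where \<psi>: "\<psi> \<in> measurable M borel"
    and U: "integrable (distr M borel \<psi> \<Otimes>\<^sub>M distr M borel \<psi>) U" "\<And>w. 0 \<le> (U w :: real)"
    and WU: "\<And>x y. x \<in> space M \<Longrightarrow> y \<in> space M \<Longrightarrow> W x y = U (\<psi> x, \<psi> y)"
    by (rule graphon_factor_bits[OF M W]) (rule that, assumption+)
  obtain \<psi>' :: "'b \<Rightarrow> nat \<Rightarrow> bool" and U' where \<psi>': "\<psi>' \<in> measurable M' borel"
    and U': "integrable (distr M' borel \<psi>' \<Otimes>\<^sub>M distr M' borel \<psi>') U'" "\<And>w. 0 \<le> (U' w :: real)"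
    and WU': "\<And>x y. x \<in> space M' \<Longrightarrow> y \<in> space M' \<Longrightarrow> W' x y = U' (\<psi>' x, \<psi>' y)"
    by (rule graphon_factor_bits[OF M' W']) (rule that, assumption+)
  define \<mu> where "\<mu> = distr M borel \<psi>"
  define \<mu>' where "\<mu>' = distr M' borel \<psi>'"
  note U = U[folded \<mu>_def] and U' = U'[folded \<mu>'_def]
  have \<mu>: "prob_space \<mu>" "sets \<mu> = sets borel"
    unfolding \<mu>_def using prob_space.prob_space_distr[OF M \<psi>] by simp_all
  have \<mu>': "prob_space \<mu>'" "sets \<mu>' = sets borel"
    unfolding \<mu>'_def using prob_space.prob_space_distr[OF M' \<psi>'] by simp_all
  note \<psi>\<mu> = distr_self[OF \<psi>, folded \<mu>_def] and \<psi>\<mu>' = distr_self[OF \<psi>', folded \<mu>'_def]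
  have "\<exists>\<nu>. \<nu> \<in> couplings M M' \<and> (\<forall>S\<in>sets (M \<Otimes>\<^sub>M M'). \<forall>T\<in>sets (M \<Otimes>\<^sub>M M').
      \<bar>set_lebesgue_integral (\<nu> \<Otimes>\<^sub>M \<nu>) (S \<times> T) (overlay W W')\<bar> \<le> 1 / real (Suc n))" for n
    using 0[unfolded delta_cut_eq_0_iff, rule_format, of "1 / real (Suc n)"] by auto
  then have "\<forall>n. \<exists>\<nu>. \<nu> \<in> couplings M M' \<and> (\<forall>S\<in>sets (M \<Otimes>\<^sub>M M'). \<forall>T\<in>sets (M \<Otimes>\<^sub>M M').
      \<bar>set_lebesgue_integral (\<nu> \<Otimes>\<^sub>M \<nu>) (S \<times> T) (overlay W W')\<bar> \<le> 1 / real (Suc n))" ..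
  from choice[OF this] obtain \<nu> where \<nu>: "\<And>n. \<nu> n \<in> couplings M M'"
    and cut: "\<And>n S T. S \<in> sets (M \<Otimes>\<^sub>M M') \<Longrightarrow> T \<in> sets (M \<Otimes>\<^sub>M M') \<Longrightarrow>
      \<bar>set_lebesgue_integral (\<nu> n \<Otimes>\<^sub>M \<nu> n) (S \<times> T) (overlay W W')\<bar> \<le> 1 / real (Suc n)"
    by blast
  \<comment> \<open>Pushing the couplings forward by \<open>r\<close> gives couplings of the two
    laws on the Cantor space, where compactness is available.\<close>
  define r where "r z = (\<psi> (fst z), \<psi>' (snd z))" for z
  define \<kappa> where "\<kappa> n = distr (\<nu> n) (\<mu> \<Otimes>\<^sub>M \<mu>') r" for n
  have r: "r \<in> measurable (\<nu> n) (\<mu> \<Otimes>\<^sub>M \<mu>')" for n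
    unfolding r_def
    by (intro measurable_Pair measurable_compose[OF couplingsD(4)[OF \<nu>] \<psi>\<mu>(1)]
        measurable_compose[OF couplingsD(5)[OF \<nu>] \<psi>\<mu>'(1)])
  have \<kappa>: "\<kappa> n \<in> couplings \<mu> \<mu>'" for n
    unfolding couplings_def
  proof (intro CollectI conjI)
    show "sets (\<kappa> n) = sets (\<mu> \<Otimes>\<^sub>M \<mu>')" by (simp add: \<kappa>_def)
    have "distr (\<kappa> n) \<mu> fst = distr (\<nu> n) \<mu> (\<lambda>z. \<psi> (fst z))"
      unfolding \<kappa>_def by (subst distr_distr[OF measurable_fst r]) (simp add: comp_def r_def)
    then show "distr (\<kappa> n) \<mu> fst = \<mu>"
      using measure_preserving_comp(2)[OF couplingsD(4,2)[OF \<nu>] \<psi>\<mu>] by simp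
    have "distr (\<kappa> n) \<mu>' snd = distr (\<nu> n) \<mu>' (\<lambda>z. \<psi>' (snd z))"
      unfolding \<kappa>_def by (subst distr_distr[OF measurable_snd r]) (simp add: comp_def r_def)
    then show "distr (\<kappa> n) \<mu>' snd = \<mu>'"
      using measure_preserving_comp(2)[OF couplingsD(5,3)[OF \<nu>] \<psi>\<mu>'] by simp
  qed
  have cut\<kappa>: "(\<lambda>n. \<integral>z. indicator (S \<times> T) z * (U (fst (fst z), fst (snd z)) - U' (snd (fst z), snd (snd z)))
      \<partial>(\<kappa> n \<Otimes>\<^sub>M \<kappa> n)) \<longlonglongrightarrow> 0"
    if S: "S \<in> sets (\<mu> \<Otimes>\<^sub>M \<mu>')" and T: "T \<in> sets (\<mu> \<Otimes>\<^sub>M \<mu>')" for S T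
  proof (rule Lim_null_comparison[OF _ LIMSEQ_inverse_real_of_nat], intro always_eventually allI)
    fix n
    let ?g = "\<lambda>z. indicator (S \<times> T) z * (U (fst (fst z), fst (snd z)) - U' (snd (fst z), snd (snd z)))"
    have prob\<nu>: "prob_space (\<nu> n)" by (rule prob_space_coupling[OF \<nu> M])
    note rn = distr_self[OF r, folded \<kappa>_def]
    note K = couplingsD[OF \<kappa>[of n]]
    have prob\<kappa>: "prob_space (\<kappa> n)" by (rule prob_space_coupling[OF \<kappa> \<mu>(1)])
    have Uf: "(\<lambda>z. U (fst (fst z), fst (snd z))) \<in> borel_measurable (\<kappa> n \<Otimes>\<^sub>M \<kappa> n)"
      by (rule borel_measurable_integrable[OF integrable_pair_square[OF prob\<kappa> K(4,2) U(1)]])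
    have Us: "(\<lambda>z. U' (snd (fst z), snd (snd z))) \<in> borel_measurable (\<kappa> n \<Otimes>\<^sub>M \<kappa> n)"
      by (rule borel_measurable_integrable[OF integrable_pair_square[OF prob\<kappa> K(5,3) U'(1)]])
    have ST: "S \<times> T \<in> sets (\<kappa> n \<Otimes>\<^sub>M \<kappa> n)" using S T by (simp add: K(1))
    have g: "?g \<in> borel_measurable (\<kappa> n \<Otimes>\<^sub>M \<kappa> n)"
      by (intro borel_measurable_times borel_measurable_diff borel_measurable_indicator Uf Us ST)
    \<comment> \<open>A rectangle in the Cantor square corresponds to the rectangle of preimages, so
      the cut bound for \<open>\<nu> n\<close> passes to \<open>\<kappa> n\<close> with the same
      constant.\<close>
    define S' where "S' = r -` S \<inter> space (M \<Otimes>\<^sub>M M')"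
    define T' where "T' = r -` T \<inter> space (M \<Otimes>\<^sub>M M')"
    have sp: "space (\<nu> n) = space (M \<Otimes>\<^sub>M M')"
      using couplingsD(6)[OF \<nu>[of n]] by (simp add: space_pair_measure)
    have S'T': "S' \<in> sets (M \<Otimes>\<^sub>M M')" "T' \<in> sets (M \<Otimes>\<^sub>M M')"
      using measurable_sets[OF r S, of n] measurable_sets[OF r T, of n] couplingsD(1)[OF \<nu>[of n]]
      by (simp_all add: S'_def T'_def sp)
    have "(\<integral>z. ?g z \<partial>(\<kappa> n \<Otimes>\<^sub>M \<kappa> n)) = (\<integral>z. ?g z \<partial>(distr (\<nu> n \<Otimes>\<^sub>M \<nu> n) (\<kappa> n \<Otimes>\<^sub>M \<kappa> n) (\<lambda>z. (r (fst z), r (snd z)))))"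
      unfolding distr_pair_square[OF prob\<nu> rn] ..
    also have "\<dots> = (\<integral>z. ?g (r (fst z), r (snd z)) \<partial>(\<nu> n \<Otimes>\<^sub>M \<nu> n))"
      by (rule integral_distr[OF measurable_pair_square[OF rn(1)] g])
    also have "\<dots> = set_lebesgue_integral (\<nu> n \<Otimes>\<^sub>M \<nu> n) (S' \<times> T') (overlay W W')"
      unfolding set_lebesgue_integral_def
    proof (rule Bochner_Integration.integral_cong[OF refl])
      fix z assume "z \<in> space (\<nu> n \<Otimes>\<^sub>M \<nu> n)"
      then have z: "fst z \<in> space (M \<Otimes>\<^sub>M M')" "snd z \<in> space (M \<Otimes>\<^sub>M M')"
        by (simp_all only: space_pair_measure[of "\<nu> n" "\<nu> n"] mem_Times_iff sp)
      then have "fst (fst z) \<in> space M" "snd (fst z) \<in> space M'" "fst (snd z) \<in> space M" "snd (snd z) \<in> space M'"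
        by (auto simp: space_pair_measure)
      moreover have "indicator (S' \<times> T') z = (indicator (S \<times> T) (r (fst z), r (snd z)) :: real)"
        using z by (simp add: indicator_def S'_def T'_def mem_Times_iff)
      ultimately show "?g (r (fst z), r (snd z)) = indicator (S' \<times> T') z *\<^sub>R overlay W W' z"
        by (simp add: r_def WU WU')
    qed
    finally show "norm (\<integral>z. ?g z \<partial>(\<kappa> n \<Otimes>\<^sub>M \<kappa> n)) \<le> inverse (real (Suc n))"
      using cut[OF S'T', of n] by (simp add: inverse_eq_divide)
  qed
  obtain \<nu>0 where \<nu>0: "\<nu>0 \<in> couplings \<mu> \<mu>'"
    and AE0: "AE z in \<nu>0 \<Otimes>\<^sub>M \<nu>0. U (fst (fst z), fst (snd z)) = U' (snd (fst z), snd (snd z))"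
    by (rule limit_coupling_AE_eq[OF \<mu> \<mu>' U U' \<kappa> cut\<kappa>]) (assumption, assumption, rule that, assumption+)
  obtain A A' V where A: "\<And>i. A i \<in> sets \<mu>" "\<And>i. A' i \<in> sets \<mu>'" and V: "V \<in> borel_measurable (borel \<Otimes>\<^sub>M borel)"
    "\<And>w. 0 \<le> (V w :: real)" and bits: "AE z in \<nu>0. bits A (fst z) = bits A' (snd z)"
    and UV: "AE z in \<mu> \<Otimes>\<^sub>M \<mu>. U z = V (bits A (fst z), bits A (snd z))"
    and UV': "AE z in \<mu>' \<Otimes>\<^sub>M \<mu>'. U' z = V (bits A' (fst z), bits A' (snd z))"
    by (rule coupling_common_factor[OF \<mu>(1) \<nu>0 U borel_measurable_integrable[OF U'(1)] AE0]) (rule that, assumption+)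
  note b = measurable_bits[OF A(1)] and b' = measurable_bits[OF A(2)]
  show ?thesis
  proof (rule graphon_equiv_bitsI[OF M M' W W' measurable_compose[OF \<psi>\<mu>(1) b] measurable_compose[OF \<psi>\<mu>'(1) b'] _ V])
    \<comment> \<open>Both laws are images of the limit coupling, one through each coordinate, and
      under it the two codes coincide almost surely.\<close>
    have "distr M borel (\<lambda>x. bits A (\<psi> x)) = distr (distr M \<mu> \<psi>) borel (bits A)"
      by (subst distr_distr[OF b \<psi>\<mu>(1)]) (simp add: comp_def)
    also have "\<dots> = distr (distr \<nu>0 \<mu> fst) borel (bits A)"
      by (simp add: \<psi>\<mu>(2) couplingsD(2)[OF \<nu>0])
    also have "\<dots> = distr \<nu>0 borel (\<lambda>z. bits A (fst z))"
      by (subst distr_distr[OF b couplingsD(4)[OF \<nu>0]]) (simp add: comp_def)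
    also have "\<dots> = distr \<nu>0 borel (\<lambda>z. bits A' (snd z))"
      by (rule distr_cong_AE[OF refl refl bits measurable_compose[OF couplingsD(4)[OF \<nu>0] b]
            measurable_compose[OF couplingsD(5)[OF \<nu>0] b']])
    also have "\<dots> = distr (distr \<nu>0 \<mu>' snd) borel (bits A')"
      by (subst distr_distr[OF b' couplingsD(5)[OF \<nu>0]]) (simp add: comp_def)
    also have "\<dots> = distr (distr M' \<mu>' \<psi>') borel (bits A')"
      by (simp add: \<psi>\<mu>'(2) couplingsD(3)[OF \<nu>0])
    also have "\<dots> = distr M' borel (\<lambda>x. bits A' (\<psi>' x))"
      by (subst distr_distr[OF b' \<psi>\<mu>'(1)]) (simp add: comp_def)
    finally show "distr M borel (\<lambda>x. bits A (\<psi> x)) = distr M' borel (\<lambda>x. bits A' (\<psi>' x))" .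
    have "AE z in M \<Otimes>\<^sub>M M. U (\<psi> (fst z), \<psi> (snd z)) = V (bits A (\<psi> (fst z)), bits A (\<psi> (snd z)))"
      using AE_pair_square[OF M \<psi>\<mu>, of "\<lambda>x y. U (x, y) = V (bits A x, bits A y)"] UV by simp
    moreover have "AE z in M \<Otimes>\<^sub>M M. z \<in> space (M \<Otimes>\<^sub>M M)" by simp
    ultimately show "AE z in M \<Otimes>\<^sub>M M. W (fst z) (snd z) = V (bits A (\<psi> (fst z)), bits A (\<psi> (snd z)))"
      by eventually_elim (simp add: space_pair_measure mem_Times_iff WU)
    have "AE z in M' \<Otimes>\<^sub>M M'. U' (\<psi>' (fst z), \<psi>' (snd z)) = V (bits A' (\<psi>' (fst z)), bits A' (\<psi>' (snd z)))"
      using AE_pair_square[OF M' \<psi>\<mu>', of "\<lambda>x y. U' (x, y) = V (bits A' x, bits A' y)"] UV' by simp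
    moreover have "AE z in M' \<Otimes>\<^sub>M M'. z \<in> space (M' \<Otimes>\<^sub>M M')" by simp
    ultimately show "AE z in M' \<Otimes>\<^sub>M M'. W' (fst z) (snd z) = V (bits A' (\<psi>' (fst z)), bits A' (\<psi>' (snd z)))"
      by eventually_elim (simp add: space_pair_measure mem_Times_iff WU')
  qed
qed

theorem theorem2p11:
  fixes p :: real
    and M :: "'a measure" and W :: "'a \<Rightarrow> 'a \<Rightarrow> real"
    and M' :: "'b measure" and W' :: "'b \<Rightarrow> 'b \<Rightarrow> real"
  assumes "p \<ge> 1"
    and "prob_space M" and "prob_space M'"
    and "graphon M W" and "graphon M' W'"
    and "Lp_norm_pow p M W < \<infinity>" and "Lp_norm_pow p M' W' < \<infinity>"
  shows "(delta_cut M W M' W' = 0 \<longleftrightarrow> delta_p p M W M' W' = 0)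
       \<and> (delta_p p M W M' W' = 0 \<longleftrightarrow> graphon_equiv M W M' W')
       \<and> (\<forall>N :: 'c measure. graphon_equiv_via M W M' W' N \<longrightarrow> delta_cut M W M' W' = 0)"
proof -
  have p: "p > 0" using assms(1) by simp
  \<comment> \<open>The implication is polymorphic in the type of the witness space. It serves once
    at the type \<open>'c\<close> and once, in \<open>equiv\<close>, at \<open>real\<close>.\<close>
  have via: "delta_p p M W M' W' = 0" if "graphon_equiv_via M W M' W' N" for N :: "'c measure"
    by (rule graphon_equiv_via_imp_delta_p[OF p assms(2-6) that])
  have equiv: "delta_p p M W M' W' = 0" if "graphon_equiv M W M' W'"
    using that graphon_equiv_via_imp_delta_p[OF p assms(2-6)] unfolding graphon_equiv_def by blast
  have cut: "delta_cut M W M' W' = 0" if "delta_p p M W M' W' = 0"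
    by (rule delta_p_imp_delta_cut[OF assms(1,2,4,5) that])
  have eq: "graphon_equiv M W M' W'" if "delta_cut M W M' W' = 0"
    by (rule delta_cut_imp_graphon_equiv[OF assms(2-5) that])
  show ?thesis using via equiv cut eq by blast
qed

end
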